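(* Let $A\subset\mathbb Z^{d+1}$ be a homogeneous, non-pyramidal, irreducible configuration with affine dimension $d(A)=d$, of the form $A=\{(1,a'):a'\in A'\}$ with $A'\subset\mathbb Z^d$ a finite configuration whose differences generate $\mathbb Z^d$ as a group. Then $\theta(A)\le (m(A)-2)/2$. Moreover, for the cases of maximal possible defect: 1. If $m(A)=2k$ is even and $\theta(A)=k-1$, then $A$ is affinely equivalent to a join of $k$ non-defective configurations $A_0,\dots,A_{k-1}$ with $m(A_j)=2$ for all $j$. 2. If $m(A)=2k+1$ is odd and $\theta(A)=k-1$, then either $A$ is affinely equivalent to a join of $k$ non-defective configurations $A_0,\dots,A_{k-1}$ with $m(A_0)=3$ and $m(A_j)=2$ for $j\ge1$, or $A$ is affinely equivalent to a Cayley configuration $A_0\ast\cdots\ast A_k$ of $k+1$ configurations of codimension $2$ and with $c(A_0,\dots,A_k)=1$.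
   Context: Configurations are finite indexed families of not necessarily distinct vectors; $A=\{a_1,\dots,a_n\}$ is identified with the matrix with columns $a_i$. $n(A)=n$ is the cardinality, $d(A)$ is the dimension of the affine span, and $m(A)=n(A)-d(A)-1$ is called the codimension of $A$. $A$ is homogeneous if $(1,\dots,1)$ lies in the rational row span of the matrix; it is a pyramid if some affine hyperplane contains all points of $A$ except one, and non-pyramidal otherwise. For a configuration $C\subset \mathbb Z^e$ write $\overline C=\{(1,x):x\in C\}$. Gale dual of a homogeneous $A$: $B=\{b_1,\dots,b_n\}\subset\mathbb Q^{m(A)}$, the rows of a matrix whose columns are a basis of $\ker_{\mathbb Q}(A)$. $L(\cdot)$ is $\mathbb Q$-linear span. $A$ is irreducible if any two elements (with different indices) of a Gale dual are linearly independent. A configuration $C$ is dual-homogeneous if $\sum_{b\in C}b=0$. Cayley decomposition of $B$ of length $r\ge 0$: a partition $B=B_0\cup\dots\cup B_r$ into nonempty dual-homogeneous subconfigurations; $c(B_0,\dots,B_r)=\sum_j\dim L(B_j)-\dim L(B)$; $\theta(A)=\theta(B)$ is the maximum of $r-c(B_0,\dots,B_r)$ over all Cayley decompositions of $B$. A homogeneous configuration is defective if $\theta>0$ and non-defective if $\theta=0$; a configuration $C$ which is not homogeneous is called non-defective if $\overline C$ is. Cayley configuration: $A_0\ast\cdots\ast A_r$ denotes $\{e_0\}\times A_0\cup\dots\cup\{e_r\}\times A_r\subset\mathbb Z^{r+1}\times\mathbb Z^{d-r}$, with $A_j\subset\mathbb Z^{d-r}$ nonempty finite configurations and $e_0,\dots,e_r$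 the canonical basis of $\mathbb Z^{r+1}$; affine equivalence of $A$ with it is up to $\mathbb Z$-linear isomorphism and reordering. The corresponding decomposition of a Gale dual $B$ has $B_j$ equal to the elements of $B$ with indices in $\{e_j\}\times A_j$, and $c(A_0,\dots,A_r):=c(B_0,\dots,B_r)$. The Cayley configuration is a join if the sum map $\bigoplus_j\langle A_j-A_j\rangle\to\mathbb Z^{d-r}$ is an isomorphism, where $\langle A_j-A_j\rangle$ is the subgroup generated by the differences of elements of $A_j$ (a join of $k$ configurations $A_0,\dots,A_{k-1}$ has $r=k-1$).
   Formalization: In the second alternative of Case 2, "codimension 2" is taken as dim L(B_j)=2 for the pieces B_j of the Gale dual, not m(A_j)=2: the latter is impossible since the m(A_j) sum to at most m(A)=2k+1, and the literal claim fails for three copies of {0,1,3}. *)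

theory Defs
  imports
    "Jordan_Normal_Form.Matrix_Kernel"
    "HOL-Algebra.Product_Groups"
    "HOL-Library.Disjoint_Sets"
    "HOL-Library.Multiset"
begin

section \<open>Rational linear algebra\<close>

abbreviation rat_space :: "nat \<Rightarrow> (rat, rat vec) module" where
  "rat_space e \<equiv> module_vec TYPE(rat) e"

abbreviation rat_span :: "nat \<Rightarrow> rat vec set \<Rightarrow> rat vec set" where
  "rat_span e \<equiv> LinearCombinations.module.span class_ring (rat_space e)"

definition span_dim :: "nat \<Rightarrow> rat vec set \<Rightarrow> nat" where
  "span_dim e S = vectorspace.dim class_ring ((rat_space e)\<lparr>carrier := rat_span e S\<rparr>)"


section \<open>Configurations\<close>

text \<open>
  A configuration in \<open>\<int>\<^sup>e\<close> is a list of integer vectors (repetitions allowed), indexed by its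
  positions. The ambient dimension \<open>e\<close> is a separate argument and lists are understood to
  satisfy \<open>set A \<subseteq> carrier_vec e\<close>.
\<close>

type_synonym config = "int vec list"

definition config_mat :: "nat \<Rightarrow> config \<Rightarrow> rat mat" where
  "config_mat e A = map_mat rat_of_int (mat_of_cols e A)"

definition differences :: "config \<Rightarrow> int vec set" where
  "differences A = {x - y | x y. x \<in> set A \<and> y \<in> set A}"

text \<open>The dimension of an affine span is the dimension of its direction space.\<close>

definition affine_dim :: "nat \<Rightarrow> config \<Rightarrow> int" where
  "affine_dim e A = (if A = [] then - 1
     else int (span_dim e (map_vec rat_of_int ` differences A)))"

definition codim :: "nat \<Rightarrow> config \<Rightarrow> int" where
  "codim e A = int (length A) - affine_dim e A - 1"

definition homogeneous :: "nat \<Rightarrow> config \<Rightarrow> bool" where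
  "homogeneous e A \<longleftrightarrow>
     vec (length A) (\<lambda>i. 1) \<in> rat_span (length A) (set (rows (config_mat e A)))"

definition pyramid :: "nat \<Rightarrow> config \<Rightarrow> bool" where
  "pyramid e A \<longleftrightarrow>
     (\<exists>w \<in> carrier_vec e. \<exists>c. \<exists>i < length A. w \<noteq> 0\<^sub>v e \<and>
        w \<bullet> map_vec rat_of_int (A ! i) \<noteq> c \<and>
        (\<forall>j < length A. j \<noteq> i \<longrightarrow> w \<bullet> map_vec rat_of_int (A ! j) = c))"

definition homogenization :: "config \<Rightarrow> config" where
  "homogenization C = map (vCons 1) C"

definition difference_group :: "nat \<Rightarrow> config \<Rightarrow> int vec monoid" where
  "difference_group e A = subgroup_generated (monoid_vec TYPE(int) e) (differences A)"


section \<open>Gale duals\<close>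

text \<open>The elements of a Gale dual are the rows of the matrix \<open>B\<close>.\<close>

definition gale_dual :: "nat \<Rightarrow> config \<Rightarrow> rat mat \<Rightarrow> bool" where
  "gale_dual e A B \<longleftrightarrow>
     B \<in> carrier_mat (length A) (nat (codim e A)) \<and>
     distinct (cols B) \<and>
     vectorspace.basis class_ring
       ((rat_space (length A))\<lparr>carrier := mat_kernel (config_mat e A)\<rparr>) (set (cols B))"

text \<open>
  A Gale dual is unique up to right multiplication by an invertible matrix, which does not affect
  any of the quantities below; one is fixed by choice.
\<close>

definition gale :: "nat \<Rightarrow> config \<Rightarrow> rat mat" where
  "gale e A = (SOME B. gale_dual e A B)"

definition irreducible_config :: "nat \<Rightarrow> config \<Rightarrow> bool" where
  "irreducible_config e A \<longleftrightarrow>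
     (\<exists>B. gale_dual e A B \<and>
        (\<forall>i < length A. \<forall>j < length A. i \<noteq> j \<longrightarrow>
           row B i \<noteq> row B j \<and>
           \<not> module.lin_dep class_ring (rat_space (dim_col B)) {row B i, row B j}))"


section \<open>Cayley decompositions and the defect\<close>

text \<open>Subconfigurations of \<open>B\<close> are given by their sets of row indices.\<close>

definition dual_homogeneous :: "rat mat \<Rightarrow> nat set \<Rightarrow> bool" where
  "dual_homogeneous B J \<longleftrightarrow> finsum_vec TYPE(rat) (dim_col B) (row B) J = 0\<^sub>v (dim_col B)"

definition sub_dim :: "rat mat \<Rightarrow> nat set \<Rightarrow> nat" where
  "sub_dim B J = span_dim (dim_col B) (row B ` J)"

definition cayley_decomposition :: "rat mat \<Rightarrow> nat set set \<Rightarrow> bool" where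
  "cayley_decomposition B P \<longleftrightarrow>
     P \<noteq> {} \<and> partition_on {..<dim_row B} P \<and> (\<forall>J\<in>P. dual_homogeneous B J)"

definition decomposition_excess :: "rat mat \<Rightarrow> nat set set \<Rightarrow> int" where
  "decomposition_excess B P = (\<Sum>J\<in>P. int (sub_dim B J)) - int (sub_dim B {..<dim_row B})"

text \<open>A decomposition \<open>B\<^sub>0, \<dots>, B\<^sub>r\<close> has \<open>r + 1\<close> parts, so its length is \<open>card P - 1\<close>.
  For a Gale dual of a nonempty homogeneous configuration, \<open>B\<close> itself is a decomposition of length 0,
  so the maximum is over a finite nonempty set.\<close>

definition gale_defect :: "rat mat \<Rightarrow> int" where
  "gale_defect B =
     Max ((\<lambda>P. (int (card P) - 1) - decomposition_excess B P) ` {P. cayley_decomposition B P})"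

definition defect :: "nat \<Rightarrow> config \<Rightarrow> int" where
  "defect e A = gale_defect (gale e A)"

definition non_defective :: "nat \<Rightarrow> config \<Rightarrow> bool" where
  "non_defective e C \<longleftrightarrow>
     (if homogeneous e C then defect e C = 0
      else defect (Suc e) (homogenization C) = 0)"


section \<open>Cayley configurations and joins\<close>

definition cayley :: "config list \<Rightarrow> config" where
  "cayley As =
     concat (map (\<lambda>j. map (\<lambda>a. unit_vec (length As) j @\<^sub>v a) (As ! j)) [0..<length As])"

definition affinely_equivalent :: "nat \<Rightarrow> config \<Rightarrow> config \<Rightarrow> bool" where
  "affinely_equivalent N A C \<longleftrightarrow>
     (\<exists>U \<in> carrier_mat N N. invertible_mat U \<and> mset (map (\<lambda>a. U *\<^sub>v a) A) = mset C)"

text \<open>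
  \<open>A \<subseteq> \<int>\<^bsup>d+1\<^esup>\<close> is affinely equivalent to the Cayley configuration of \<open>As = [A\<^sub>0, \<dots>, A\<^sub>r]\<close>, with
  \<open>A\<^sub>j \<subseteq> \<int>\<^bsup>d-r\<^esup>\<close> nonempty; note that \<open>d - r = Suc d - length As\<close>.
\<close>

definition equivalent_to_cayley :: "nat \<Rightarrow> config \<Rightarrow> config list \<Rightarrow> bool" where
  "equivalent_to_cayley d A As \<longleftrightarrow>
     0 < length As \<and> length As \<le> Suc d \<and>
     (\<forall>C \<in> set As. C \<noteq> [] \<and> set C \<subseteq> carrier_vec (Suc d - length As)) \<and>
     affinely_equivalent (Suc d) A (cayley As)"

definition is_join :: "nat \<Rightarrow> config list \<Rightarrow> bool" where
  "is_join e As \<longleftrightarrow>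
     (\<lambda>g. finsum_vec TYPE(int) e g {..<length As})
       \<in> iso (sum_group {..<length As} (\<lambda>j. difference_group e (As ! j))) (monoid_vec TYPE(int) e)"

text \<open>The positions in \<^term>\<open>cayley As\<close> of the elements of \<open>{e\<^sub>j} \<times> A\<^sub>j\<close>.\<close>

definition cayley_block :: "config list \<Rightarrow> nat \<Rightarrow> nat set" where
  "cayley_block As j = {length (concat (take j As)) ..< length (concat (take (Suc j) As))}"

definition cayley_gale :: "nat \<Rightarrow> config list \<Rightarrow> rat mat" where
  "cayley_gale e As = gale (length As + e) (cayley As)"

definition cayley_excess :: "nat \<Rightarrow> config list \<Rightarrow> int" where
  "cayley_excess e As =
     decomposition_excess (cayley_gale e As) (cayley_block As ` {..<length As})"

text \<open>
  The codimension of the \<open>j\<close>-th constituent of a Cayley configuration, read off the decomposition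
  \<open>B = B\<^sub>0 \<union> \<dots> \<union> B\<^sub>r\<close> of its Gale dual as \<open>dim L(B\<^sub>j)\<close>: the dual-homogeneous configuration \<open>B\<^sub>j\<close> is a
  Gale dual of a homogeneous configuration of codimension \<open>dim L(B\<^sub>j)\<close>, namely \<open>A\<^sub>j\<close> modulo the
  differences of the other constituents. It coincides with the codimension of \<open>A\<^sub>j\<close> in its own
  affine span when \<open>c(A\<^sub>0, \<dots>, A\<^sub>r) = 0\<close> but not in general: the codimensions of the \<open>A\<^sub>j\<close>
  always add up to at most that of the Cayley configuration, whereas the numbers \<open>dim L(B\<^sub>j)\<close> add up
  to that codimension plus \<open>c(A\<^sub>0, \<dots>, A\<^sub>r)\<close>. For instance, three copies of \<open>{0, 1, 3} \<subseteq> \<int>\<close> form a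
  Cayley configuration of codimension 5 with \<open>c = 1\<close>; each copy has codimension 1 and
  \<open>dim L(B\<^sub>j) = 2\<close>.
\<close>

definition constituent_codim :: "nat \<Rightarrow> config list \<Rightarrow> nat \<Rightarrow> nat" where
  "constituent_codim e As j = sub_dim (cayley_gale e As) (cayley_block As j)"

end

theory Submission
  imports Defs
begin

text \<open>
  Let \<open>n\<close> be the length of \<open>A\<close>, let \<open>K\<close> be the space of its linear relations, and let the rows
  \<open>b\<^sub>1, \<dots>, b\<^sub>n\<close> of \<open>B\<close> be a Gale dual, so that the columns of \<open>B\<close> are a basis of \<open>K\<close>. Ranks of subfamilies
  of \<open>B\<close> and relations among its rows depend on \<open>K\<close> alone: a relation \<open>\<Sum> c\<^sub>i b\<^sub>i = 0\<close> says that \<open>c\<close> is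
  orthogonal to \<open>K\<close>.

  The bound. Let \<open>B\<^sub>0, \<dots>, B\<^sub>r\<close> be a Cayley decomposition with excess \<open>c\<close> that attains
  \<open>\<theta> = r - c\<close>, and let \<open>m\<close> be the codimension. A nonempty \<open>B\<^sub>j\<close> with sum 0 has two elements, as no
  \<open>b\<^sub>i\<close> vanishes, and these are independent; so \<open>dim L(B\<^sub>j) \<ge> 2\<close>. Hence
  \<open>2 (r + 1) \<le> \<Sum> dim L(B\<^sub>j) = m + c\<close>, that is \<open>2 \<theta> \<le> m - 2 - c\<close>, and \<open>c \<ge> 0\<close> by subadditivity of the
  rank. For \<open>m = 2k\<close> and \<open>\<theta> = k - 1\<close> this forces \<open>c = 0\<close>, \<open>r = k - 1\<close> and all ranks 2. For
  \<open>m = 2k + 1\<close> and \<open>\<theta> = k - 1\<close>, either \<open>c = 0\<close>, \<open>r = k - 1\<close> and the ranks are 3, 2, \<dots>, 2, or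
  \<open>c = 1\<close>, \<open>r = k\<close> and all ranks are 2. (\<open>twice_gale_defect_le\<close>,
  \<open>extremal_decomposition_even\<close>, \<open>extremal_decomposition_odd\<close>.)

  The Cayley form. That \<open>B\<^sub>j\<close> has sum 0 means that the indicator of its index set \<open>J\<^sub>j\<close> is orthogonal
  to \<open>K\<close>, so it is the restriction to \<open>A\<close> of a rational linear form \<open>h\<^sub>j\<close>. As \<open>A\<close> generates
  \<open>\<int>\<^bsup>d+1\<^esup>\<close>, the form \<open>h\<^sub>j\<close> is integral (\<open>integral_indicator_form\<close>). Choosing \<open>a\<^sub>l\<close> with index in
  \<open>J\<^sub>l\<close> gives \<open>h\<^sub>j(a\<^sub>l) = \<delta>\<^sub>j\<^sub>l\<close>, so \<open>h\<^sub>0, \<dots>, h\<^sub>r\<close> are the first rows of a unimodular matrix \<open>U\<close>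
  (\<open>complete_to_unimodular\<close>), and \<open>U\<close> maps the elements with index in \<open>J\<^sub>j\<close> into \<open>{e\<^sub>j} \<times> \<int>\<^bsup>d-r\<^esup>\<close>.

  Joins. If \<open>c = 0\<close>, then \<open>L(B)\<close> is the direct sum of the \<open>L(B\<^sub>j)\<close>, so a relation among the rows of
  \<open>B\<close> restricts to every block. The rows of the matrix of \<open>A\<close> are such relations, and their
  restrictions say that an element of \<open>K\<close> may be cut off outside a block without leaving \<open>K\<close>. This
  gives at once that the sum map of the groups \<open>\<langle>A\<^sub>j - A\<^sub>j\<rangle>\<close> is injective (\<open>is_join_As\<close>), and that the
  affine relations of \<open>A\<^sub>j\<close> are the restrictions of \<open>K\<close> to \<open>J\<^sub>j\<close>, so that \<open>B\<^sub>j\<close> is a Gale dual of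
  \<open>A\<^sub>j\<close> and \<open>m(A\<^sub>j) = dim L(B\<^sub>j)\<close> (\<open>block_gale\<close>). Finally, the bound itself, applied to \<open>A\<^sub>j\<close>, shows that
  \<open>A\<^sub>j\<close> is non-defective, because \<open>2 \<theta>(A\<^sub>j) \<le> m(A\<^sub>j) - 2 \<le> 1\<close>.
\<close>

section \<open>The matroid of a set of rational functions\<close>

text \<open>
  Here \<open>K\<close> is a set of functions on an index set. The evaluations \<open>x \<mapsto> x i\<close> restricted to \<open>K\<close> form a
  vector configuration, and its matroid is all that matters below. A configuration
  \<open>(v\<^sub>i)\<close> of vectors has the same matroid as the set \<open>K\<close> of its coordinate functions \<open>i \<mapsto> v\<^sub>i(t)\<close>, so
  one notion serves for \<open>A\<close> (with the rows of its matrix as \<open>K\<close>) and for a Gale dual (with the kernel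
  as \<open>K\<close>), and it does not depend on the choice of a Gale dual.
\<close>

definition relation_on :: "('i \<Rightarrow> rat) set \<Rightarrow> 'i set \<Rightarrow> ('i \<Rightarrow> rat) \<Rightarrow> bool" where
  "relation_on K J c \<longleftrightarrow> (\<forall>x\<in>K. (\<Sum>i\<in>J. c i * x i) = 0)"

definition indep_on :: "('i \<Rightarrow> rat) set \<Rightarrow> 'i set \<Rightarrow> bool" where
  "indep_on K I \<longleftrightarrow> (\<forall>c. relation_on K I c \<longrightarrow> (\<forall>i\<in>I. c i = 0))"

definition depends_on :: "('i \<Rightarrow> rat) set \<Rightarrow> 'i set \<Rightarrow> 'i \<Rightarrow> bool" where
  "depends_on K I j \<longleftrightarrow> (\<exists>c. \<forall>x\<in>K. x j = (\<Sum>i\<in>I. c i * x i))"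

definition basis_on :: "('i \<Rightarrow> rat) set \<Rightarrow> 'i set \<Rightarrow> 'i set \<Rightarrow> bool" where
  "basis_on K J I \<longleftrightarrow> I \<subseteq> J \<and> indep_on K I \<and> (\<forall>j\<in>J. depends_on K I j)"

lemma indep_onD: "indep_on K I \<Longrightarrow> (\<And>x. x \<in> K \<Longrightarrow> (\<Sum>i\<in>I. c i * x i) = 0) \<Longrightarrow> i \<in> I \<Longrightarrow> c i = 0"
  unfolding indep_on_def relation_on_def by blast

lemma basis_onD:
  assumes "basis_on K J I"
  shows "I \<subseteq> J" "indep_on K I" "j \<in> J \<Longrightarrow> depends_on K I j"
  using assms unfolding basis_on_def by auto

lemma depends_onI: "(\<And>x. x \<in> K \<Longrightarrow> x j = (\<Sum>i\<in>I. c i * x i)) \<Longrightarrow> depends_on K I j"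
  unfolding depends_on_def by auto

lemma depends_onE:
  assumes "depends_on K I j"
  obtains c where "\<And>x. x \<in> K \<Longrightarrow> x j = (\<Sum>i\<in>I. c i * x i)"
  using assms unfolding depends_on_def by auto

lemma depends_on_self:
  assumes "finite I" "j \<in> I" shows "depends_on K I j"
  unfolding depends_on_def
proof (intro exI ballI)
  fix x assume "x \<in> K"
  have "(\<Sum>i\<in>I. (if i = j then 1 else 0) * x i) = (\<Sum>i\<in>I. if i = j then x i else 0)"
    by (rule sum.cong) auto
  then show "x j = (\<Sum>i\<in>I. (if i = j then 1 else 0) * x i)"
    using assms by simp
qed

lemma depends_on_trans:
  assumes "depends_on K I j" "\<And>i. i \<in> I \<Longrightarrow> depends_on K I' i"
  shows "depends_on K I' j"
proof -
  obtain c where c: "\<And>x. x \<in> K \<Longrightarrow> x j = (\<Sum>i\<in>I. c i * x i)"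
    using assms(1) by (rule depends_onE) auto
  obtain D where D: "\<And>i x. i \<in> I \<Longrightarrow> x \<in> K \<Longrightarrow> x i = (\<Sum>l\<in>I'. D i l * x l)"
    using assms(2) unfolding depends_on_def by metis
  have "x j = (\<Sum>l\<in>I'. (\<Sum>i\<in>I. c i * D i l) * x l)" if x: "x \<in> K" for x
  proof -
    have "x j = (\<Sum>i\<in>I. c i * (\<Sum>l\<in>I'. D i l * x l))"
      using c[OF x] D[OF _ x] by simp
    also have "\<dots> = (\<Sum>i\<in>I. \<Sum>l\<in>I'. c i * D i l * x l)"
      by (simp add: sum_distrib_left mult.assoc)
    also have "\<dots> = (\<Sum>l\<in>I'. \<Sum>i\<in>I. c i * D i l * x l)"
      by (rule sum.swap)
    finally show ?thesis by (simp add: sum_distrib_right)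
  qed
  then show ?thesis by (rule depends_onI)
qed

lemma depends_on_if_insert_dependent:
  assumes I: "finite I" "indep_on K I" and not: "\<not> indep_on K (insert j I)"
  shows "depends_on K I j"
proof (cases "j \<in> I")
  case True then show ?thesis using depends_on_self[OF I(1)] by simp
next
  case False
  obtain c i where c: "\<And>x. x \<in> K \<Longrightarrow> (\<Sum>i\<in>insert j I. c i * x i) = 0" and i: "i \<in> insert j I" "c i \<noteq> 0"
    using not unfolding indep_on_def relation_on_def by blast
  have eq: "c j * x j + (\<Sum>i\<in>I. c i * x i) = 0" if "x \<in> K" for x
    using c[OF that] False I by simp
  have cj: "c j \<noteq> 0"
  proof
    assume "c j = 0"
    then have "c i = 0" if "i \<in> I" for i
      using indep_onD[OF I(2), of c i] eq that by simp
    with \<open>c j = 0\<close> i show False by auto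
  qed
  have "x j = (\<Sum>i\<in>I. (- c i / c j) * x i)" if x: "x \<in> K" for x
  proof -
    have "(\<Sum>i\<in>I. (- c i / c j) * x i) = (- 1 / c j) * (\<Sum>i\<in>I. c i * x i)"
      by (simp add: sum_distrib_left)
    also have "(\<Sum>i\<in>I. c i * x i) = - c j * x j" using eq[OF x] by linarith
    finally show ?thesis using cj by simp
  qed
  then show ?thesis by (rule depends_onI)
qed

lemma indep_extends_to_basis:
  assumes J: "finite J" and I0: "I0 \<subseteq> J" "indep_on K I0"
  obtains I where "I0 \<subseteq> I" "basis_on K J I"
proof -
  let ?F = "{I. I0 \<subseteq> I \<and> I \<subseteq> J \<and> indep_on K I}"
  have "finite ?F" using J by (intro finite_subset[of ?F "Pow J"]) auto
  moreover have "I0 \<in> ?F" using I0 by auto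
  ultimately have "\<exists>I\<in>?F. I0 \<subseteq> I \<and> (\<forall>I'\<in>?F. I \<subseteq> I' \<longrightarrow> I = I')"
    by (rule finite_has_maximal2)
  then obtain I where I: "I \<in> ?F" and max: "\<And>I'. I' \<in> ?F \<Longrightarrow> I \<subseteq> I' \<Longrightarrow> I = I'"
    by (elim bexE conjE) auto
  have fin: "finite I" using I J finite_subset by auto
  have "depends_on K I j" if j: "j \<in> J" for j
  proof (cases "j \<in> I")
    case True then show ?thesis using depends_on_self[OF fin] by simp
  next
    case False
    then have "\<not> indep_on K (insert j I)" using max[of "insert j I"] I j by auto
    with depends_on_if_insert_dependent[OF fin] I show ?thesis by simp
  qed
  then show ?thesis using I by (intro that[of I]) (auto simp: basis_on_def)
qed

lemma basis_on_exists:
  assumes "finite J"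
  obtains I where "basis_on K J I"
  using indep_extends_to_basis[OF assms, of "{}" K] unfolding indep_on_def by auto

text \<open>
  The matroid on \<open>J\<close> depends only on the linear span of the restrictions of \<open>K\<close> to \<open>J\<close>, which is
  why a set of generators may replace a space of relations.
\<close>

lemma basis_on_cong_span:
  assumes sub: "\<And>x. x \<in> K \<Longrightarrow> \<exists>x'\<in>K'. \<forall>i\<in>J. x' i = x i"
    and comb: "\<And>x'. x' \<in> K' \<Longrightarrow> \<exists>S y. (\<forall>l\<in>S. f l \<in> K) \<and> (\<forall>i\<in>J. x' i = (\<Sum>l\<in>S. y l * f l i))"
  shows "I \<subseteq> J \<Longrightarrow> relation_on K I c \<longleftrightarrow> relation_on K' I c"
    and "I \<subseteq> J \<Longrightarrow> indep_on K I \<longleftrightarrow> indep_on K' I"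
    and "basis_on K J I \<longleftrightarrow> basis_on K' J I"
proof -
  show rel: "relation_on K I c \<longleftrightarrow> relation_on K' I c" if I: "I \<subseteq> J" for I c
  proof
    assume R: "relation_on K I c"
    show "relation_on K' I c" unfolding relation_on_def
    proof
      fix x' assume "x' \<in> K'"
      then obtain S y where S: "\<And>l. l \<in> S \<Longrightarrow> f l \<in> K" and x': "\<And>i. i \<in> J \<Longrightarrow> x' i = (\<Sum>l\<in>S. y l * f l i)"
        using comb[OF \<open>x' \<in> K'\<close>] by (elim exE conjE) (rule that; simp)
      have "(\<Sum>i\<in>I. c i * x' i) = (\<Sum>i\<in>I. \<Sum>l\<in>S. y l * (c i * f l i))"
        using x' I by (intro sum.cong) (auto simp: sum_distrib_left algebra_simps)
      also have "\<dots> = (\<Sum>l\<in>S. y l * (\<Sum>i\<in>I. c i * f l i))"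
        by (subst sum.swap) (simp add: sum_distrib_left)
      also have "\<dots> = 0" using R S unfolding relation_on_def by simp
      finally show "(\<Sum>i\<in>I. c i * x' i) = 0" .
    qed
  next
    assume R: "relation_on K' I c"
    show "relation_on K I c" unfolding relation_on_def
    proof
      fix x assume "x \<in> K"
      then obtain x' where x': "x' \<in> K'" "\<And>i. i \<in> J \<Longrightarrow> x' i = x i" using sub by blast
      have "(\<Sum>i\<in>I. c i * x i) = (\<Sum>i\<in>I. c i * x' i)" using x' I by (intro sum.cong) auto
      then show "(\<Sum>i\<in>I. c i * x i) = 0" using R x' unfolding relation_on_def by simp
    qed
  qed
  then show ind: "indep_on K I \<longleftrightarrow> indep_on K' I" if "I \<subseteq> J" for I
    using that unfolding indep_on_def by blast
  have dep: "depends_on K I j \<longleftrightarrow> depends_on K' I j" if I: "I \<subseteq> J" and j: "j \<in> J" for j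
  proof
    assume "depends_on K I j"
    then obtain c where c: "\<And>x. x \<in> K \<Longrightarrow> x j = (\<Sum>i\<in>I. c i * x i)" by (rule depends_onE) auto
    have "x' j = (\<Sum>i\<in>I. c i * x' i)" if x': "x' \<in> K'" for x'
    proof -
      obtain S y where S: "\<And>l. l \<in> S \<Longrightarrow> f l \<in> K" and x': "\<And>i. i \<in> J \<Longrightarrow> x' i = (\<Sum>l\<in>S. y l * f l i)"
        using comb[OF x'] by (elim exE conjE) (rule that; simp)
      have "x' j = (\<Sum>l\<in>S. y l * (\<Sum>i\<in>I. c i * f l i))" using x'[OF j] c S by simp
      also have "\<dots> = (\<Sum>i\<in>I. \<Sum>l\<in>S. c i * (y l * f l i))"
        by (subst sum.swap) (simp add: sum_distrib_left algebra_simps)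
      also have "\<dots> = (\<Sum>i\<in>I. c i * x' i)"
        using x' I by (intro sum.cong) (auto simp: sum_distrib_left)
      finally show ?thesis .
    qed
    then show "depends_on K' I j" by (rule depends_onI)
  next
    assume "depends_on K' I j"
    then obtain c where c: "\<And>x. x \<in> K' \<Longrightarrow> x j = (\<Sum>i\<in>I. c i * x i)" by (rule depends_onE) auto
    have "x j = (\<Sum>i\<in>I. c i * x i)" if x: "x \<in> K" for x
    proof -
      obtain x' where x': "x' \<in> K'" "\<And>i. i \<in> J \<Longrightarrow> x' i = x i" using sub[OF x] by blast
      have "(\<Sum>i\<in>I. c i * x i) = (\<Sum>i\<in>I. c i * x' i)" using x' I by (intro sum.cong) auto
      then show ?thesis using c[OF x'(1)] x'(2)[OF j] by simp
    qed
    then show "depends_on K I j" by (rule depends_onI)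
  qed
  show "basis_on K J I \<longleftrightarrow> basis_on K' J I"
    using ind[of I] dep unfolding basis_on_def by auto
qed

text \<open>
  Matroid duality on a block \<open>J\<close>, where \<open>R\<close> and \<open>K\<close> are orthogonal complements: a basis \<open>I\<close> for \<open>R\<close>
  gives for every \<open>j \<in> J - I\<close> a circuit \<open>\<kappa>\<^sub>j \<in> K\<close> supported on \<open>I \<union> {j}\<close> with value 1 at \<open>j\<close>. These
  circuits are dual to the evaluations at \<open>J - I\<close>, and they determine the values at \<open>I\<close>.
\<close>

lemma fundamental_circuits:
  assumes J: "finite J" and B: "basis_on R J I"
  obtains \<kappa> where "\<And>j. j \<in> J - I \<Longrightarrow> relation_on R J (\<kappa> j)"
    and "\<And>j l. j \<in> J - I \<Longrightarrow> l \<in> J - I \<Longrightarrow> \<kappa> j l = (if l = j then 1 else 0)"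
    and "\<And>x i. relation_on R J x \<Longrightarrow> i \<in> J \<Longrightarrow> x i = (\<Sum>j\<in>J - I. x j * \<kappa> j i)"
proof -
  note IJ = basis_onD(1)[OF B]
  have fin: "finite I" using IJ J finite_subset by auto
  obtain D where D: "\<And>j x. j \<in> J \<Longrightarrow> x \<in> R \<Longrightarrow> x j = (\<Sum>i\<in>I. D j i * x i)"
    using basis_onD(3)[OF B] unfolding depends_on_def by metis
  \<comment> \<open>\<open>x j - \<Sum>\<^sub>I D j i x i = 0\<close> on \<open>R\<close>, read as a relation with support in \<open>I \<union> {j}\<close>\<close>
  define \<kappa> where "\<kappa> j i = (if i = j then 1 else if i \<in> I then - D j i else 0)" for j i
  have rel: "relation_on R J (\<kappa> j)" if j: "j \<in> J - I" for j
    unfolding relation_on_def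
  proof
    fix x assume x: "x \<in> R"
    have "(\<Sum>i\<in>J. \<kappa> j i * x i) = (\<Sum>i\<in>insert j I. \<kappa> j i * x i)"
      using J IJ j by (intro sum.mono_neutral_right) (auto simp: \<kappa>_def)
    also have "\<dots> = \<kappa> j j * x j + (\<Sum>i\<in>I. \<kappa> j i * x i)"
      using fin j by simp
    also have "(\<Sum>i\<in>I. \<kappa> j i * x i) = (\<Sum>i\<in>I. - (D j i * x i))"
      using j by (intro sum.cong) (auto simp: \<kappa>_def)
    also have "\<dots> = - x j" using D[of j x] j x by (simp add: sum_negf)
    finally show "(\<Sum>i\<in>J. \<kappa> j i * x i) = 0" by (simp add: \<kappa>_def)
  qed
  have dual: "\<kappa> j l = (if l = j then 1 else 0)" if "j \<in> J - I" "l \<in> J - I" for j l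
    using that by (auto simp: \<kappa>_def)
  have exp: "x i = (\<Sum>j\<in>J - I. x j * \<kappa> j i)" if x: "relation_on R J x" and i: "i \<in> J" for x i
  proof -
    \<comment> \<open>the difference is a relation supported on the independent set \<open>I\<close>\<close>
    define z where "z i = x i - (\<Sum>j\<in>J - I. x j * \<kappa> j i)" for i
    have z0: "z l = 0" if l: "l \<in> J - I" for l
    proof -
      have "(\<Sum>j\<in>J - I. x j * \<kappa> j l) = (\<Sum>j\<in>J - I. if j = l then x j else 0)"
        using l by (intro sum.cong) (auto simp: dual)
      then show ?thesis using J l by (simp add: z_def)
    qed
    have "(\<Sum>i\<in>I. z i * y i) = 0" if y: "y \<in> R" for y
    proof -
      have "(\<Sum>i\<in>I. z i * y i) = (\<Sum>i\<in>J. z i * y i)"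
        using J IJ z0 by (intro sum.mono_neutral_left) auto
      also have "\<dots> = (\<Sum>i\<in>J. x i * y i) - (\<Sum>i\<in>J. \<Sum>j\<in>J - I. x j * (\<kappa> j i * y i))"
        by (simp add: z_def algebra_simps sum_subtractf sum_distrib_left)
      also have "(\<Sum>i\<in>J. \<Sum>j\<in>J - I. x j * (\<kappa> j i * y i)) = (\<Sum>j\<in>J - I. x j * (\<Sum>i\<in>J. \<kappa> j i * y i))"
        by (subst sum.swap) (simp add: sum_distrib_left)
      also have "\<dots> = 0" using rel y unfolding relation_on_def by simp
      finally show ?thesis using x y unfolding relation_on_def by simp
    qed
    then have "z i = 0" if "i \<in> I" for i
      using indep_onD[OF basis_onD(2)[OF B], of z i] that by blast
    with z0 i have "z i = 0" by auto
    then show ?thesis by (simp add: z_def)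
  qed
  show ?thesis using rel dual exp by (rule that)
qed

lemma dual_basis_on:
  assumes J: "finite J" and B: "basis_on R J I"
    and K: "\<And>x. x \<in> K \<Longrightarrow> relation_on R J x"
    and K': "\<And>x. relation_on R J x \<Longrightarrow> \<exists>x'\<in>K. \<forall>i\<in>J. x' i = x i"
  shows "basis_on K J (J - I)"
proof -
  obtain \<kappa> where \<kappa>: "\<And>j. j \<in> J - I \<Longrightarrow> relation_on R J (\<kappa> j)"
    "\<And>j l. j \<in> J - I \<Longrightarrow> l \<in> J - I \<Longrightarrow> \<kappa> j l = (if l = j then 1 else 0)"
    "\<And>x i. relation_on R J x \<Longrightarrow> i \<in> J \<Longrightarrow> x i = (\<Sum>j\<in>J - I. x j * \<kappa> j i)"
    by (rule fundamental_circuits[OF J B], rule that)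
  have "indep_on K (J - I)"
    unfolding indep_on_def
  proof (intro allI impI ballI)
    fix c j assume c: "relation_on K (J - I) c" and j: "j \<in> J - I"
    obtain x where x: "x \<in> K" "\<And>i. i \<in> J \<Longrightarrow> x i = \<kappa> j i" using K'[OF \<kappa>(1)[OF j]] by blast
    have "0 = (\<Sum>l\<in>J - I. c l * x l)" using bspec[OF c[unfolded relation_on_def] x(1)] by simp
    also have "\<dots> = (\<Sum>l\<in>J - I. if l = j then c l else 0)"
      using x \<kappa>(2)[OF j] by (intro sum.cong) auto
    also have "\<dots> = c j" using J j by simp
    finally show "c j = 0" by simp
  qed
  moreover have "depends_on K (J - I) i" if i: "i \<in> J" for i
    unfolding depends_on_def
    using \<kappa>(3)[OF K i] by (intro exI[of _ "\<lambda>j. \<kappa> j i"]) (simp add: mult.commute)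
  ultimately show ?thesis unfolding basis_on_def by auto
qed

text \<open>
  The Fredholm alternative, by induction on \<open>p\<close>: either \<open>f p\<close>
  vanishes on the common kernel of the others and can be dropped, or that kernel contains some \<open>v\<close>
  with \<open>f p v \<noteq> 0\<close>, and a multiple of \<open>f p\<close> can be subtracted from \<open>g\<close> to make it vanish at \<open>v\<close>.
\<close>

lemma orthogonal_to_relations_imp_combination:
  fixes f :: "nat \<Rightarrow> 'i \<Rightarrow> rat"
  assumes E: "finite E"
    and "\<And>x. (\<forall>t<p. (\<Sum>i\<in>E. f t i * x i) = 0) \<Longrightarrow> (\<Sum>i\<in>E. g i * x i) = 0"
  shows "\<exists>h. \<forall>i\<in>E. g i = (\<Sum>t<p. h t * f t i)"
  using assms(2)
proof (induction p arbitrary: g)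
  case 0
  have "g i = 0" if "i \<in> E" for i
  proof -
    have "(\<Sum>l\<in>E. g l * (if l = i then 1 else 0)) = (\<Sum>l\<in>E. if l = i then g l else 0)"
      by (rule sum.cong) auto
    then show ?thesis using 0[of "\<lambda>l. if l = i then 1 else 0"] that E by simp
  qed
  then show ?case by simp
next
  case (Suc p)
  show ?case
  proof (cases "\<exists>v. (\<forall>t<p. (\<Sum>i\<in>E. f t i * v i) = 0) \<and> (\<Sum>i\<in>E. f p i * v i) \<noteq> 0")
    case False
    have "\<exists>h. \<forall>i\<in>E. g i = (\<Sum>t<p. h t * f t i)"
      using False by (intro Suc.IH Suc.prems) (auto simp: less_Suc_eq)
    then obtain h where h: "\<forall>i\<in>E. g i = (\<Sum>t<p. h t * f t i)" by blast
    then show ?thesis by (intro exI[of _ "h(p := 0)"]) auto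
  next
    case True
    then obtain v where v: "\<And>t. t < p \<Longrightarrow> (\<Sum>i\<in>E. f t i * v i) = 0" and vp: "(\<Sum>i\<in>E. f p i * v i) \<noteq> 0"
      by blast
    define q where "q = (\<Sum>i\<in>E. f p i * v i)"
    define a where "a = (\<Sum>i\<in>E. g i * v i) / q"
    have lin: "(\<Sum>i\<in>E. u i * (x i - b * v i)) = (\<Sum>i\<in>E. u i * x i) - b * (\<Sum>i\<in>E. u i * v i)"
      for u x b by (simp add: algebra_simps sum_subtractf sum_distrib_left)
    have "\<exists>h. \<forall>i\<in>E. g i - a * f p i = (\<Sum>t<p. h t * f t i)"
    proof (rule Suc.IH)
      fix x assume x: "\<forall>t<p. (\<Sum>i\<in>E. f t i * x i) = 0"
      define b where "b = (\<Sum>i\<in>E. f p i * x i) / q"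
      have bq: "b * q = (\<Sum>i\<in>E. f p i * x i)" using vp by (simp add: b_def q_def)
      have "(\<Sum>i\<in>E. g i * (x i - b * v i)) = 0"
      proof (rule Suc.prems, intro allI impI)
        fix t assume "t < Suc p"
        then show "(\<Sum>i\<in>E. f t i * (x i - b * v i)) = 0"
          using x v bq unfolding lin less_Suc_eq q_def by auto
      qed
      then have "(\<Sum>i\<in>E. g i * x i) = b * (\<Sum>i\<in>E. g i * v i)" by (simp add: lin)
      also have "\<dots> = a * (\<Sum>i\<in>E. f p i * x i)"
        using vp unfolding bq[symmetric] by (simp add: a_def q_def)
      finally show "(\<Sum>i\<in>E. (g i - a * f p i) * x i) = 0"
        by (simp add: algebra_simps sum_subtractf sum_distrib_left)
    qed
    then obtain h where "\<forall>i\<in>E. g i - a * f p i = (\<Sum>t<p. h t * f t i)" by blast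
    then show ?thesis by (intro exI[of _ "h(p := a)"]) (auto simp: algebra_simps)
  qed
qed

text \<open>
  Blocks \<open>J \<in> P\<close> have bases \<open>T J\<close>, whose union generates everything. It is a basis as soon as
  the ranks add up, and then a relation on the union of the blocks restricts to each block.
\<close>

lemma block_bases:
  assumes P: "partition_on E P" and E: "finite E"
    and T: "\<And>J. J \<in> P \<Longrightarrow> basis_on K J (T J)"
  obtains I where "basis_on K E I" "I \<subseteq> \<Union>(T ` P)" "card (\<Union>(T ` P)) = (\<Sum>J\<in>P. card (T J))"
proof -
  have finP: "finite P" using P E finite_elements by blast
  have sub: "T J \<subseteq> J" if "J \<in> P" for J using basis_onD(1)[OF T[OF that]] .
  have JE: "J \<subseteq> E" if "J \<in> P" for J using P that unfolding partition_on_def by auto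
  have U: "\<Union>(T ` P) \<subseteq> E" using sub JE by blast
  then have finU: "finite (\<Union>(T ` P))" using E finite_subset by blast
  obtain I where I: "basis_on K (\<Union>(T ` P)) I" using basis_on_exists[OF finU] .
  have "depends_on K I i" if i: "i \<in> E" for i
  proof -
    obtain J where J: "J \<in> P" "i \<in> J" using P i unfolding partition_on_def by blast
    show ?thesis using basis_onD(3)[OF T[OF J(1)] J(2)]
      by (rule depends_on_trans) (use basis_onD(3)[OF I] J in auto)
  qed
  moreover have "I \<subseteq> E" using basis_onD(1)[OF I] U by (rule subset_trans)
  ultimately have "basis_on K E I"
    using basis_onD(2)[OF I] unfolding basis_on_def by simp
  moreover have "card (\<Union>(T ` P)) = (\<Sum>J\<in>P. card (T J))"
  proof (rule card_UN_disjoint[OF finP])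
    show "\<forall>J\<in>P. finite (T J)" using finite_subset[OF UN_upper finU] by simp
    show "\<forall>J\<in>P. \<forall>J'\<in>P. J \<noteq> J' \<longrightarrow> T J \<inter> T J' = {}"
    proof (intro ballI impI)
      fix J J' assume "J \<in> P" "J' \<in> P" "J \<noteq> J'"
      then show "T J \<inter> T J' = {}"
        using disjointD[OF partition_onD2[OF P], of J J'] sub[of J] sub[of J'] by auto
    qed
  qed
  ultimately show ?thesis using basis_onD(1)[OF I] by (intro that)
qed

lemma relation_restricts_to_blocks:
  assumes P: "partition_on E P" and E: "finite E"
    and T: "\<And>J. J \<in> P \<Longrightarrow> basis_on K J (T J)" and I: "indep_on K (\<Union>(T ` P))"
    and c: "relation_on K E c" and J: "J \<in> P"
  shows "relation_on K J c"
proof -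
  have finP: "finite P" using P E finite_elements by blast
  have sub: "T J \<subseteq> J" if "J \<in> P" for J using basis_onD(1)[OF T[OF that]] .
  have JE: "J \<subseteq> E" if "J \<in> P" for J using P that unfolding partition_on_def by auto
  have finJ: "finite J" if "J \<in> P" for J using JE[OF that] E finite_subset by blast
  have finT: "finite (T J)" if "J \<in> P" for J using finJ[OF that] sub[OF that] finite_subset by blast
  have disj: "J = J'" if "J \<in> P" "J' \<in> P" "i \<in> J" "i \<in> J'" for i J J'
    using P that unfolding partition_on_def disjoint_def by blast
  have "\<exists>D. \<forall>x\<in>K. (\<Sum>i\<in>J. c i * x i) = (\<Sum>l\<in>T J. D l * x l)" if J: "J \<in> P" for J
  proof -
    have "\<forall>i\<in>J. \<exists>d. \<forall>x\<in>K. x i = (\<Sum>l\<in>T J. d l * x l)"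
      using basis_onD(3)[OF T[OF J]] unfolding depends_on_def by simp
    from bchoice[OF this] obtain d where "\<forall>i\<in>J. \<forall>x\<in>K. x i = (\<Sum>l\<in>T J. d i l * x l)" ..
    then have d: "\<And>i x. i \<in> J \<Longrightarrow> x \<in> K \<Longrightarrow> x i = (\<Sum>l\<in>T J. d i l * x l)" by simp
    have "(\<Sum>i\<in>J. c i * x i) = (\<Sum>l\<in>T J. (\<Sum>i\<in>J. c i * d i l) * x l)" if x: "x \<in> K" for x
    proof -
      have "(\<Sum>i\<in>J. c i * x i) = (\<Sum>i\<in>J. \<Sum>l\<in>T J. c i * d i l * x l)"
        using d[OF _ x] by (intro sum.cong) (auto simp: sum_distrib_left mult.assoc)
      also have "\<dots> = (\<Sum>l\<in>T J. \<Sum>i\<in>J. c i * d i l * x l)" by (rule sum.swap)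
      finally show ?thesis by (simp add: sum_distrib_right)
    qed
    then show ?thesis by (intro exI[of _ "\<lambda>l. \<Sum>i\<in>J. c i * d i l"]) simp
  qed
  then obtain D where D: "\<And>J x. J \<in> P \<Longrightarrow> x \<in> K \<Longrightarrow> (\<Sum>i\<in>J. c i * x i) = (\<Sum>l\<in>T J. D J l * x l)"
    by metis
  \<comment> \<open>\<open>b l\<close> is the block that contains \<open>l\<close>\<close>
  define b where "b l = (THE J. J \<in> P \<and> l \<in> J)" for l
  have b: "b l = J" if "J \<in> P" "l \<in> J" for l J
    unfolding b_def using that disj by (intro the_equality) auto
  have TT: "\<forall>J\<in>P. \<forall>J'\<in>P. J \<noteq> J' \<longrightarrow> T J \<inter> T J' = {}"
  proof (intro ballI impI)
    fix J J' assume "J \<in> P" "J' \<in> P" "J \<noteq> J'"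
    then show "T J \<inter> T J' = {}"
      using disjointD[OF partition_onD2[OF P], of J J'] sub[of J] sub[of J'] by auto
  qed
  have PP: "\<forall>J\<in>P. \<forall>J'\<in>P. J \<noteq> J' \<longrightarrow> J \<inter> J' = {}" using disj by blast
  have "(\<Sum>l\<in>\<Union>(T ` P). D (b l) l * x l) = 0" if x: "x \<in> K" for x
  proof -
    have "(\<Sum>l\<in>\<Union>(T ` P). D (b l) l * x l) = (\<Sum>J\<in>P. \<Sum>l\<in>T J. D (b l) l * x l)"
      using finP finT TT by (intro sum.UNION_disjoint) auto
    also have "\<dots> = (\<Sum>J\<in>P. \<Sum>i\<in>J. c i * x i)"
    proof (rule sum.cong[OF refl])
      fix J assume J: "J \<in> P"
      have "(\<Sum>l\<in>T J. D (b l) l * x l) = (\<Sum>l\<in>T J. D J l * x l)"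
        using b[OF J] sub[OF J] by (intro sum.cong) auto
      then show "(\<Sum>l\<in>T J. D (b l) l * x l) = (\<Sum>i\<in>J. c i * x i)" using D[OF J x] by simp
    qed
    also have "\<dots> = (\<Sum>i\<in>\<Union>P. c i * x i)"
      using sum.UNION_disjoint[of P "\<lambda>J. J" "\<lambda>i. c i * x i"] finP finJ PP by auto
    also have "\<Union>P = E" using P unfolding partition_on_def by simp
    also have "(\<Sum>i\<in>E. c i * x i) = 0" using c x unfolding relation_on_def by simp
    finally show ?thesis .
  qed
  then have "D J l = 0" if "l \<in> T J" for l
    using indep_onD[OF I, of "\<lambda>l. D (b l) l" l] that J b[OF J, of l] sub[OF J] by auto
  then show ?thesis using D[OF J] unfolding relation_on_def by simp
qed

section \<open>Rank of a family of rational vectors\<close>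

text \<open>
  This section identifies \<open>span_dim\<close> with the matroid rank of the coordinate functions. Families,
  unlike sets of vectors, keep repeated elements apart.
\<close>

definition coordinates :: "nat \<Rightarrow> ('i \<Rightarrow> rat vec) \<Rightarrow> ('i \<Rightarrow> rat) set" where
  "coordinates e v = (\<lambda>t i. v i $ t) ` {..<e}"

context
  fixes e :: nat
begin

interpretation V: vec_space "TYPE(rat)" e .

lemma lincomb_family_index:
  assumes I: "finite I" "inj_on v I" "v ` I \<subseteq> carrier_vec e" and t: "t < e"
  shows "V.lincomb a (v ` I) $ t = (\<Sum>i\<in>I. a (v i) * v i $ t)"
  using V.lincomb_index[OF t I(3), of a] sum.reindex[OF I(2), of "\<lambda>x. a x * x $ t"] by simp

lemma lin_indpt_iff_indep_on:
  assumes I: "finite I" "inj_on v I" "v ` I \<subseteq> carrier_vec e"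
  shows "V.lin_indpt (v ` I) \<longleftrightarrow> indep_on (coordinates e v) I"
proof
  assume ind: "V.lin_indpt (v ` I)"
  show "indep_on (coordinates e v) I"
    unfolding indep_on_def
  proof (intro allI impI)
    fix c assume c: "relation_on (coordinates e v) I c"
    define a where "a = c \<circ> inv_into I v"
    have a: "a (v i) = c i" if "i \<in> I" for i using I(2) that by (simp add: a_def)
    have "V.lincomb a (v ` I) = 0\<^sub>v e"
    proof (rule eq_vecI)
      fix t assume "t < dim_vec (0\<^sub>v e :: rat vec)"
      then have t: "t < e" by simp
      have "V.lincomb a (v ` I) $ t = (\<Sum>i\<in>I. c i * v i $ t)"
        using lincomb_family_index[OF I t] a by simp
      also have "\<dots> = 0" using c t unfolding relation_on_def coordinates_def by simp
      finally show "V.lincomb a (v ` I) $ t = 0\<^sub>v e $ t" using t by simp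
    qed (use I(3) V.lincomb_dim[OF _ I(3)] I(1) in simp)
    then have "a \<in> v ` I \<rightarrow> {0}"
      using V.not_lindepD[OF ind, of "v ` I" a] I(1) by simp
    then show "\<forall>i\<in>I. c i = 0" using a by (metis Pi_mem imageI singletonD)
  qed
next
  assume ind: "indep_on (coordinates e v) I"
  show "V.lin_indpt (v ` I)"
  proof (rule V.finite_lin_indpt2)
    fix a :: "rat vec \<Rightarrow> rat" assume "V.lincomb a (v ` I) = 0\<^sub>v e"
    then have 0: "V.lincomb a (v ` I) $ t = 0" if "t < e" for t using that by simp
    have "a (v i) = 0" if i: "i \<in> I" for i
      using indep_onD[OF ind, of "\<lambda>i. a (v i)" i] i lincomb_family_index[OF I] 0
      unfolding coordinates_def by auto
    then show "\<forall>x\<in>v ` I. a x = 0" by simp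
  qed (use I in auto)
qed

lemma indep_on_coordinates_inj_on:
  assumes "finite I" and ind: "indep_on (coordinates e v) I"
  shows "inj_on v I"
proof (rule inj_onI, rule ccontr)
  fix i j assume ij: "i \<in> I" "j \<in> I" "v i = v j" "i \<noteq> j"
  define c where "c l = (if l = i then 1 else if l = j then -1 else 0 :: rat)" for l
  have "(\<Sum>l\<in>I. c l * v l $ t) = 0" for t
  proof -
    have "(\<Sum>l\<in>I. c l * v l $ t) = (\<Sum>l\<in>{i, j}. c l * v l $ t)"
      using ij(1,2) assms(1) by (intro sum.mono_neutral_right) (auto simp: c_def)
    also have "\<dots> = c i * v i $ t + c j * v j $ t" using ij(4) by simp
    also have "\<dots> = 0" unfolding ij(3) using ij(4) by (simp add: c_def)
    finally show ?thesis .
  qed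
  then have "relation_on (coordinates e v) I c"
    unfolding relation_on_def coordinates_def by simp
  then have "c i = 0" using ind ij(1) unfolding indep_on_def by simp
  then show False by (simp add: c_def)
qed

lemma in_span_if_depends_on:
  assumes I: "finite I" "inj_on v I" "v ` I \<subseteq> carrier_vec e" "v j \<in> carrier_vec e"
    and dep: "depends_on (coordinates e v) I j"
  shows "v j \<in> rat_span e (v ` I)"
proof -
  obtain c where c: "\<And>x. x \<in> coordinates e v \<Longrightarrow> x j = (\<Sum>i\<in>I. c i * x i)"
    using dep by (rule depends_onE) auto
  define a where "a = c \<circ> inv_into I v"
  have a: "a (v i) = c i" if "i \<in> I" for i using I(2) that by (simp add: a_def)
  have "v j = V.lincomb a (v ` I)"
  proof (rule eq_vecI)
    fix t assume "t < dim_vec (V.lincomb a (v ` I))"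
    then have t: "t < e" using V.lincomb_dim[OF finite_imageI[OF I(1)] I(3), of a] by simp
    have "v j $ t = (\<Sum>i\<in>I. c i * v i $ t)"
      using c[of "\<lambda>i. v i $ t"] t unfolding coordinates_def by simp
    then show "v j $ t = V.lincomb a (v ` I) $ t"
      using lincomb_family_index[OF I(1-3) t, of a] a by simp
  next
    show "dim_vec (v j) = dim_vec (V.lincomb a (v ` I))"
      using V.lincomb_dim[OF finite_imageI[OF I(1)] I(3), of a] carrier_vecD[OF I(4)] by simp
  qed
  then show ?thesis by (rule V.in_spanI) (use I in auto)
qed

lemma span_dim_eq_card_basis:
  assumes J: "finite J" "v ` J \<subseteq> carrier_vec e" and B: "basis_on (coordinates e v) J I"
  shows "span_dim e (v ` J) = card I"
proof -
  note IJ = basis_onD(1)[OF B]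
  have I: "finite I" using IJ J(1) by (rule finite_subset)
  have inj: "inj_on v I" by (rule indep_on_coordinates_inj_on[OF I basis_onD(2)[OF B]])
  have carr: "v ` I \<subseteq> carrier_vec e" using IJ J(2) by auto
  have "v ` J \<subseteq> V.span (v ` I)"
    using in_span_if_depends_on[OF I inj carr _ basis_onD(3)[OF B]] J(2) by blast
  then have eq: "V.span (v ` J) = V.span (v ` I)"
    using V.span_subsetI[OF carr] V.span_is_monotone[of "v ` I" "v ` J"] IJ by blast
  let ?S = "V.V\<lparr>carrier := V.span (v ` I)\<rparr>"
  have sm: "submodule class_ring (V.span (v ` I)) V.V"
    using V.span_is_submodule carr by simp
  interpret S: vectorspace class_ring ?S
    using V.span_is_subspace[of "v ` I"] carr by (intro V.subspace_is_vs) simp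
  have sub: "v ` I \<subseteq> V.span (v ` I)" using V.in_own_span carr by simp
  have "S.basis (v ` I)"
    unfolding S.basis_def
    using V.span_li_not_depend[OF sub sm] lin_indpt_iff_indep_on[OF I inj carr] basis_onD(2)[OF B] sub
    by simp
  then have "S.dim = card (v ` I)" using I by (intro S.dim_basis) auto
  then show ?thesis unfolding span_dim_def eq using card_image[OF inj] by simp
qed

end

section \<open>Gale duals\<close>

definition row_functions :: "nat \<Rightarrow> config \<Rightarrow> (nat \<Rightarrow> rat) set" where
  "row_functions e A = coordinates e (\<lambda>i. map_vec rat_of_int (A ! i))"

text \<open>
  A relation is a function on all of \<open>nat\<close> that is constrained only through its values at indices
  below the length of \<open>A\<close>; this avoids a change of type between \<open>A\<close> and its subfamilies.
\<close>

definition relations :: "nat \<Rightarrow> config \<Rightarrow> (nat \<Rightarrow> rat) set" where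
  "relations e A = {x. relation_on (row_functions e A) {..<length A} x}"

text \<open>The columns of \<open>B\<close> generate \<open>K\<close>; this is what a Gale dual is to the set of relations.\<close>

definition presents :: "rat mat \<Rightarrow> (nat \<Rightarrow> rat) set \<Rightarrow> bool" where
  "presents B K \<longleftrightarrow>
     (\<forall>l<dim_col B. \<exists>x\<in>K. \<forall>i<dim_row B. x i = B $$ (i, l)) \<and>
     (\<forall>x\<in>K. \<exists>y. \<forall>i<dim_row B. x i = (\<Sum>l<dim_col B. y l * B $$ (i, l)))"

lemma presents_cong:
  assumes B: "presents B K" and J: "J \<subseteq> {..<dim_row B}"
  shows "I \<subseteq> J \<Longrightarrow> relation_on (coordinates (dim_col B) (row B)) I c \<longleftrightarrow> relation_on K I c"
    and "I \<subseteq> J \<Longrightarrow> indep_on (coordinates (dim_col B) (row B)) I \<longleftrightarrow> indep_on K I"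
    and "basis_on (coordinates (dim_col B) (row B)) J I \<longleftrightarrow> basis_on K J I"
proof -
  let ?C = "coordinates (dim_col B) (row B)"
  have row: "row B i $ l = B $$ (i, l)" if "i \<in> J" "l < dim_col B" for i l
    using that J by auto
  have sub: "\<exists>x'\<in>K. \<forall>i\<in>J. x' i = x i" if "x \<in> ?C" for x
  proof -
    obtain l where l: "l < dim_col B" "x = (\<lambda>i. row B i $ l)"
      using \<open>x \<in> ?C\<close> unfolding coordinates_def by auto
    obtain x' where "x' \<in> K" "\<forall>i<dim_row B. x' i = B $$ (i, l)"
      using B l(1) unfolding presents_def by auto
    then show ?thesis using l row J by (intro bexI[of _ x']) auto
  qed
  have comb: "\<exists>S y. (\<forall>l\<in>S. (\<lambda>i. row B i $ l) \<in> ?C) \<and> (\<forall>i\<in>J. x' i = (\<Sum>l\<in>S. y l * row B i $ l))"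
    if "x' \<in> K" for x'
  proof -
    have "\<exists>y. \<forall>i<dim_row B. x' i = (\<Sum>l<dim_col B. y l * B $$ (i, l))"
      using B that unfolding presents_def by simp
    then obtain y where y: "\<forall>i<dim_row B. x' i = (\<Sum>l<dim_col B. y l * B $$ (i, l))" ..
    have "x' i = (\<Sum>l<dim_col B. y l * row B i $ l)" if "i \<in> J" for i
      using y J that row by auto
    then show ?thesis
      by (intro exI[of _ "{..<dim_col B}"] exI[of _ y]) (auto simp: coordinates_def)
  qed
  note cong = basis_on_cong_span[of ?C K J "\<lambda>l i. row B i $ l", OF sub comb]
  show "I \<subseteq> J \<Longrightarrow> relation_on ?C I c \<longleftrightarrow> relation_on K I c"
    and "I \<subseteq> J \<Longrightarrow> indep_on ?C I \<longleftrightarrow> indep_on K I"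
    and "basis_on ?C J I \<longleftrightarrow> basis_on K J I"
    using cong by simp_all
qed

lemma sub_dim_eq_card_basis:
  assumes B: "presents B K" and J: "J \<subseteq> {..<dim_row B}" and I: "basis_on K J I"
  shows "sub_dim B J = card I"
  unfolding sub_dim_def
proof (rule span_dim_eq_card_basis)
  show "finite J" using J finite_subset by blast
  show "row B ` J \<subseteq> carrier_vec (dim_col B)" by auto
  show "basis_on (coordinates (dim_col B) (row B)) J I" using presents_cong(3)[OF B J] I by simp
qed

lemma dual_homogeneous_iff:
  assumes B: "presents B K" and J: "J \<subseteq> {..<dim_row B}"
  shows "dual_homogeneous B J \<longleftrightarrow> relation_on K J (\<lambda>i. 1)"
proof -
  have fin: "finite J" using J finite_subset by blast
  have r: "row B \<in> J \<rightarrow> carrier_vec (dim_col B)" by auto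
  have idx: "finsum_vec TYPE(rat) (dim_col B) (row B) J $ l = (\<Sum>i\<in>J. row B i $ l)"
    if "l < dim_col B" for l by (rule index_finsum_vec[OF fin that r])
  have dim: "dim_vec (finsum_vec TYPE(rat) (dim_col B) (row B) J) = dim_col B"
    using finsum_vec_closed[OF r] by (rule carrier_vecD)
  have "dual_homogeneous B J \<longleftrightarrow> (\<forall>l<dim_col B. (\<Sum>i\<in>J. row B i $ l) = 0)"
    unfolding dual_homogeneous_def using idx dim by (auto simp: vec_eq_iff)
  also have "\<dots> \<longleftrightarrow> relation_on (coordinates (dim_col B) (row B)) J (\<lambda>i. 1)"
    unfolding relation_on_def coordinates_def by auto
  also have "\<dots> \<longleftrightarrow> relation_on K J (\<lambda>i. 1)" by (rule presents_cong(1)[OF B J subset_refl])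
  finally show ?thesis .
qed

context
  fixes e :: nat and A :: config
  assumes carr: "set A \<subseteq> carrier_vec e"
begin

lemma map_vec_nth_index: "i < length A \<Longrightarrow> t < e \<Longrightarrow> map_vec rat_of_int (A ! i) $ t = rat_of_int (A ! i $ t)"
  using carr nth_mem by fastforce

lemma in_relations_iff:
  "x \<in> relations e A \<longleftrightarrow> (\<forall>t<e. (\<Sum>i<length A. x i * rat_of_int (A ! i $ t)) = 0)"
proof -
  have "x \<in> relations e A \<longleftrightarrow>
      (\<forall>t<e. (\<Sum>i<length A. x i * map_vec rat_of_int (A ! i) $ t) = 0)"
    unfolding relations_def relation_on_def row_functions_def coordinates_def by auto
  then show ?thesis using map_vec_nth_index by simp
qed

lemma config_mat_carrier: "config_mat e A \<in> carrier_mat e (length A)"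
  unfolding config_mat_def by simp

lemma vec_in_mat_kernel_iff:
  "vec (length A) x \<in> mat_kernel (config_mat e A) \<longleftrightarrow> x \<in> relations e A"
proof -
  have "(config_mat e A *\<^sub>v vec (length A) x) $ t = (\<Sum>i<length A. x i * rat_of_int (A ! i $ t))"
    if "t < e" for t
    unfolding config_mat_def using that
    by (simp add: scalar_prod_def mat_of_cols_index lessThan_atLeast0 mult.commute)
  then show ?thesis
    unfolding in_relations_iff mat_kernel[OF config_mat_carrier]
    using config_mat_carrier by (auto simp: vec_eq_iff)
qed

interpretation k: kernel e "length A" "config_mat e A"
  by unfold_locales (rule config_mat_carrier)

lemma gale_dual_presents:
  assumes "gale_dual e A B"
  shows "dim_row B = length A" "presents B (relations e A)"
proof -
  have B: "B \<in> carrier_mat (length A) (nat (codim e A))" and basis: "k.basis (set (cols B))"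
    using assms unfolding gale_dual_def by auto
  show dim: "dim_row B = length A" using B by auto
  have sub: "set (cols B) \<subseteq> mat_kernel (config_mat e A)"
    and gen: "k.span (set (cols B)) = mat_kernel (config_mat e A)"
    using basis unfolding k.Ker.basis_def by auto
  have eq: "mat_kernel (config_mat e A) =
      {y \<in> carrier_vec (length A). \<exists>w\<in>carrier_vec (dim_col B). B *\<^sub>v w = y}"
    using gen unfolding k.span_same[OF sub] k.NC.col_space_def[symmetric] k.NC.col_space_eq[OF B]
    using B by auto
  show "presents B (relations e A)"
    unfolding presents_def
  proof (intro conjI allI impI ballI)
    fix l assume l: "l < dim_col B"
    have "col B l = vec (length A) (\<lambda>i. B $$ (i, l))" using l dim by (intro eq_vecI) auto
    moreover have "col B l \<in> mat_kernel (config_mat e A)" using sub l by (auto simp: cols_def)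
    ultimately have "(\<lambda>i. B $$ (i, l)) \<in> relations e A" using vec_in_mat_kernel_iff by simp
    then show "\<exists>x\<in>relations e A. \<forall>i<dim_row B. x i = B $$ (i, l)" by (intro bexI) auto
  next
    fix x assume "x \<in> relations e A"
    then have "vec (length A) x \<in> mat_kernel (config_mat e A)" using vec_in_mat_kernel_iff by simp
    then obtain w where w: "w \<in> carrier_vec (dim_col B)" "B *\<^sub>v w = vec (length A) x"
      using eq by auto
    have "x i = (\<Sum>l<dim_col B. w $ l * B $$ (i, l))" if i: "i < dim_row B" for i
    proof -
      have "x i = (B *\<^sub>v w) $ i" using w(2) i dim by simp
      also have "\<dots> = (\<Sum>l<dim_col B. w $ l * B $$ (i, l))"
        using i w(1) by (simp add: scalar_prod_def lessThan_atLeast0 mult.commute)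
      finally show ?thesis .
    qed
    then show "\<exists>y. \<forall>i<dim_row B. x i = (\<Sum>l<dim_col B. y l * B $$ (i, l))"
      by (intro exI[of _ "\<lambda>l. w $ l"]) simp
  qed
qed

text \<open>
  Irreducibility speaks of some Gale dual, but independence of two of its rows is a property of the
  relations of \<open>A\<close> and thus passes to every Gale dual.
\<close>

lemma irreducible_imp_pairs_independent:
  assumes "irreducible_config e A" and ij: "i < length A" "j < length A" "i \<noteq> j"
  shows "indep_on (relations e A) {i, j}"
proof -
  obtain B where B: "gale_dual e A B" "row B i \<noteq> row B j"
    "\<not> module.lin_dep class_ring (rat_space (dim_col B)) {row B i, row B j}"
    using assms unfolding irreducible_config_def by blast
  have "inj_on (row B) {i, j}" "row B ` {i, j} \<subseteq> carrier_vec (dim_col B)" using B(2) by auto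
  from lin_indpt_iff_indep_on[OF _ this] B(3)
  have "indep_on (coordinates (dim_col B) (row B)) {i, j}" by simp
  then show ?thesis
    using presents_cong(2)[OF gale_dual_presents(2)[OF B(1)], of "{i, j}" "{i, j}"]
      gale_dual_presents(1)[OF B(1)] ij by simp
qed

text \<open>
  A Gale dual with the prescribed number \<open>n - rank\<close> of columns: the fundamental circuits of a
  basis of \<open>A\<close>.
\<close>

lemma gale_dual_exists:
  assumes I: "basis_on (row_functions e A) {..<length A} I"
    and codim: "codim e A = int (length A) - int (card I)"
  shows "\<exists>B. gale_dual e A B"
proof -
  let ?n = "length A" and ?R = "row_functions e A"
  obtain \<kappa> where \<kappa>: "\<And>j. j \<in> {..<?n} - I \<Longrightarrow> relation_on ?R {..<?n} (\<kappa> j)"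
    "\<And>j l. j \<in> {..<?n} - I \<Longrightarrow> l \<in> {..<?n} - I \<Longrightarrow> \<kappa> j l = (if l = j then 1 else 0)"
    "\<And>x i. relation_on ?R {..<?n} x \<Longrightarrow> i \<in> {..<?n} \<Longrightarrow> x i = (\<Sum>j\<in>{..<?n} - I. x j * \<kappa> j i)"
    by (rule fundamental_circuits[OF finite_lessThan I], rule that)
  define js where "js = sorted_list_of_set ({..<?n} - I)"
  define m where "m = length js"
  define B where "B = mat ?n m (\<lambda>(i, l). \<kappa> (js ! l) i)"
  have js: "set js = {..<?n} - I" "distinct js" by (simp_all add: js_def)
  have IJ: "I \<subseteq> {..<?n}" by (rule basis_onD(1)[OF I])
  then have "card I \<le> ?n" using card_mono[of "{..<?n}" I] by simp
  then have m: "m = nat (codim e A)"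
    using IJ unfolding m_def js_def codim by (simp add: card_Diff_subset finite_subset[OF IJ])
  have B: "B \<in> carrier_mat ?n m" by (simp add: B_def)
  have jsl: "js ! l \<in> {..<?n} - I" if "l < m" for l using that js nth_mem m_def by metis
  have col: "col B l = vec ?n (\<kappa> (js ! l))" if "l < m" for l
    using that by (intro eq_vecI) (auto simp: B_def)
  have entry: "col B l $ (js ! l') = (if l' = l then 1 else 0)" if "l < m" "l' < m" for l l'
    using \<kappa>(2)[OF jsl jsl, OF that] jsl[OF that(2)] that nth_eq_iff_index_eq[OF js(2)] col
    by (auto simp: m_def)
  have inj: "inj_on (col B) {..<m}"
  proof (rule inj_onI)
    fix l l' assume l: "l \<in> {..<m}" "l' \<in> {..<m}" and eq: "col B l = col B l'"
    have "(if l' = l then 1 else 0) = col B l $ (js ! l')" using entry[of l l'] l by simp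
    also have "\<dots> = 1" unfolding eq using entry[of l' l'] l by simp
    finally show "l = l'" by (simp split: if_splits)
  qed
  have cols: "set (cols B) = col B ` {..<m}" using B by (auto simp: cols_def)
  have sub: "set (cols B) \<subseteq> mat_kernel (config_mat e A)"
    unfolding cols using col vec_in_mat_kernel_iff \<kappa>(1)[OF jsl] by (auto simp: relations_def)
  have colcarr: "col B ` {..<m} \<subseteq> carrier_vec ?n" using B by auto
  have "indep_on (coordinates ?n (col B)) {..<m}"
    unfolding indep_on_def
  proof (intro allI impI ballI)
    fix c l assume c: "relation_on (coordinates ?n (col B)) {..<m} c" and l: "l \<in> {..<m}"
    have "0 = (\<Sum>l'<m. c l' * col B l' $ (js ! l))"
      using c jsl[of l] l unfolding relation_on_def coordinates_def by auto
    also have "\<dots> = (\<Sum>l'<m. if l' = l then c l' else 0)"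
      using entry l by (intro sum.cong) auto
    finally show "c l = 0" using l by simp
  qed
  then have "k.NC.lin_indpt (set (cols B))"
    unfolding cols using lin_indpt_iff_indep_on[OF _ inj colcarr] by simp
  then have ind: "k.lin_indpt (set (cols B))" using k.lindep_same[OF sub] by simp
  have gen: "k.span (set (cols B)) = mat_kernel (config_mat e A)"
  proof
    show "k.span (set (cols B)) \<subseteq> mat_kernel (config_mat e A)"
      using k.Ker.span_is_subset2[of "set (cols B)"] sub by simp
    show "mat_kernel (config_mat e A) \<subseteq> k.span (set (cols B))"
    proof
      fix v assume v: "v \<in> mat_kernel (config_mat e A)"
      then have vc: "v \<in> carrier_vec ?n" using mat_kernelD(1)[OF config_mat_carrier] by simp
      then have "v = vec ?n (\<lambda>i. v $ i)" by auto
      then have "(\<lambda>i. v $ i) \<in> relations e A" using v vec_in_mat_kernel_iff by metis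
      then have exp: "v $ i = (\<Sum>j\<in>{..<?n} - I. v $ j * \<kappa> j i)" if "i < ?n" for i
        using \<kappa>(3)[of "\<lambda>i. v $ i" i] that by (simp add: relations_def)
      define w where "w = vec m (\<lambda>l. v $ (js ! l))"
      have "B *\<^sub>v w = v"
      proof (rule eq_vecI)
        fix i assume "i < dim_vec v"
        then have i: "i < ?n" using vc by simp
        have "(B *\<^sub>v w) $ i = (\<Sum>l<m. v $ (js ! l) * \<kappa> (js ! l) i)"
          using i by (simp add: B_def w_def scalar_prod_def lessThan_atLeast0 mult.commute)
        also have "\<dots> = (\<Sum>j\<in>{..<?n} - I. v $ j * \<kappa> j i)"
          using sum.reindex_bij_betw[OF bij_betw_nth[OF js(2) _ js(1)[symmetric]],
              of "{..<m}" "\<lambda>j. v $ j * \<kappa> j i"] by (simp add: m_def)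
        finally show "(B *\<^sub>v w) $ i = v $ i" using exp[OF i] by simp
      qed (use B vc in auto)
      moreover have "w \<in> carrier_vec m" by (simp add: w_def)
      ultimately have "v \<in> k.NC.col_space B"
        unfolding k.NC.col_space_eq[OF B] using B vc by auto
      then show "v \<in> k.span (set (cols B))"
        unfolding k.span_same[OF sub] k.NC.col_space_def .
    qed
  qed
  have "distinct (cols B)"
    using inj B unfolding cols_def by (simp add: distinct_map lessThan_atLeast0)
  moreover have "k.basis (set (cols B))" unfolding k.Ker.basis_def using ind gen sub by simp
  ultimately show ?thesis using B m unfolding gale_dual_def by auto
qed

end

section \<open>Codimension is the rank of a Gale dual\<close>

text \<open>
  If the constant function 1 is a combination of \<open>K\<close>, as for points on an affine hyperplane off the
  origin, then subtracting one member \<open>i\<^sub>0\<close> of a basis from the others gives a basis of all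
  differences: the coefficients of a relation add up to 0, those of a dependence to 1.
\<close>

lemma difference_basis:
  assumes E: "finite E" and B: "basis_on K E I" and i0: "i0 \<in> I"
    and f: "\<And>l. l \<in> S \<Longrightarrow> f l \<in> K" and one: "\<And>i. i \<in> E \<Longrightarrow> (\<Sum>l\<in>S. y l * f l i) = 1"
  shows "basis_on ((\<lambda>x (i, l). x i - x l) ` K) (E \<times> E) ((\<lambda>i. (i, i0)) ` (I - {i0}))"
proof -
  note IE = basis_onD(1)[OF B]
  have fin: "finite I" using IE E by (rule finite_subset)
  have inj: "inj_on (\<lambda>i. (i, i0)) (I - {i0})" by (rule inj_onI) simp
  have split: "(\<Sum>i\<in>I. a i * x i) = (\<Sum>i\<in>I - {i0}. a i * x i) + a i0 * x i0" for a x :: "_ \<Rightarrow> rat"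
    using sum.remove[OF fin i0, of "\<lambda>i. a i * x i"] by simp
  have coeff: "(\<Sum>i\<in>I. a i) = 1"
    if j: "j \<in> E" and a: "\<And>x. x \<in> K \<Longrightarrow> x j = (\<Sum>i\<in>I. a i * x i)" for j a
  proof -
    have "1 = (\<Sum>l\<in>S. y l * (\<Sum>i\<in>I. a i * f l i))" using one[OF j] a[OF f] by simp
    also have "\<dots> = (\<Sum>i\<in>I. \<Sum>l\<in>S. a i * (y l * f l i))"
      by (subst sum.swap) (simp add: sum_distrib_left algebra_simps)
    also have "\<dots> = (\<Sum>i\<in>I. a i * (\<Sum>l\<in>S. y l * f l i))" by (simp add: sum_distrib_left)
    also have "\<dots> = (\<Sum>i\<in>I. a i)" using one IE by (intro sum.cong) auto
    finally show ?thesis by simp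
  qed
  have ind: "indep_on ((\<lambda>x (i, l). x i - x l) ` K) ((\<lambda>i. (i, i0)) ` (I - {i0}))"
    unfolding indep_on_def
  proof (intro allI impI)
    fix c assume c: "relation_on ((\<lambda>x (i, l). x i - x l) ` K) ((\<lambda>i. (i, i0)) ` (I - {i0})) c"
    define a where "a i = (if i = i0 then - (\<Sum>l\<in>I - {i0}. c (l, i0)) else c (i, i0))" for i
    have "(\<Sum>i\<in>I. a i * x i) = 0" if x: "x \<in> K" for x
    proof -
      have "(\<Sum>i\<in>I. a i * x i) = (\<Sum>i\<in>I - {i0}. c (i, i0) * x i) + a i0 * x i0"
        unfolding split by (simp add: a_def)
      also have "\<dots> = (\<Sum>i\<in>I - {i0}. c (i, i0) * (x i - x i0))"
        by (simp add: a_def algebra_simps sum_subtractf sum_distrib_left)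
      also have "\<dots> = 0"
        using c x unfolding relation_on_def by (simp add: sum.reindex[OF inj])
      finally show ?thesis .
    qed
    then have "a i = 0" if "i \<in> I" for i using indep_onD[OF basis_onD(2)[OF B], of a i] that by simp
    then have "c (i, i0) = 0" if "i \<in> I - {i0}" for i
      using that by (auto simp: a_def dest!: meta_spec[of _ i])
    then show "\<forall>p\<in>(\<lambda>i. (i, i0)) ` (I - {i0}). c p = 0" by auto
  qed
  have dep: "depends_on ((\<lambda>x (i, l). x i - x l) ` K) ((\<lambda>i. (i, i0)) ` (I - {i0})) (j, l)"
    if j: "j \<in> E" and l: "l \<in> E" for j l
  proof -
    obtain a where a: "\<And>x. x \<in> K \<Longrightarrow> x j = (\<Sum>i\<in>I. a i * x i)"
      using basis_onD(3)[OF B j] by (rule depends_onE) auto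
    obtain b where b: "\<And>x. x \<in> K \<Longrightarrow> x l = (\<Sum>i\<in>I. b i * x i)"
      using basis_onD(3)[OF B l] by (rule depends_onE) auto
    have "(\<Sum>i\<in>I. a i) = (\<Sum>i\<in>I. b i)" using coeff[OF j a] coeff[OF l b] by simp
    then have 0: "(\<Sum>i\<in>I - {i0}. a i - b i) = b i0 - a i0"
      using sum.remove[OF fin i0, of a] sum.remove[OF fin i0, of b] by (simp add: sum_subtractf)
    have "x j - x l = (\<Sum>i\<in>I - {i0}. (a i - b i) * (x i - x i0))" if x: "x \<in> K" for x
    proof -
      have "x j - x l = (\<Sum>i\<in>I. (a i - b i) * x i)"
        using a[OF x] b[OF x] by (simp add: algebra_simps sum_subtractf)
      also have "\<dots> = (\<Sum>i\<in>I - {i0}. (a i - b i) * x i) - (\<Sum>i\<in>I - {i0}. a i - b i) * x i0"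
        unfolding split 0 by (simp add: algebra_simps)
      also have "\<dots> = (\<Sum>i\<in>I - {i0}. (a i - b i) * (x i - x i0))"
        by (simp add: algebra_simps sum_subtractf sum.distrib sum_distrib_left)
      finally show ?thesis .
    qed
    then show ?thesis
      by (intro depends_onI[where c = "\<lambda>(i, _). a i - b i"]) (auto simp: sum.reindex[OF inj])
  qed
  have "(\<lambda>i. (i, i0)) ` (I - {i0}) \<subseteq> E \<times> E" using IE i0 by auto
  then show ?thesis unfolding basis_on_def using ind dep by auto
qed

definition pair_difference :: "config \<Rightarrow> nat \<times> nat \<Rightarrow> rat vec" where
  "pair_difference A = (\<lambda>(i, l). map_vec rat_of_int (A ! i) - map_vec rat_of_int (A ! l))"

lemma affine_dim_eq_card_basis_of_differences:
  assumes carr: "set A \<subseteq> carrier_vec e" and A: "A \<noteq> []"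
    and B: "basis_on (coordinates e (pair_difference A)) ({..<length A} \<times> {..<length A}) I"
  shows "affine_dim e A = int (card I)"
proof -
  let ?E = "{..<length A} \<times> {..<length A}"
  have "map_vec rat_of_int ` differences A = pair_difference A ` ?E"
  proof -
    have set: "set A = (!) A ` {..<length A}" by (auto simp: set_conv_nth)
    have "differences A = (\<lambda>(i, l). A ! i - A ! l) ` ?E" unfolding differences_def set by auto
    moreover have "map_vec rat_of_int (A ! i - A ! l) = pair_difference A (i, l)"
      if "i < length A" "l < length A" for i l
    proof (rule eq_vecI)
      show "dim_vec (map_vec rat_of_int (A ! i - A ! l)) = dim_vec (pair_difference A (i, l))"
        by (simp add: pair_difference_def)
      fix t assume t: "t < dim_vec (pair_difference A (i, l))"
      have "A ! i \<in> carrier_vec e" "A ! l \<in> carrier_vec e" using carr that nth_mem by auto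
      then show "map_vec rat_of_int (A ! i - A ! l) $ t = pair_difference A (i, l) $ t"
        using t by (simp add: pair_difference_def)
    qed
    ultimately show ?thesis by (auto simp: image_image split: prod.splits intro!: image_cong)
  qed
  moreover have "pair_difference A ` ?E \<subseteq> carrier_vec e"
  proof -
    have "A ! i \<in> carrier_vec e" if "i < length A" for i using carr nth_mem that by auto
    then show ?thesis by (auto simp: pair_difference_def)
  qed
  ultimately show ?thesis
    using span_dim_eq_card_basis[OF _ _ B] A unfolding affine_dim_def by simp
qed

text \<open>A linear form \<open>h\<close> with value 1 on \<open>A\<close> is how homogeneity is used.\<close>

context
  fixes e :: nat and A :: config and h :: "nat \<Rightarrow> rat"
  assumes carr: "set A \<subseteq> carrier_vec e" and A: "A \<noteq> []"
    and h: "\<And>i. i < length A \<Longrightarrow> (\<Sum>t<e. h t * rat_of_int (A ! i $ t)) = 1"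
begin

lemma codim_eq_length_minus_rank:
  assumes I: "basis_on (row_functions e A) {..<length A} I"
  shows "codim e A = int (length A) - int (card I)"
proof -
  let ?f = "\<lambda>t i. map_vec rat_of_int (A ! i) $ t"
  have one: "(\<Sum>t<e. h t * ?f t i) = 1" if "i < length A" for i
    using h[OF that] map_vec_nth_index[OF carr that] by simp
  have fin: "finite I" using basis_onD(1)[OF I] finite_subset by blast
  \<comment> \<open>a point of \<open>A\<close> is not the zero vector, since \<open>h\<close> has value 1 there\<close>
  have "I \<noteq> {}"
  proof
    assume "I = {}"
    then have "?f t 0 = 0" if "t < e" for t
      using basis_onD(3)[OF I, of 0] A that
      unfolding depends_on_def row_functions_def coordinates_def by simp
    then show False using one[of 0] A by simp
  qed
  then obtain i0 where i0: "i0 \<in> I" by auto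
  have "basis_on ((\<lambda>x (i, l). x i - x l) ` row_functions e A) ({..<length A} \<times> {..<length A})
      ((\<lambda>i. (i, i0)) ` (I - {i0}))"
    using one by (intro difference_basis[OF _ I i0, where S = "{..<e}" and f = ?f and y = h])
      (auto simp: row_functions_def coordinates_def)
  moreover have "basis_on ((\<lambda>x (i, l). x i - x l) ` row_functions e A) ({..<length A} \<times> {..<length A}) T
      \<longleftrightarrow> basis_on (coordinates e (pair_difference A)) ({..<length A} \<times> {..<length A}) T" for T
  proof (rule basis_on_cong_span(3)[where f = "\<lambda>t (i, l). ?f t i - ?f t l"])
    have idx: "pair_difference A (i, l) $ t = ?f t i - ?f t l"
      if "t < e" "i < length A" "l < length A" for i l t
    proof -
      have "A ! i \<in> carrier_vec e" "A ! l \<in> carrier_vec e" using carr that nth_mem by auto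
      then show ?thesis using that(1) by (simp add: pair_difference_def)
    qed
    show "\<exists>x'\<in>coordinates e (pair_difference A). \<forall>i\<in>{..<length A} \<times> {..<length A}. x' i = x i"
      if "x \<in> (\<lambda>x (i, l). x i - x l) ` row_functions e A" for x
      using that idx unfolding row_functions_def coordinates_def by auto
    show "\<exists>S y. (\<forall>t\<in>S. (\<lambda>(i, l). ?f t i - ?f t l) \<in> (\<lambda>x (i, l). x i - x l) ` row_functions e A) \<and>
        (\<forall>i\<in>{..<length A} \<times> {..<length A}. x' i = (\<Sum>t\<in>S. y t * (case i of (i, l) \<Rightarrow> ?f t i - ?f t l)))"
      if x': "x' \<in> coordinates e (pair_difference A)" for x'
    proof -
      obtain t where t: "t < e" "x' = (\<lambda>p. pair_difference A p $ t)"
        using x' unfolding coordinates_def by auto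
      show ?thesis
        using t idx
        by (intro exI[of _ "{t}"] exI[of _ "\<lambda>_. 1"]) (auto simp: row_functions_def coordinates_def)
    qed
  qed
  ultimately have "affine_dim e A = int (card ((\<lambda>i. (i, i0)) ` (I - {i0})))"
    using affine_dim_eq_card_basis_of_differences[OF carr A] by simp
  also have "\<dots> = int (card I) - 1"
    using fin i0 card_gt_0_iff[of I]
    by (subst card_image) (auto simp: inj_on_def card_Diff_singleton of_nat_diff Suc_le_eq)
  finally show ?thesis unfolding codim_def by simp
qed

lemma gale_is_gale_dual: "gale_dual e A (gale e A)"
proof -
  obtain I where "basis_on (row_functions e A) {..<length A} I"
    using basis_on_exists[of "{..<length A}"] by auto
  then have "\<exists>B. gale_dual e A B"
    using gale_dual_exists[OF carr] codim_eq_length_minus_rank by simp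
  then show ?thesis unfolding gale_def by (rule someI_ex)
qed

lemma gale_presents: "dim_row (gale e A) = length A" "presents (gale e A) (relations e A)"
  using gale_dual_presents[OF carr gale_is_gale_dual] by simp_all

lemma codim_eq_card_dual_basis:
  assumes I: "basis_on (row_functions e A) {..<length A} I"
  shows "basis_on (relations e A) {..<length A} ({..<length A} - I)"
    and "codim e A = int (card ({..<length A} - I))"
proof -
  show "basis_on (relations e A) {..<length A} ({..<length A} - I)"
    by (rule dual_basis_on[OF _ I]) (auto simp: relations_def)
  have "I \<subseteq> {..<length A}" by (rule basis_onD(1)[OF I])
  then show "codim e A = int (card ({..<length A} - I))"
    using codim_eq_length_minus_rank[OF I] finite_subset[of I "{..<length A}"] card_mono[of "{..<length A}" I]
    by (simp add: card_Diff_subset of_nat_diff)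
qed

lemma sub_dim_gale_all: "int (sub_dim (gale e A) {..<length A}) = codim e A"
proof -
  obtain I where I: "basis_on (row_functions e A) {..<length A} I"
    using basis_on_exists[of "{..<length A}"] by auto
  show ?thesis
    using sub_dim_eq_card_basis[OF gale_presents(2) _ codim_eq_card_dual_basis(1)[OF I]]
      codim_eq_card_dual_basis(2)[OF I] gale_presents(1) by simp
qed

lemma relations_sum_zero:
  assumes x: "x \<in> relations e A" shows "(\<Sum>i<length A. x i) = 0"
proof -
  have "(\<Sum>i<length A. x i) = (\<Sum>i<length A. \<Sum>t<e. h t * (x i * rat_of_int (A ! i $ t)))"
  proof (rule sum.cong[OF refl])
    fix i assume "i \<in> {..<length A}"
    then have "x i = x i * (\<Sum>t<e. h t * rat_of_int (A ! i $ t))" using h by simp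
    also have "\<dots> = (\<Sum>t<e. h t * (x i * rat_of_int (A ! i $ t)))"
      by (simp add: sum_distrib_left mult.left_commute)
    finally show "x i = (\<Sum>t<e. h t * (x i * rat_of_int (A ! i $ t)))" .
  qed
  also have "\<dots> = (\<Sum>t<e. h t * (\<Sum>i<length A. x i * rat_of_int (A ! i $ t)))"
    by (subst sum.swap) (simp add: sum_distrib_left)
  also have "\<dots> = 0" using x unfolding in_relations_iff[OF carr] by simp
  finally show ?thesis .
qed

end

lemma homogeneous_imp_linear_form:
  assumes carr: "set A \<subseteq> carrier_vec e" and hom: "homogeneous e A"
  obtains h where "\<And>i. i < length A \<Longrightarrow> (\<Sum>t<e. h t * rat_of_int (A ! i $ t)) = 1"
proof -
  interpret V: vec_space "TYPE(rat)" "length A" .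
  note M = config_mat_carrier[OF carr]
  have "vec (length A) (\<lambda>i. 1) \<in> V.row_space (config_mat e A)"
    using hom unfolding homogeneous_def V.row_space_def .
  then obtain w where w: "w \<in> carrier_vec e" "(config_mat e A)\<^sup>T *\<^sub>v w = vec (length A) (\<lambda>i. 1)"
    unfolding V.row_space_eq[OF M] using M by auto
  have "(\<Sum>t<e. w $ t * rat_of_int (A ! i $ t)) = 1" if i: "i < length A" for i
  proof -
    have "1 = ((config_mat e A)\<^sup>T *\<^sub>v w) $ i" using w(2) i by simp
    also have "\<dots> = (\<Sum>t<e. w $ t * rat_of_int (A ! i $ t))"
      using i w(1) by (simp add: config_mat_def scalar_prod_def mat_of_cols_index lessThan_atLeast0 mult.commute)
    finally show ?thesis by simp
  qed
  then show ?thesis by (rule that)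
qed

lemma homogenization_carrier:
  "set C \<subseteq> carrier_vec e \<Longrightarrow> set (homogenization C) \<subseteq> carrier_vec (Suc e)"
  unfolding homogenization_def by auto

lemma homogenization_nth:
  "i < length C \<Longrightarrow> homogenization C ! i = vCons 1 (C ! i)" "length (homogenization C) = length C"
  unfolding homogenization_def by simp_all

lemma homogenization_linear_form:
  assumes "i < length (homogenization C)"
  shows "(\<Sum>t<Suc e. (if t = 0 then 1 else 0) * rat_of_int (homogenization C ! i $ t)) = 1"
  using assms by (simp add: homogenization_nth sum.lessThan_Suc_shift del: sum.lessThan_Suc)

lemma homogenization_relations_iff:
  assumes "set C \<subseteq> carrier_vec m"
  shows "x \<in> relations (Suc m) (homogenization C) \<longleftrightarrow> (\<Sum>q<length C. x q) = 0 \<and> x \<in> relations m C"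
proof -
  have "(\<Sum>q<length C. x q * rat_of_int (homogenization C ! q $ t)) =
      (case t of 0 \<Rightarrow> (\<Sum>q<length C. x q) | Suc s \<Rightarrow> (\<Sum>q<length C. x q * rat_of_int (C ! q $ s)))" for t
    by (cases t) (simp_all add: homogenization_nth)
  then show ?thesis
    unfolding in_relations_iff[OF assms] in_relations_iff[OF homogenization_carrier[OF assms]] homogenization_nth(2)
    by (auto simp: All_less_Suc2)
qed

lemma codim_homogenization:
  assumes carr: "set C \<subseteq> carrier_vec e" and C: "C \<noteq> []"
  shows "codim (Suc e) (homogenization C) = codim e C"
proof -
  let ?D = "homogenization C" and ?E = "{..<length C} \<times> {..<length C}"
  let ?p = "pair_difference C" and ?q = "pair_difference (homogenization C)"
  have Ci: "C ! i \<in> carrier_vec e" if "i < length C" for i using carr nth_mem that by auto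
  have q0: "?q (i, l) $ 0 = 0" and qS: "t < e \<Longrightarrow> ?q (i, l) $ Suc t = ?p (i, l) $ t"
    if "i < length C" "l < length C" for i l t
    using Ci[OF that(1)] Ci[OF that(2)] that by (simp_all add: pair_difference_def homogenization_nth)
  \<comment> \<open>the differences of the homogenization have an additional first coordinate, which is 0\<close>
  obtain I where I: "basis_on (coordinates e ?p) ?E I" using basis_on_exists[of ?E] by auto
  have "basis_on (coordinates e ?p) ?E I \<longleftrightarrow> basis_on (coordinates (Suc e) ?q) ?E I"
  proof (rule basis_on_cong_span(3)[where f = "\<lambda>t i. ?p i $ t"])
    show "\<exists>x'\<in>coordinates (Suc e) ?q. \<forall>i\<in>?E. x' i = x i" if x: "x \<in> coordinates e ?p" for x
    proof -
      obtain t where t: "t < e" "x = (\<lambda>i. ?p i $ t)" using x unfolding coordinates_def by auto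
      show ?thesis using t qS
        by (intro bexI[of _ "\<lambda>i. ?q i $ Suc t"]) (auto simp: coordinates_def)
    qed
    show "\<exists>S y. (\<forall>t\<in>S. (\<lambda>i. ?p i $ t) \<in> coordinates e ?p) \<and> (\<forall>i\<in>?E. x' i = (\<Sum>t\<in>S. y t * ?p i $ t))"
      if x': "x' \<in> coordinates (Suc e) ?q" for x'
    proof -
      obtain t where t: "t < Suc e" "x' = (\<lambda>i. ?q i $ t)" using x' unfolding coordinates_def by auto
      show ?thesis
      proof (cases t)
        case 0
        then show ?thesis using t q0 by (intro exI[of _ "{}"]) auto
      next
        case (Suc s)
        then show ?thesis using t qS
          by (intro exI[of _ "{s}"] exI[of _ "\<lambda>_. 1"]) (auto simp: coordinates_def)
      qed
    qed
  qed
  then have "basis_on (coordinates (Suc e) ?q) ?E I" using I by simp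
  then have "affine_dim (Suc e) ?D = affine_dim e C"
    using affine_dim_eq_card_basis_of_differences[OF carr C I]
      affine_dim_eq_card_basis_of_differences[OF homogenization_carrier[OF carr], of I] C
    by (simp add: homogenization_nth(2) homogenization_def)
  then show ?thesis unfolding codim_def by (simp add: homogenization_nth(2))
qed

section \<open>Bounding the defect\<close>

text \<open>
  A nonempty block \<open>J\<close> with \<open>\<Sum>\<^sub>J b\<^sub>i = 0\<close> has at least two elements as no \<open>b\<^sub>i\<close> vanishes, and
  two of them are independent, so every constituent has rank at least 2. Ranks of constituents are
  subadditive, so the excess is nonnegative.
\<close>

context
  fixes B :: "rat mat" and K :: "(nat \<Rightarrow> rat) set" and P :: "nat set set"
  assumes B: "presents B K" and P: "cayley_decomposition B P" and n: "2 \<le> dim_row B"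
    and pairs: "\<And>i j. i < dim_row B \<Longrightarrow> j < dim_row B \<Longrightarrow> i \<noteq> j \<Longrightarrow> indep_on K {i, j}"
begin

lemma decomposition_partition: "partition_on {..<dim_row B} P"
  using P unfolding cayley_decomposition_def by simp

lemma block_subset: "J \<in> P \<Longrightarrow> J \<subseteq> {..<dim_row B}"
  using decomposition_partition unfolding partition_on_def by auto

lemma block_homogeneous:
  assumes J: "J \<in> P" shows "relation_on K J (\<lambda>i. 1)"
  using P J dual_homogeneous_iff[OF B block_subset[OF J]] unfolding cayley_decomposition_def by simp

lemma block_rank_ge_2:
  assumes J: "J \<in> P" shows "2 \<le> sub_dim B J"
proof -
  have JE: "J \<subseteq> {..<dim_row B}" by (rule block_subset[OF J])
  have fin: "finite J" using JE finite_subset by blast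
  have "J \<noteq> {}" using decomposition_partition J unfolding partition_on_def by auto
  then obtain i where i: "i \<in> J" by auto
  have "J \<noteq> {i}"
  proof
    assume Ji: "J = {i}"
    define j where "j = (if i = 0 then 1 else 0 :: nat)"
    have j: "j < dim_row B" "i \<noteq> j" using n by (auto simp: j_def)
    have "x i = 0" if "x \<in> K" for x
      using block_homogeneous[OF J] that unfolding Ji relation_on_def by simp
    then have "relation_on K {i, j} (\<lambda>l. if l = i then 1 else 0)"
      using j(2) unfolding relation_on_def by simp
    moreover have "indep_on K {i, j}" using pairs[OF _ j] i JE by auto
    ultimately have "\<forall>l\<in>{i, j}. (if l = i then 1 else 0 :: rat) = 0" unfolding indep_on_def by (elim allE impE)
    then show False by simp
  qed
  then obtain j where j: "j \<in> J" "j \<noteq> i" using i by auto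
  have "indep_on K {i, j}" using pairs i j JE by auto
  then obtain I where I: "{i, j} \<subseteq> I" "basis_on K J I"
    using indep_extends_to_basis[OF fin, of "{i, j}" K] i j by auto
  have "finite I" using basis_onD(1)[OF I(2)] fin by (rule finite_subset)
  then have "card {i, j} \<le> card I" using I(1) by (rule card_mono)
  then show ?thesis using sub_dim_eq_card_basis[OF B JE I(2)] j by simp
qed

lemma excess_nonneg: "0 \<le> decomposition_excess B P"
  and excess_zero_relation_restricts:
    "decomposition_excess B P = 0 \<Longrightarrow> relation_on K {..<dim_row B} c \<Longrightarrow> J \<in> P \<Longrightarrow> relation_on K J c"
proof -
  have "\<exists>T. basis_on K J T" if "J \<in> P" for J
    using basis_on_exists[of J K] finite_subset[OF block_subset[OF that]] by auto
  then obtain T where T: "\<And>J. J \<in> P \<Longrightarrow> basis_on K J (T J)" by metis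
  obtain I where I: "basis_on K {..<dim_row B} I" "I \<subseteq> \<Union>(T ` P)"
    "card (\<Union>(T ` P)) = (\<Sum>J\<in>P. card (T J))"
    by (rule block_bases[OF decomposition_partition finite_lessThan T], assumption, rule that)
  have "\<Union>(T ` P) \<subseteq> {..<dim_row B}" using basis_onD(1)[OF T] block_subset by blast
  then have fin: "finite (\<Union>(T ` P))" using finite_subset by blast
  have sd: "sub_dim B J = card (T J)" if "J \<in> P" for J
    by (rule sub_dim_eq_card_basis[OF B block_subset[OF that] T[OF that]])
  have eq: "decomposition_excess B P = int (card (\<Union>(T ` P))) - int (card I)"
    unfolding decomposition_excess_def using sd sub_dim_eq_card_basis[OF B subset_refl I(1)] I(3) by simp
  show "0 \<le> decomposition_excess B P" using eq card_mono[OF fin I(2)] by simp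
  assume "decomposition_excess B P = 0" and c: "relation_on K {..<dim_row B} c" and J: "J \<in> P"
  then have "\<Union>(T ` P) = I" using eq card_subset_eq[OF fin I(2)] by simp
  then have ind: "indep_on K (\<Union>(T ` P))" using basis_onD(2)[OF I(1)] by simp
  show "relation_on K J c"
    by (rule relation_restricts_to_blocks[OF decomposition_partition finite_lessThan _ ind c J], rule T)
qed

lemma sum_sub_dim: "(\<Sum>J\<in>P. int (sub_dim B J)) = int (sub_dim B {..<dim_row B}) + decomposition_excess B P"
  unfolding decomposition_excess_def by simp

lemma twice_card_le_sum_sub_dim: "2 * int (card P) \<le> (\<Sum>J\<in>P. int (sub_dim B J))"
  using sum_mono[of P "\<lambda>J. 2 :: int" "\<lambda>J. int (sub_dim B J)"] block_rank_ge_2 by simp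

lemma finite_decomposition: "finite P"
  using finite_elements[OF finite_lessThan decomposition_partition] .

lemma all_ranks_2:
  assumes "(\<Sum>J\<in>P. int (sub_dim B J)) = 2 * int (card P)" and J: "J \<in> P"
  shows "sub_dim B J = 2"
proof -
  have "(\<Sum>J\<in>P. int (sub_dim B J) - 2) = 0" using assms(1) by (simp add: sum_subtractf)
  then have "int (sub_dim B J) - 2 = 0"
    using sum_nonneg_eq_0_iff[OF finite_decomposition, of "\<lambda>J. int (sub_dim B J) - 2"] block_rank_ge_2 J
    by auto
  then show ?thesis by simp
qed

lemma one_rank_3_others_2:
  assumes "(\<Sum>J\<in>P. int (sub_dim B J)) = 2 * int (card P) + 1"
  obtains J0 where "J0 \<in> P" "sub_dim B J0 = 3" "\<And>J. J \<in> P \<Longrightarrow> J \<noteq> J0 \<Longrightarrow> sub_dim B J = 2"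
proof -
  let ?f = "\<lambda>J. int (sub_dim B J) - 2"
  have nonneg: "0 \<le> ?f J" if "J \<in> P" for J using block_rank_ge_2[OF that] by simp
  have sum: "(\<Sum>J\<in>P. ?f J) = 1" using assms by (simp add: sum_subtractf)
  have "\<exists>J0\<in>P. ?f J0 \<noteq> 0"
  proof (rule ccontr)
    assume "\<not> ?thesis"
    then have "(\<Sum>J\<in>P. ?f J) = 0" by (intro sum.neutral) auto
    then show False using sum by simp
  qed
  then obtain J0 where J0: "J0 \<in> P" "?f J0 \<noteq> 0" by auto
  have rem: "?f J0 + (\<Sum>J\<in>P - {J0}. ?f J) = 1"
    using sum sum.remove[OF finite_decomposition J0(1), of ?f] by simp
  have "0 \<le> (\<Sum>J\<in>P - {J0}. ?f J)" using nonneg by (intro sum_nonneg) auto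
  then have f0: "?f J0 = 1" "(\<Sum>J\<in>P - {J0}. ?f J) = 0" using rem J0 nonneg[OF J0(1)] by linarith+
  have "?f J = 0" if "J \<in> P" "J \<noteq> J0" for J
    using f0(2) sum_nonneg_eq_0_iff[of "P - {J0}" ?f] finite_decomposition nonneg that by auto
  then show ?thesis using J0(1) f0(1) by (intro that[of J0]) auto
qed

end

context
  fixes B :: "rat mat" and K :: "(nat \<Rightarrow> rat) set"
  assumes B: "presents B K" and n: "2 \<le> dim_row B"
    and pairs: "\<And>i j. i < dim_row B \<Longrightarrow> j < dim_row B \<Longrightarrow> i \<noteq> j \<Longrightarrow> indep_on K {i, j}"
    and hom: "relation_on K {..<dim_row B} (\<lambda>i. 1)"
begin

lemma gale_defect_attained:
  obtains P where "cayley_decomposition B P" "gale_defect B = int (card P) - 1 - decomposition_excess B P"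
    "0 \<le> gale_defect B"
proof -
  let ?D = "(\<lambda>P. (int (card P) - 1) - decomposition_excess B P) ` {P. cayley_decomposition B P}"
  have "{P. cayley_decomposition B P} \<subseteq> Pow (Pow {..<dim_row B})"
    unfolding cayley_decomposition_def partition_on_def by auto
  then have fin: "finite ?D" using finite_subset by blast
  have "partition_on {..<dim_row B} {{..<dim_row B}}" using n by (intro partition_on_space) (auto simp: lessThan_empty_iff)
  then have triv: "cayley_decomposition B {{..<dim_row B}}"
    unfolding cayley_decomposition_def using hom dual_homogeneous_iff[OF B subset_refl] by simp
  have "decomposition_excess B {{..<dim_row B}} = 0" unfolding decomposition_excess_def by simp
  then have mem: "0 \<in> ?D" using triv by (intro image_eqI[of _ _ "{{..<dim_row B}}"]) auto
  then have "Max ?D \<in> ?D" using fin by (intro Max_in) auto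
  then show ?thesis using Max_ge[OF fin mem] that unfolding gale_defect_def by auto
qed

text \<open>
  With \<open>p\<close> parts of total rank \<open>s = m + c\<close> and \<open>\<theta> = p - 1 - c\<close>, the inequality \<open>2p \<le> s\<close> reads
  \<open>2\<theta> \<le> m - 2 - c\<close>; near equality therefore forces \<open>c\<close> and the ranks.
\<close>

lemma twice_gale_defect_le: "2 * gale_defect B \<le> int (sub_dim B {..<dim_row B}) - 2"
proof -
  obtain P where P: "cayley_decomposition B P" "gale_defect B = int (card P) - 1 - decomposition_excess B P"
    by (rule gale_defect_attained)
  note a = sum_sub_dim[OF B P(1) n pairs] twice_card_le_sum_sub_dim[OF B P(1) n pairs]
    excess_nonneg[OF B P(1) n pairs]
  show ?thesis using a P(2) by linarith
qed

lemma gale_defect_eq_0: "sub_dim B {..<dim_row B} \<le> 3 \<Longrightarrow> gale_defect B = 0"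
proof -
  assume "sub_dim B {..<dim_row B} \<le> 3"
  moreover have "0 \<le> gale_defect B" by (rule gale_defect_attained)
  ultimately show ?thesis using twice_gale_defect_le by linarith
qed

lemma extremal_decomposition_even:
  assumes m: "sub_dim B {..<dim_row B} = 2 * k" and d: "gale_defect B = int k - 1"
  obtains P where "cayley_decomposition B P" "card P = k" "decomposition_excess B P = 0"
    "\<And>J. J \<in> P \<Longrightarrow> sub_dim B J = 2"
proof -
  obtain P where P: "cayley_decomposition B P" "gale_defect B = int (card P) - 1 - decomposition_excess B P"
    by (rule gale_defect_attained)
  note a = sum_sub_dim[OF B P(1) n pairs] twice_card_le_sum_sub_dim[OF B P(1) n pairs]
    excess_nonneg[OF B P(1) n pairs]
  have c: "decomposition_excess B P = 0" "card P = k" using a P(2) d m by linarith+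
  then have s: "(\<Sum>J\<in>P. int (sub_dim B J)) = 2 * int (card P)" using a(1) m by simp
  show ?thesis
    by (rule that[OF P(1) c(2,1)]) (rule all_ranks_2[OF B P(1) n pairs s])
qed

lemma extremal_decomposition_odd:
  assumes m: "sub_dim B {..<dim_row B} = 2 * k + 1" and d: "gale_defect B = int k - 1"
  obtains
    (join) P J0 where "cayley_decomposition B P" "card P = k" "decomposition_excess B P = 0"
      "J0 \<in> P" "sub_dim B J0 = 3" "\<And>J. J \<in> P \<Longrightarrow> J \<noteq> J0 \<Longrightarrow> sub_dim B J = 2"
  | (cayley) P where "cayley_decomposition B P" "card P = Suc k" "decomposition_excess B P = 1"
      "\<And>J. J \<in> P \<Longrightarrow> sub_dim B J = 2"
proof -
  obtain P where P: "cayley_decomposition B P" "gale_defect B = int (card P) - 1 - decomposition_excess B P"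
    by (rule gale_defect_attained)
  note a = sum_sub_dim[OF B P(1) n pairs] twice_card_le_sum_sub_dim[OF B P(1) n pairs]
    excess_nonneg[OF B P(1) n pairs]
  have "decomposition_excess B P \<le> 1" using a P(2) d m by linarith
  then consider "decomposition_excess B P = 0" | "decomposition_excess B P = 1" using a(3) by linarith
  then show ?thesis
  proof cases
    case 1
    then have c: "card P = k" using P(2) d by linarith
    have s: "(\<Sum>J\<in>P. int (sub_dim B J)) = 2 * int (card P) + 1" using a(1) 1 m c by simp
    obtain J0 where "J0 \<in> P" "sub_dim B J0 = 3" "\<And>J. J \<in> P \<Longrightarrow> J \<noteq> J0 \<Longrightarrow> sub_dim B J = 2"
      by (rule one_rank_3_others_2[OF B P(1) n _ s], rule pairs, assumption+, rule that)
    then show ?thesis by (rule join[OF P(1) c 1])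
  next
    case 2
    then have c: "card P = Suc k" using P(2) d by linarith
    have s: "(\<Sum>J\<in>P. int (sub_dim B J)) = 2 * int (card P)" using a(1) 2 m c by simp
    show ?thesis
      by (rule cayley[OF P(1) c 2]) (rule all_ranks_2[OF B P(1) n pairs s])
  qed
qed

end

section \<open>Completing integral linear forms to a unimodular matrix\<close>

definition unimodular :: "nat \<Rightarrow> int mat set" where
  "unimodular N = {X \<in> carrier_mat N N. \<exists>Y \<in> carrier_mat N N. X * Y = 1\<^sub>m N \<and> Y * X = 1\<^sub>m N}"

lemma unimodular_carrier: "X \<in> unimodular N \<Longrightarrow> X \<in> carrier_mat N N"
  unfolding unimodular_def by simp

lemma one_unimodular: "1\<^sub>m N \<in> unimodular N"
  unfolding unimodular_def by (auto intro!: bexI[of _ "1\<^sub>m N"])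

lemma mult_unimodular:
  assumes X: "X \<in> unimodular N" and Y: "Y \<in> unimodular N"
  shows "X * Y \<in> unimodular N"
proof -
  obtain X' Y' where inv: "X' \<in> carrier_mat N N" "X * X' = 1\<^sub>m N" "X' * X = 1\<^sub>m N"
    "Y' \<in> carrier_mat N N" "Y * Y' = 1\<^sub>m N" "Y' * Y = 1\<^sub>m N"
    using X Y unfolding unimodular_def by auto
  note c = unimodular_carrier[OF X] unimodular_carrier[OF Y] inv(1,4)
  have 1: "(X * Y) * (Y' * X') = 1\<^sub>m N"
  proof -
    have "(X * Y) * (Y' * X') = X * (Y * (Y' * X'))" by (rule assoc_mult_mat[OF c(1,2) mult_carrier_mat[OF c(4,3)]])
    also have "Y * (Y' * X') = (Y * Y') * X'" by (rule assoc_mult_mat[symmetric, OF c(2,4,3)])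
    finally show ?thesis using inv c by simp
  qed
  have 2: "(Y' * X') * (X * Y) = 1\<^sub>m N"
  proof -
    have "(Y' * X') * (X * Y) = Y' * (X' * (X * Y))" by (rule assoc_mult_mat[OF c(4,3) mult_carrier_mat[OF c(1,2)]])
    also have "X' * (X * Y) = (X' * X) * Y" by (rule assoc_mult_mat[symmetric, OF c(3,1,2)])
    finally show ?thesis using inv c by simp
  qed
  show ?thesis unfolding unimodular_def
    by (intro CollectI conjI bexI[OF _ mult_carrier_mat[OF c(4,3)]] mult_carrier_mat[OF c(1,2)] 1 2)
qed

text \<open>
  The inverse transpose \<open>Z\<close> of \<open>X\<close>; it carries dual systems of forms along when \<open>X\<close> is applied
  to vectors.
\<close>

lemma contragredient:
  assumes X: "X \<in> unimodular N"
  obtains Z where "Z \<in> unimodular N"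
    "\<And>l v. l \<in> carrier_vec N \<Longrightarrow> v \<in> carrier_vec N \<Longrightarrow> (Z *\<^sub>v l) \<bullet> (X *\<^sub>v v) = l \<bullet> v"
proof -
  note Xc = unimodular_carrier[OF X]
  obtain Y where Y: "Y \<in> carrier_mat N N" "X * Y = 1\<^sub>m N" "Y * X = 1\<^sub>m N"
    using X unfolding unimodular_def by auto
  have "Y\<^sup>T * X\<^sup>T = 1\<^sub>m N" "X\<^sup>T * Y\<^sup>T = 1\<^sub>m N"
    by (simp_all only: transpose_mult[OF Xc Y(1), symmetric] transpose_mult[OF Y(1) Xc, symmetric]
        Y(2,3) transpose_one)
  then have "Y\<^sup>T \<in> unimodular N" using Xc Y(1) unfolding unimodular_def by auto
  moreover have "(Y\<^sup>T *\<^sub>v l) \<bullet> (X *\<^sub>v v) = l \<bullet> v" if "l \<in> carrier_vec N" "v \<in> carrier_vec N" for l v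
  proof -
    have "(Y\<^sup>T *\<^sub>v l) \<bullet> (X *\<^sub>v v) = l \<bullet> (Y *\<^sub>v (X *\<^sub>v v))"
      using Y(1) Xc that by (intro transpose_vec_mult_scalar) auto
    also have "Y *\<^sub>v (X *\<^sub>v v) = (Y * X) *\<^sub>v v"
      by (rule assoc_mult_mat_vec[symmetric, OF Y(1) Xc that(2)])
    finally show ?thesis using Y(3) that by simp
  qed
  ultimately show ?thesis by (rule that)
qed

text \<open>
  The map \<open>v \<mapsto> v + v\<^sub>k w\<close>. Besides row operations (\<open>w\<^sub>k = 0\<close>), the case \<open>w = - 2 e\<^sub>k\<close> is used, which
  changes the sign of the entry \<open>k\<close>.
\<close>

definition transvection :: "nat \<Rightarrow> nat \<Rightarrow> int vec \<Rightarrow> int mat" where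
  "transvection N k w = mat N N (\<lambda>(i, j). (if i = j then 1 else 0) + (if j = k then w $ i else 0))"

lemma transvection_mult_vec:
  assumes "k < N" "v \<in> carrier_vec N" "i < N"
  shows "(transvection N k w *\<^sub>v v) $ i = v $ i + w $ i * v $ k"
proof -
  have "(transvection N k w *\<^sub>v v) $ i
      = (\<Sum>j\<in>{0..<N}. ((if i = j then 1 else 0) + (if j = k then w $ i else 0)) * v $ j)"
    using assms unfolding transvection_def by (simp add: scalar_prod_def)
  also have "\<dots> = (\<Sum>j\<in>{0..<N}. (if i = j then v $ j else 0) + (if j = k then w $ i * v $ j else 0))"
    by (rule sum.cong) (auto simp: algebra_simps)
  also have "\<dots> = v $ i + w $ i * v $ k" using assms by (simp add: sum.distrib)
  finally show ?thesis .
qed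

lemma transvection_mult_transvection:
  assumes k: "k < N" and w: "\<And>i. i < N \<Longrightarrow> w' $ i + (1 + w' $ k) * w $ i = 0"
  shows "transvection N k w * transvection N k w' = 1\<^sub>m N"
proof (rule eq_matI)
  fix i j assume "i < dim_row (1\<^sub>m N :: int mat)" "j < dim_col (1\<^sub>m N :: int mat)"
  then have ij: "i < N" "j < N" by auto
  have col: "col (transvection N k w') j \<in> carrier_vec N"
    using ij by (intro col_carrier_vec) (auto simp: transvection_def)
  have "(transvection N k w * transvection N k w') $$ (i, j)
      = (transvection N k w *\<^sub>v col (transvection N k w') j) $ i"
    using ij by (simp add: transvection_def)
  also have "\<dots> = col (transvection N k w') j $ i + w $ i * col (transvection N k w') j $ k"
    by (rule transvection_mult_vec[OF k col ij(1)])
  also have "\<dots> = 1\<^sub>m N $$ (i, j)"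
    using ij k w[OF ij(1)] by (auto simp: transvection_def algebra_simps)
  finally show "(transvection N k w * transvection N k w') $$ (i, j) = 1\<^sub>m N $$ (i, j)" .
qed (auto simp: transvection_def)

lemma transvection_unimodular:
  assumes k: "k < N" and w: "w \<in> carrier_vec N" "w $ k = 0 \<or> w = (- 2) \<cdot>\<^sub>v unit_vec N k"
  shows "transvection N k w \<in> unimodular N"
proof -
  have c: "transvection N k u \<in> carrier_mat N N" for u by (simp add: transvection_def)
  show ?thesis
  proof (cases "w $ k = 0")
    case True
    then have "transvection N k w * transvection N k (- w) = 1\<^sub>m N"
      "transvection N k (- w) * transvection N k w = 1\<^sub>m N"
      using k w(1) by (auto intro!: transvection_mult_transvection)
    then show ?thesis using c unfolding unimodular_def by auto
  next
    case False
    then have "w = (- 2) \<cdot>\<^sub>v unit_vec N k" using w(2) by simp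
    then have "transvection N k w * transvection N k w = 1\<^sub>m N"
      using k by (auto intro!: transvection_mult_transvection simp: unit_vec_def)
    then show ?thesis using c unfolding unimodular_def by auto
  qed
qed

text \<open>The matrices used to treat a further vector must fix the first \<open>k\<close> unit vectors.\<close>

definition fixes_below :: "nat \<Rightarrow> nat \<Rightarrow> int mat \<Rightarrow> bool" where
  "fixes_below N k X \<longleftrightarrow>
     (\<forall>v\<in>carrier_vec N. (\<forall>i<N. k \<le> i \<longrightarrow> v $ i = 0) \<longrightarrow> X *\<^sub>v v = v)"

lemma transvection_fixes_below:
  assumes "k \<le> j" "j < N" shows "fixes_below N k (transvection N j w)"
  unfolding fixes_below_def
proof (intro ballI impI)
  fix v :: "int vec" assume v: "v \<in> carrier_vec N" "\<forall>i<N. k \<le> i \<longrightarrow> v $ i = 0"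
  show "transvection N j w *\<^sub>v v = v"
  proof (rule eq_vecI)
    fix i assume "i < dim_vec v"
    then show "(transvection N j w *\<^sub>v v) $ i = v $ i"
      using transvection_mult_vec[OF assms(2) v(1), of i w] v assms by simp
  qed (use v in \<open>simp add: transvection_def\<close>)
qed

lemma one_fixes_below: "fixes_below N k (1\<^sub>m N)"
  unfolding fixes_below_def by simp

lemma fixes_below_mult:
  assumes "X \<in> carrier_mat N N" "Y \<in> carrier_mat N N" "fixes_below N k X" "fixes_below N k Y"
  shows "fixes_below N k (X * Y)"
  unfolding fixes_below_def
proof (intro ballI impI)
  fix v :: "int vec" assume v: "v \<in> carrier_vec N" "\<forall>i<N. k \<le> i \<longrightarrow> v $ i = 0"
  have "(X * Y) *\<^sub>v v = X *\<^sub>v (Y *\<^sub>v v)" by (rule assoc_mult_mat_vec[OF assms(1,2) v(1)])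
  then show "(X * Y) *\<^sub>v v = v" using assms(3,4) v unfolding fixes_below_def by simp
qed

text \<open>
  Euclid's algorithm on the entries with index at least \<open>k\<close>: while two of them are nonzero, a row
  operation with the smaller one decreases the sum of their absolute values.
\<close>

lemma euclid_on_tail:
  assumes k: "k < N" and y: "y \<in> carrier_vec N"
  shows "\<exists>X\<in>unimodular N. fixes_below N k X \<and> (\<forall>i<N. k < i \<longrightarrow> (X *\<^sub>v y) $ i = 0)"
  using y
proof (induction "nat (\<Sum>i\<in>{k..<N}. \<bar>y $ i\<bar>)" arbitrary: y rule: less_induct)
  case less
  note y = less.prems
  have step: "\<exists>X\<in>unimodular N. fixes_below N k X \<and> (\<forall>i<N. k < i \<longrightarrow> (X *\<^sub>v y) $ i = 0)"
    if T: "T \<in> unimodular N" "fixes_below N k T"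
      and X: "\<exists>X\<in>unimodular N. fixes_below N k X \<and> (\<forall>i<N. k < i \<longrightarrow> (X *\<^sub>v (T *\<^sub>v y)) $ i = 0)" for T
  proof -
    obtain X where X: "X \<in> unimodular N" "fixes_below N k X" "\<forall>i<N. k < i \<longrightarrow> (X *\<^sub>v (T *\<^sub>v y)) $ i = 0"
      using X by auto
    note c = unimodular_carrier[OF X(1)] unimodular_carrier[OF T(1)]
    have "(X * T) *\<^sub>v y = X *\<^sub>v (T *\<^sub>v y)" by (rule assoc_mult_mat_vec[OF c y])
    then show ?thesis using mult_unimodular[OF X(1) T(1)] fixes_below_mult[OF c X(2) T(2)] X(3)
      by (intro bexI[of _ "X * T"]) auto
  qed
  define row_op where "row_op i l a = transvection N l (a \<cdot>\<^sub>v unit_vec N i)" for i l a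
  have op: "row_op i l a \<in> unimodular N" "fixes_below N k (row_op i l a)"
    "\<And>v t. v \<in> carrier_vec N \<Longrightarrow> t < N \<Longrightarrow> (row_op i l a *\<^sub>v v) $ t = v $ t + (if t = i then a * v $ l else 0)"
    if "i < N" "l < N" "k \<le> l" "i \<noteq> l" for i l a
  proof -
    show "row_op i l a \<in> unimodular N"
      unfolding row_op_def using that by (intro transvection_unimodular) (simp_all add: unit_vec_def)
    show "fixes_below N k (row_op i l a)"
      unfolding row_op_def by (rule transvection_fixes_below[OF that(3,2)])
    show "(row_op i l a *\<^sub>v v) $ t = v $ t + (if t = i then a * v $ l else 0)"
      if v: "v \<in> carrier_vec N" "t < N" for v t
      unfolding row_op_def transvection_mult_vec[OF \<open>l < N\<close> v] using \<open>i < N\<close> v(2)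
      by (simp add: unit_vec_def)
  qed
  have opc: "row_op i l a *\<^sub>v v \<in> carrier_vec N" for i l a v
    unfolding row_op_def transvection_def carrier_vec_def by simp
  show ?case
  proof (cases "\<exists>i l. i \<in> {k..<N} \<and> l \<in> {k..<N} \<and> i \<noteq> l \<and> y $ l \<noteq> 0 \<and> \<bar>y $ l\<bar> \<le> \<bar>y $ i\<bar>")
    case True
    then obtain i l where il: "i \<in> {k..<N}" "l \<in> {k..<N}" "i \<noteq> l" "y $ l \<noteq> 0" "\<bar>y $ l\<bar> \<le> \<bar>y $ i\<bar>"
      by auto
    \<comment> \<open>with this sign, \<open>\<bar>y\<^sub>i + a y\<^sub>l\<bar> = \<bar>y\<^sub>i\<bar> - \<bar>y\<^sub>l\<bar>\<close>\<close>
    define a where "a = - (sgn (y $ i) * sgn (y $ l))"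
    let ?T = "row_op i l a"
    have Ty: "(?T *\<^sub>v y) $ t = y $ t + (if t = i then a * y $ l else 0)" if "t < N" for t
      using op(3)[of i l y t a] il y that by simp
    have dec: "\<bar>(?T *\<^sub>v y) $ i\<bar> < \<bar>y $ i\<bar>"
      using Ty[of i] il(1,4,5) by (auto simp: a_def sgn_if abs_if split: if_splits)
    have rest: "(\<Sum>t\<in>{k..<N} - {i}. \<bar>(?T *\<^sub>v y) $ t\<bar>) = (\<Sum>t\<in>{k..<N} - {i}. \<bar>y $ t\<bar>)"
      using Ty by (intro sum.cong) auto
    have "(\<Sum>t\<in>{k..<N}. \<bar>(?T *\<^sub>v y) $ t\<bar>) < (\<Sum>t\<in>{k..<N}. \<bar>y $ t\<bar>)"
      using dec rest sum.remove[of "{k..<N}" i "\<lambda>t. \<bar>(?T *\<^sub>v y) $ t\<bar>"]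
        sum.remove[of "{k..<N}" i "\<lambda>t. \<bar>y $ t\<bar>"] il(1) by simp
    moreover have "0 \<le> (\<Sum>t\<in>{k..<N}. \<bar>(?T *\<^sub>v y) $ t\<bar>)" by (rule sum_nonneg) simp
    ultimately have "nat (\<Sum>t\<in>{k..<N}. \<bar>(?T *\<^sub>v y) $ t\<bar>) < nat (\<Sum>t\<in>{k..<N}. \<bar>y $ t\<bar>)" by linarith
    from less.hyps[OF this opc] show ?thesis using op(1,2)[of i l a] il by (intro step[of ?T]) auto
  next
    case False
    \<comment> \<open>at most one entry with index at least \<open>k\<close> is nonzero: two would compare in absolute value, one way or the other\<close>
    show ?thesis
    proof (cases "\<exists>i<N. k < i \<and> y $ i \<noteq> 0")
      case no: False
      then show ?thesis using y one_unimodular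
        by (intro bexI[of _ "1\<^sub>m N"]) (auto simp: fixes_below_def)
    next
      case True
      then obtain i where i: "i < N" "k < i" "y $ i \<noteq> 0" by auto
      have zero: "y $ l = 0" if l: "l < N" "k \<le> l" "l \<noteq> i" for l
      proof (rule ccontr)
        assume "y $ l \<noteq> 0"
        then show False using False i l linear[of "\<bar>y $ l\<bar>" "\<bar>y $ i\<bar>"] by fastforce
      qed
      \<comment> \<open>copy the entry \<open>i\<close> to the position \<open>k\<close>, then clear the position \<open>i\<close>\<close>
      let ?S = "row_op k i 1" and ?T = "row_op i k (- 1)"
      have Sy: "(?S *\<^sub>v y) $ t = y $ t + (if t = k then y $ i else 0)" if "t < N" for t
        using op(3)[of k i y t 1] i k y that by simp
      have TSy: "(?T *\<^sub>v (?S *\<^sub>v y)) $ t = 0" if t: "t < N" "k < t" for t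
        using op(3)[of i k "?S *\<^sub>v y" t "- 1"] i k opc Sy t zero by auto
      have "\<exists>X\<in>unimodular N. fixes_below N k X \<and> (\<forall>t<N. k < t \<longrightarrow> (X *\<^sub>v (?S *\<^sub>v y)) $ t = 0)"
        using op(1,2)[of i k "- 1"] i k TSy by (intro bexI[of _ ?T]) auto
      then show ?thesis using op(1,2)[of k i 1] i k by (intro step[of ?S]) auto
    qed
  qed
qed

text \<open>
  After Euclid's algorithm, only the entry \<open>k\<close> of the tail remains, and pairing with the transported
  form \<open>l\<close> shows that it is \<open>\<pm>1\<close>. A sign change makes it 1, and one transvection clears the entries
  below \<open>k\<close>.
\<close>

lemma primitive_tail_to_unit_vec:
  assumes k: "k < N" and y: "y \<in> carrier_vec N" and l: "l \<in> carrier_vec N" "l \<bullet> y = 1"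
    and l0: "\<And>i. i < k \<Longrightarrow> l $ i = 0"
  shows "\<exists>X\<in>unimodular N. fixes_below N k X \<and> X *\<^sub>v y = unit_vec N k"
proof -
  obtain X where X: "X \<in> unimodular N" "fixes_below N k X" and z0: "\<And>i. i < N \<Longrightarrow> k < i \<Longrightarrow> (X *\<^sub>v y) $ i = 0"
    using euclid_on_tail[OF k y] by auto
  note Xc = unimodular_carrier[OF X(1)]
  define z where "z = X *\<^sub>v y"
  have z: "z \<in> carrier_vec N" using Xc y by (simp add: z_def)
  obtain Z where Z: "Z \<in> unimodular N"
    "\<And>l v. l \<in> carrier_vec N \<Longrightarrow> v \<in> carrier_vec N \<Longrightarrow> (Z *\<^sub>v l) \<bullet> (X *\<^sub>v v) = l \<bullet> v"
    using contragredient[OF X(1)] by metis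
  define m where "m = Z *\<^sub>v l"
  have m: "m \<in> carrier_vec N" using unimodular_carrier[OF Z(1)] l(1) by (simp add: m_def)
  have m0: "m $ i = 0" if i: "i < k" for i
  proof -
    have "X *\<^sub>v unit_vec N i = unit_vec N i"
      using X(2) i k unfolding fixes_below_def by (simp add: unit_vec_def)
    then have "m \<bullet> unit_vec N i = l \<bullet> unit_vec N i"
      using Z(2)[OF l(1), of "unit_vec N i"] by (simp add: m_def)
    then show ?thesis using i k l m l0 by simp
  qed
  have "1 = m \<bullet> z" using Z(2)[OF l(1) y] l(2) by (simp add: m_def z_def)
  also have "\<dots> = (\<Sum>i\<in>{0..<N}. m $ i * z $ i)" using z by (simp add: scalar_prod_def)
  also have "\<dots> = (\<Sum>i\<in>{k}. m $ i * z $ i)"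
    using k m0 z0 by (intro sum.mono_neutral_right) (auto simp: z_def nat_neq_iff)
  finally have "m $ k * z $ k = 1" by simp
  then have zk: "z $ k = 1 \<or> z $ k = - 1" by (metis mult.commute pos_zmult_eq_1_iff zmult_eq_1_iff)
  let ?D = "if z $ k = 1 then 1\<^sub>m N else transvection N k ((- 2) \<cdot>\<^sub>v unit_vec N k)"
  have D: "?D \<in> unimodular N" "fixes_below N k ?D"
    using k one_unimodular one_fixes_below transvection_unimodular transvection_fixes_below by auto
  note Dc = unimodular_carrier[OF D(1)]
  define u where "u = ?D *\<^sub>v z"
  have u: "u \<in> carrier_vec N" using Dc z by (simp add: u_def)
  have uk: "u $ k = 1"
    using zk z k transvection_mult_vec[OF k z k, of "(- 2) \<cdot>\<^sub>v unit_vec N k"] by (auto simp: u_def)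
  let ?w = "vec N (\<lambda>i. if i = k then 0 else - u $ i)"
  let ?T = "transvection N k ?w"
  have T: "?T \<in> unimodular N" "fixes_below N k ?T"
    using k transvection_unimodular transvection_fixes_below by auto
  note Tc = unimodular_carrier[OF T(1)]
  have "?T *\<^sub>v u = unit_vec N k"
  proof (rule eq_vecI)
    fix i assume "i < dim_vec (unit_vec N k :: int vec)"
    then show "(?T *\<^sub>v u) $ i = unit_vec N k $ i"
      using transvection_mult_vec[OF k u, of i ?w] uk k by (simp add: unit_vec_def)
  qed (use Tc in simp)
  moreover have "(?T * (?D * X)) *\<^sub>v y = ?T *\<^sub>v u"
  proof -
    have "(?T * (?D * X)) *\<^sub>v y = ?T *\<^sub>v ((?D * X) *\<^sub>v y)"
      by (rule assoc_mult_mat_vec[OF Tc _ y]) (use Dc Xc in simp)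
    also have "(?D * X) *\<^sub>v y = u" using assoc_mult_mat_vec[OF Dc Xc y] by (simp add: u_def z_def)
    finally show ?thesis .
  qed
  ultimately show ?thesis
    using mult_unimodular[OF T(1) mult_unimodular[OF D(1) X(1)]]
      fixes_below_mult[OF Tc _ T(2) fixes_below_mult[OF Dc Xc D(2) X(2)]] Dc Xc
    by (intro bexI[of _ "?T * (?D * X)"]) auto
qed

text \<open>
  Once \<open>g 0, \<dots>, g (k - 1)\<close> are unit vectors, the dual form of \<open>g k\<close> vanishes on them and so has
  zero entries below \<open>k\<close>; it certifies that the remaining entries of \<open>g k\<close> are coprime.
\<close>

lemma primitive_system_to_unit_vecs:
  assumes "\<And>j. j < k \<Longrightarrow> g j \<in> carrier_vec N" "\<And>j. j < k \<Longrightarrow> l j \<in> carrier_vec N"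
    and "\<And>i j. i < k \<Longrightarrow> j < k \<Longrightarrow> l i \<bullet> g j = (if i = j then 1 else 0 :: int)"
  shows "k \<le> N \<and> (\<exists>X\<in>unimodular N. \<forall>j<k. X *\<^sub>v g j = unit_vec N j)"
  using assms
proof (induction k)
  case 0
  then show ?case using one_unimodular by auto
next
  case (Suc k)
  have "k \<le> N \<and> (\<exists>X\<in>unimodular N. \<forall>j<k. X *\<^sub>v g j = unit_vec N j)"
    by (rule Suc.IH) (use Suc.prems in auto)
  then obtain X where kN: "k \<le> N" and X: "X \<in> unimodular N" and Xg: "\<And>j. j < k \<Longrightarrow> X *\<^sub>v g j = unit_vec N j"
    by auto
  note Xc = unimodular_carrier[OF X]
  obtain Z where Z: "Z \<in> unimodular N"
    "\<And>l v. l \<in> carrier_vec N \<Longrightarrow> v \<in> carrier_vec N \<Longrightarrow> (Z *\<^sub>v l) \<bullet> (X *\<^sub>v v) = l \<bullet> v"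
    using contragredient[OF X] by metis
  define m where "m = Z *\<^sub>v l k"
  define y where "y = X *\<^sub>v g k"
  have gk: "g k \<in> carrier_vec N" "l k \<in> carrier_vec N" using Suc.prems by auto
  have m: "m \<in> carrier_vec N" and y: "y \<in> carrier_vec N"
    using unimodular_carrier[OF Z(1)] Xc gk by (auto simp: m_def y_def)
  have m0: "m $ j = 0" if j: "j < k" for j
  proof -
    have "m \<bullet> unit_vec N j = l k \<bullet> g j"
      using Z(2)[OF gk(2), of "g j"] Suc.prems(1)[of j] Xg[OF j] j by (simp add: m_def)
    then show ?thesis using Suc.prems(3)[of k j] j kN m by simp
  qed
  have my: "m \<bullet> y = 1" using Z(2)[OF gk(2,1)] Suc.prems(3)[of k k] by (simp add: m_def y_def)
  have "k < N"
  proof (rule ccontr)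
    assume "\<not> k < N"
    then have "m \<bullet> y = 0" using m0 y by (simp add: scalar_prod_def)
    then show False using my by simp
  qed
  from primitive_tail_to_unit_vec[OF this y m my m0]
  obtain Y where Y: "Y \<in> unimodular N" "fixes_below N k Y" "Y *\<^sub>v y = unit_vec N k" by auto
  note Yc = unimodular_carrier[OF Y(1)]
  have "(Y * X) *\<^sub>v g j = unit_vec N j" if j: "j < Suc k" for j
  proof -
    have gj: "g j \<in> carrier_vec N" using Suc.prems(1) j by simp
    have "(Y * X) *\<^sub>v g j = Y *\<^sub>v (X *\<^sub>v g j)" by (rule assoc_mult_mat_vec[OF Yc Xc gj])
    also have "\<dots> = unit_vec N j"
    proof (cases "j = k")
      case True
      then show ?thesis using Y(3) by (simp add: y_def)
    next
      case False
      then have "j < k" using j by simp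
      then show ?thesis using Xg Y(2) \<open>k < N\<close> unfolding fixes_below_def by (simp add: unit_vec_def)
    qed
    finally show ?thesis .
  qed
  then show ?case using mult_unimodular[OF Y(1) X] \<open>k < N\<close> by auto
qed

text \<open>
  The roles of forms and vectors are exchanged: \<open>X\<close> maps the forms \<open>h j\<close> to unit vectors, and its
  inverse transpose is the required matrix.
\<close>

lemma complete_to_unimodular:
  assumes h: "\<And>j. j < k \<Longrightarrow> h j \<in> carrier_vec N" and s: "\<And>j. j < k \<Longrightarrow> s j \<in> carrier_vec N"
    and hs: "\<And>i j. i < k \<Longrightarrow> j < k \<Longrightarrow> h i \<bullet> s j = (if i = j then 1 else 0 :: int)"
  obtains U where "k \<le> N" "U \<in> unimodular N"
    "\<And>j v. j < k \<Longrightarrow> v \<in> carrier_vec N \<Longrightarrow> (U *\<^sub>v v) $ j = h j \<bullet> v"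
proof -
  have sh: "s i \<bullet> h j = (if i = j then 1 else 0)" if "i < k" "j < k" for i j
    using hs[OF that(2,1)] comm_scalar_prod[OF h s, OF that(2,1)] by auto
  obtain X where kN: "k \<le> N" and X: "X \<in> unimodular N" and Xh: "\<And>j. j < k \<Longrightarrow> X *\<^sub>v h j = unit_vec N j"
    using primitive_system_to_unit_vecs[of k h N s, OF h s sh] by auto
  obtain Z where Z: "Z \<in> unimodular N"
    "\<And>l v. l \<in> carrier_vec N \<Longrightarrow> v \<in> carrier_vec N \<Longrightarrow> (Z *\<^sub>v l) \<bullet> (X *\<^sub>v v) = l \<bullet> v"
    using contragredient[OF X] by metis
  have "(Z *\<^sub>v v) $ j = h j \<bullet> v" if j: "j < k" and v: "v \<in> carrier_vec N" for j v
  proof -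
    have "(Z *\<^sub>v v) \<bullet> unit_vec N j = v \<bullet> h j" using Z(2)[OF v h[OF j]] Xh[OF j] by simp
    moreover have "(Z *\<^sub>v v) \<bullet> unit_vec N j = (Z *\<^sub>v v) $ j"
      using unimodular_carrier[OF Z(1)] v j kN by simp
    ultimately show ?thesis using comm_scalar_prod[OF h[OF j] v] by simp
  qed
  then show ?thesis by (rule that[OF kN Z(1)])
qed

section \<open>Reindexing\<close>

text \<open>
  Restricting to a block and permuting both pull relations back along an injection \<open>\<sigma>\<close> of index
  sets, under which bases correspond.
\<close>

lemma basis_on_reindex:
  assumes inj: "inj_on \<sigma> J'"
    and KK': "\<And>x'. x' \<in> K' \<Longrightarrow> \<exists>x\<in>K. \<forall>p\<in>J'. x' p = x (\<sigma> p)"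
    and K'K: "\<And>x. x \<in> K \<Longrightarrow> \<exists>x'\<in>K'. \<forall>p\<in>J'. x' p = x (\<sigma> p)"
    and I': "I' \<subseteq> J'"
  shows "indep_on K (\<sigma> ` I') \<Longrightarrow> indep_on K' I'"
    and "basis_on K (\<sigma> ` J') (\<sigma> ` I') \<Longrightarrow> basis_on K' J' I'"
proof -
  have inj': "inj_on \<sigma> I'" using inj I' by (rule inj_on_subset)
  have sum: "(\<Sum>p\<in>I'. c (\<sigma> p) * x' p) = (\<Sum>i\<in>\<sigma> ` I'. c i * x i)"
    if "\<forall>p\<in>J'. x' p = x (\<sigma> p)" for c x x' :: "_ \<Rightarrow> rat"
    unfolding sum.reindex[OF inj'] using that I' by (intro sum.cong) auto
  show ind: "indep_on K' I'" if ind: "indep_on K (\<sigma> ` I')"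
    unfolding indep_on_def
  proof (intro allI impI)
    fix c assume c: "relation_on K' I' c"
    define b where "b = c \<circ> inv_into I' \<sigma>"
    have b: "b (\<sigma> p) = c p" if "p \<in> I'" for p using that inj' by (simp add: b_def)
    have "(\<Sum>i\<in>\<sigma> ` I'. b i * x i) = 0" if x: "x \<in> K" for x
    proof -
      obtain x' where x': "x' \<in> K'" "\<forall>p\<in>J'. x' p = x (\<sigma> p)" using K'K[OF x] by auto
      have "(\<Sum>i\<in>\<sigma> ` I'. b i * x i) = (\<Sum>p\<in>I'. b (\<sigma> p) * x' p)" using sum[OF x'(2), of b] by simp
      also have "\<dots> = (\<Sum>p\<in>I'. c p * x' p)" using b by simp
      finally show ?thesis using c x'(1) unfolding relation_on_def by simp
    qed
    then have "b i = 0" if "i \<in> \<sigma> ` I'" for i using indep_onD[OF ind, of b i] that by simp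
    then show "\<forall>p\<in>I'. c p = 0" using b by auto
  qed
  show "basis_on K' J' I'" if B: "basis_on K (\<sigma> ` J') (\<sigma> ` I')"
  proof -
    have "depends_on K' I' j" if j: "j \<in> J'" for j
    proof -
      obtain c where c: "\<And>x. x \<in> K \<Longrightarrow> x (\<sigma> j) = (\<Sum>i\<in>\<sigma> ` I'. c i * x i)"
        using basis_onD(3)[OF B imageI[OF j]] by (rule depends_onE) auto
      show ?thesis
      proof (rule depends_onI[where c = "\<lambda>p. c (\<sigma> p)"])
        fix x' assume "x' \<in> K'"
        then obtain x where x: "x \<in> K" "\<forall>p\<in>J'. x' p = x (\<sigma> p)" using KK' by auto
        show "x' j = (\<Sum>p\<in>I'. c (\<sigma> p) * x' p)" using sum[OF x(2), of c] c[OF x(1)] x(2) j by simp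
      qed
    qed
    then show ?thesis using ind[OF basis_onD(2)[OF B]] I' unfolding basis_on_def by simp
  qed
qed

lemma sub_dim_reindex:
  assumes inj: "inj_on \<sigma> J'"
    and KK': "\<And>x'. x' \<in> K' \<Longrightarrow> \<exists>x\<in>K. \<forall>p\<in>J'. x' p = x (\<sigma> p)"
    and K'K: "\<And>x. x \<in> K \<Longrightarrow> \<exists>x'\<in>K'. \<forall>p\<in>J'. x' p = x (\<sigma> p)"
    and B: "presents B K" "\<sigma> ` J' \<subseteq> {..<dim_row B}" and B': "presents B' K'" "J' \<subseteq> {..<dim_row B'}"
  shows "sub_dim B' J' = sub_dim B (\<sigma> ` J')"
proof -
  have "finite (\<sigma> ` J')" using B(2) finite_subset by blast
  then obtain I where I: "basis_on K (\<sigma> ` J') I" by (rule basis_on_exists)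
  obtain I' where I': "I' \<subseteq> J'" "I = \<sigma> ` I'" using basis_onD(1)[OF I] by (auto simp: subset_image_iff)
  have "basis_on K' J' I'" using basis_on_reindex(2)[OF inj KK' K'K I'(1)] I I'(2) by simp
  then have "sub_dim B' J' = card I'" by (rule sub_dim_eq_card_basis[OF B'])
  moreover have "sub_dim B (\<sigma> ` J') = card I" by (rule sub_dim_eq_card_basis[OF B I])
  moreover have "card I = card I'" unfolding I'(2) using card_image inj_on_subset[OF inj I'(1)] by blast
  ultimately show ?thesis by simp
qed


section \<open>Lattices\<close>

text \<open>
  The integral combinations with coefficient sum 0 form a group that contains the differences; they
  are integral combinations of the differences to one fixed element.
\<close>

lemma difference_group_iff:
  assumes carr: "set C \<subseteq> carrier_vec e"
  shows "x \<in> carrier (difference_group e C) \<longleftrightarrow>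
    x \<in> carrier_vec e \<and>
    (\<exists>c. (\<Sum>i<length C. c i) = 0 \<and> (\<forall>t<e. x $ t = (\<Sum>i<length C. c i * C ! i $ t)))"
proof -
  let ?G = "monoid_vec TYPE(int) e" and ?n = "length C"
  interpret G: comm_group ?G by (rule comm_group_vec)
  let ?H = "{x \<in> carrier_vec e. \<exists>c. (\<Sum>i<?n. c i) = 0 \<and> (\<forall>t<e. x $ t = (\<Sum>i<?n. c i * C ! i $ t))}"
  have Ci: "C ! i \<in> carrier_vec e" if "i < ?n" for i using carr that by auto
  have inv: "inv\<^bsub>?G\<^esub> x = - x" if "x \<in> carrier_vec e" for x
    using that by (intro G.inv_equality) (auto simp: monoid_vec_simps)
  have "subgroup ?H ?G"
  proof (rule G.subgroupI)
    show "?H \<subseteq> carrier ?G" by (auto simp: monoid_vec_simps)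
    have "0\<^sub>v e \<in> ?H" by (auto intro!: exI[of _ "\<lambda>_. 0"])
    then show "?H \<noteq> {}" by blast
    fix x assume "x \<in> ?H"
    then obtain c where c: "x \<in> carrier_vec e" "(\<Sum>i<?n. c i) = 0" "\<forall>t<e. x $ t = (\<Sum>i<?n. c i * C ! i $ t)"
      by auto
    show "inv\<^bsub>?G\<^esub> x \<in> ?H"
      unfolding inv[OF c(1)] using c by (auto intro!: exI[of _ "\<lambda>i. - c i"] simp: sum_negf)
    fix y assume "y \<in> ?H"
    then obtain b where b: "y \<in> carrier_vec e" "(\<Sum>i<?n. b i) = 0" "\<forall>t<e. y $ t = (\<Sum>i<?n. b i * C ! i $ t)"
      by auto
    show "x \<otimes>\<^bsub>?G\<^esub> y \<in> ?H"
      using b c by (auto intro!: exI[of _ "\<lambda>i. c i + b i"] simp: monoid_vec_simps sum.distrib distrib_right)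
  qed
  moreover have "differences C \<subseteq> ?H"
  proof
    fix x assume "x \<in> differences C"
    then obtain i l where il: "i < ?n" "l < ?n" "x = C ! i - C ! l"
      unfolding differences_def by (auto simp: in_set_conv_nth)
    let ?c = "\<lambda>m. (if m = i then 1 else 0) - (if m = l then 1 else 0 :: int)"
    have "(\<Sum>m<?n. ?c m) = 0" using il by (simp add: sum_subtractf)
    moreover have "x $ t = (\<Sum>m<?n. ?c m * C ! m $ t)" if "t < e" for t
    proof -
      have "(\<Sum>m<?n. ?c m * C ! m $ t) = (\<Sum>m<?n. (if m = i then C ! m $ t else 0) - (if m = l then C ! m $ t else 0))"
        by (rule sum.cong) auto
      moreover have "C ! l \<in> carrier_vec e" using Ci il by simp
      ultimately show ?thesis using il that by (simp add: sum_subtractf)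
    qed
    ultimately show "x \<in> ?H" using il Ci by (auto intro!: exI[of _ ?c])
  qed
  ultimately have sub: "carrier (difference_group e C) \<subseteq> ?H"
    unfolding difference_group_def by (intro G.subgroup_generated_minimal)
  let ?D = "carrier (difference_group e C)"
  have D: "subgroup ?D ?G" unfolding difference_group_def by (rule G.subgroup_subgroup_generated)
  have D0: "0\<^sub>v e \<in> ?D" using subgroup.one_closed[OF D] by (simp add: monoid_vec_simps)
  have Dplus: "x + y \<in> ?D" if "x \<in> ?D" "y \<in> ?D" for x y
    using subgroup.m_closed[OF D that] by (simp add: monoid_vec_simps)
  have Dc: "?D \<subseteq> carrier_vec e" using sub by auto
  have Dneg: "- x \<in> ?D" if "x \<in> ?D" for x
    using subgroup.m_inv_closed[OF D that] inv[of x] Dc that by auto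
  have Dnat: "int m \<cdot>\<^sub>v x \<in> ?D" if x: "x \<in> ?D" for m x
  proof (induction m)
    case 0
    have "int 0 \<cdot>\<^sub>v x = 0\<^sub>v e" using x Dc by (intro eq_vecI) auto
    then show ?case using D0 by simp
  next
    case (Suc m)
    have "int (Suc m) \<cdot>\<^sub>v x = int m \<cdot>\<^sub>v x + x" by (rule eq_vecI) (auto simp: algebra_simps)
    then show ?case using Dplus[OF Suc x] by simp
  qed
  have Dint: "m \<cdot>\<^sub>v x \<in> ?D" if x: "x \<in> ?D" for m x
  proof (cases "0 \<le> m")
    case True
    then show ?thesis using Dnat[OF x, of "nat m"] by simp
  next
    case False
    have "m \<cdot>\<^sub>v x = - (int (nat (- m)) \<cdot>\<^sub>v x)" using False by (intro eq_vecI) auto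
    then show ?thesis using Dneg[OF Dnat[OF x, of "nat (- m)"]] by (simp only:)
  qed
  have diff: "C ! i - C ! 0 \<in> ?D" if i: "i < ?n" for i
  proof -
    have "0 < ?n" using i by linarith
    then have "C ! i \<in> set C" "C ! 0 \<in> set C" "C ! i - C ! 0 \<in> carrier_vec e"
      using i Ci[OF i] Ci[OF \<open>0 < ?n\<close>] by auto
    then have "C ! i - C ! 0 \<in> carrier ?G \<inter> differences C"
      unfolding differences_def monoid_vec_simps by blast
    then show ?thesis
      unfolding difference_group_def carrier_subgroup_generated by (rule generate.incl)
  qed
  have comb: "vec e (\<lambda>t. \<Sum>i\<in>F. c i * (C ! i $ t - C ! 0 $ t)) \<in> ?D" if "finite F" "F \<subseteq> {..<?n}" for F c
    using that
  proof (induction F)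
    case empty
    have "vec e (\<lambda>t. 0 :: int) = 0\<^sub>v e" by auto
    then show ?case using D0 by simp
  next
    case (insert i F)
    then have i: "i < ?n" by simp
    have "0 < ?n" using i by linarith
    have "vec e (\<lambda>t. \<Sum>i\<in>insert i F. c i * (C ! i $ t - C ! 0 $ t))
        = c i \<cdot>\<^sub>v (C ! i - C ! 0) + vec e (\<lambda>t. \<Sum>i\<in>F. c i * (C ! i $ t - C ! 0 $ t))"
      using insert(1,2) Ci[OF i] Ci[OF \<open>0 < ?n\<close>] by (intro eq_vecI) auto
    then show ?case using Dplus[OF Dint[OF diff[OF i]] insert.IH] insert.prems by simp
  qed
  have "?H \<subseteq> ?D"
  proof
    fix x assume "x \<in> ?H"
    then obtain c where c: "x \<in> carrier_vec e" "(\<Sum>i<?n. c i) = 0" "\<forall>t<e. x $ t = (\<Sum>i<?n. c i * C ! i $ t)"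
      by auto
    have "x = vec e (\<lambda>t. \<Sum>i<?n. c i * (C ! i $ t - C ! 0 $ t))"
    proof (rule eq_vecI)
      fix t assume "t < dim_vec (vec e (\<lambda>t. \<Sum>i<?n. c i * (C ! i $ t - C ! 0 $ t)))"
      then have t: "t < e" by simp
      have "(\<Sum>i<?n. c i * (C ! i $ t - C ! 0 $ t)) = (\<Sum>i<?n. c i * C ! i $ t) - (\<Sum>i<?n. c i) * C ! 0 $ t"
        by (simp add: right_diff_distrib sum_subtractf sum_distrib_right)
      then show "x $ t = vec e (\<lambda>t. \<Sum>i<?n. c i * (C ! i $ t - C ! 0 $ t)) $ t" using c t by simp
    qed (use c in simp)
    then show "x \<in> ?D" using comb[of "{..<?n}" c] by simp
  qed
  with sub have "?D = ?H" by (rule equalityI)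
  then show ?thesis by blast
qed

text \<open>
  Subtracting \<open>z\<^sub>0 (1, a'\<^sub>0)\<close> from a vector \<open>z\<close> leaves a vector with first coordinate 0, which is an
  integral combination of the differences of \<open>A'\<close>. So the points \<open>(1, a')\<close> generate \<open>\<int>\<^bsup>d+1\<^esup>\<close>.
\<close>

context
  fixes d :: nat and A' :: config
  assumes carr: "set A' \<subseteq> carrier_vec d" and A': "A' \<noteq> []"
    and gen: "carrier (difference_group d A') = carrier_vec d"
begin

lemma homogenization_generates:
  assumes z: "z \<in> carrier_vec (Suc d)"
  shows "\<exists>c. \<forall>t<Suc d. z $ t = (\<Sum>i<length A'. c i * homogenization A' ! i $ t)"
proof -
  let ?n = "length A'"
  have n: "0 < ?n" using A' by simp
  define z' where "z' = vec d (\<lambda>t. z $ Suc t - z $ 0 * A' ! 0 $ t)"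
  have "z' \<in> carrier (difference_group d A')" unfolding gen by (simp add: z'_def)
  then obtain c where c: "(\<Sum>i<?n. c i) = 0" "\<forall>t<d. z' $ t = (\<Sum>i<?n. c i * A' ! i $ t)"
    using difference_group_iff[OF carr] by auto
  define b where "b i = c i + (if i = 0 then z $ 0 else 0)" for i
  have bsum: "(\<Sum>i<?n. b i * f i) = (\<Sum>i<?n. c i * f i) + z $ 0 * f 0" for f
  proof -
    have "(\<Sum>i<?n. b i * f i) = (\<Sum>i<?n. c i * f i + (if i = 0 then z $ 0 * f i else 0))"
      by (rule sum.cong) (auto simp: b_def algebra_simps)
    then show ?thesis using n by (simp add: sum.distrib)
  qed
  have "z $ t = (\<Sum>i<?n. b i * homogenization A' ! i $ t)" if t: "t < Suc d" for t
  proof (cases t)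
    case 0
    have "(\<Sum>i<?n. b i * homogenization A' ! i $ t) = (\<Sum>i<?n. b i * 1)"
      unfolding 0 by (rule sum.cong) (auto simp: homogenization_nth)
    also have "\<dots> = z $ t" using bsum[of "\<lambda>_. 1"] c(1) 0 by simp
    finally show ?thesis by simp
  next
    case (Suc s)
    have "(\<Sum>i<?n. b i * homogenization A' ! i $ t) = (\<Sum>i<?n. b i * A' ! i $ s)"
      unfolding Suc by (rule sum.cong) (auto simp: homogenization_nth)
    also have "\<dots> = z' $ s + z $ 0 * A' ! 0 $ s"
      using bsum[of "\<lambda>i. A' ! i $ s"] c(2) Suc t by simp
    also have "\<dots> = z $ t" using Suc t by (simp add: z'_def)
    finally show ?thesis by simp
  qed
  then show ?thesis by blast
qed

text \<open>
  \<open>\<Sum>\<^sub>J b\<^sub>i = 0\<close> says that the indicator of \<open>J\<close> is orthogonal to the kernel of \<open>A\<close>, hence a rational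
  linear form on \<open>A\<close>; taking integral values on generators of the lattice, it is integral.
\<close>

lemma integral_indicator_form:
  assumes J: "J \<subseteq> {..<length A'}"
    and rel: "relation_on (relations (Suc d) (homogenization A')) J (\<lambda>i. 1)"
  obtains h where "h \<in> carrier_vec (Suc d)"
    "\<And>i. i < length A' \<Longrightarrow> h \<bullet> (homogenization A' ! i) = (if i \<in> J then 1 else 0)"
proof -
  let ?A = "homogenization A'" and ?n = "length A'"
  note carrA = homogenization_carrier[OF carr]
  have Ai: "?A ! i \<in> carrier_vec (Suc d)" if "i < ?n" for i
    using carr that by (simp add: homogenization_nth subset_iff)
  have "\<exists>h. \<forall>i\<in>{..<?n}. (if i \<in> J then 1 else 0) = (\<Sum>t<Suc d. h t * rat_of_int (?A ! i $ t))"
  proof (rule orthogonal_to_relations_imp_combination[where f = "\<lambda>t i. rat_of_int (?A ! i $ t)"])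
    fix x assume "\<forall>t<Suc d. (\<Sum>i<?n. rat_of_int (?A ! i $ t) * x i) = 0"
    then have x: "x \<in> relations (Suc d) ?A"
      unfolding in_relations_iff[OF carrA] homogenization_nth(2) by (simp add: mult.commute)
    have "(\<Sum>i<?n. (if i \<in> J then 1 else 0) * x i) = (\<Sum>i<?n. if i \<in> J then x i else 0)"
      by (rule sum.cong) auto
    also have "\<dots> = (\<Sum>i\<in>{..<?n} \<inter> J. x i)" by (simp add: sum.inter_restrict)
    also have "{..<?n} \<inter> J = J" using J by auto
    also have "(\<Sum>i\<in>J. x i) = 0" using rel x unfolding relation_on_def by simp
    finally show "(\<Sum>i<?n. (if i \<in> J then 1 else 0) * x i) = 0" .
  qed simp
  then obtain h where h: "\<And>i. i < ?n \<Longrightarrow> (\<Sum>t<Suc d. h t * rat_of_int (?A ! i $ t)) = (if i \<in> J then 1 else 0)"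
    by auto
  have "\<exists>m. h s = rat_of_int m" if s: "s < Suc d" for s
  proof -
    obtain c where c: "\<And>t. t < Suc d \<Longrightarrow> unit_vec (Suc d) s $ t = (\<Sum>i<?n. c i * ?A ! i $ t)"
      using homogenization_generates[of "unit_vec (Suc d) s"] by auto
    have "h s = (\<Sum>t<Suc d. if t = s then h t else 0)" using s by simp
    also have "\<dots> = (\<Sum>t<Suc d. h t * rat_of_int (unit_vec (Suc d) s $ t))"
      using s by (intro sum.cong) (auto simp: unit_vec_def)
    also have "\<dots> = (\<Sum>t<Suc d. \<Sum>i<?n. rat_of_int (c i) * (h t * rat_of_int (?A ! i $ t)))"
      using c by (intro sum.cong) (auto simp: sum_distrib_left algebra_simps)
    also have "\<dots> = (\<Sum>i<?n. rat_of_int (c i) * (\<Sum>t<Suc d. h t * rat_of_int (?A ! i $ t)))"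
      by (subst sum.swap) (simp only: sum_distrib_left)
    also have "\<dots> = (\<Sum>i<?n. rat_of_int (if i \<in> J then c i else 0))"
      using h by (intro sum.cong) auto
    also have "\<dots> = rat_of_int (\<Sum>i<?n. if i \<in> J then c i else 0)" by (simp only: of_int_sum)
    finally show ?thesis by blast
  qed
  then obtain m where m: "\<And>s. s < Suc d \<Longrightarrow> h s = rat_of_int (m s)" by metis
  have "vec (Suc d) m \<bullet> (?A ! i) = (if i \<in> J then 1 else 0)" if i: "i < ?n" for i
  proof -
    have "rat_of_int (vec (Suc d) m \<bullet> (?A ! i)) = (\<Sum>t<Suc d. h t * rat_of_int (?A ! i $ t))"
      using Ai[OF i] m by (simp add: scalar_prod_def lessThan_atLeast0 del: sum.atLeast0_lessThan_Suc)
    also have "\<dots> = rat_of_int (if i \<in> J then 1 else 0)" using h[OF i] by simp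
    finally show ?thesis by (simp only: of_int_eq_iff)
  qed
  then show ?thesis by (intro that[of "vec (Suc d) m"]) auto
qed

end

section \<open>The Cayley configuration of a decomposition\<close>

text \<open>
  Rational combinations of integer vectors commute with integer matrices; all vectors here are
  integral and all relations rational.
\<close>

lemma mat_mult_vec_sum:
  fixes M :: "int mat" and y :: "'i \<Rightarrow> rat"
  assumes M: "M \<in> carrier_mat N N" and a: "\<And>i. i \<in> F \<Longrightarrow> a i \<in> carrier_vec N" and t: "t < N"
  shows "(\<Sum>i\<in>F. y i * rat_of_int ((M *\<^sub>v a i) $ t))
    = (\<Sum>s<N. rat_of_int (M $$ (t, s)) * (\<Sum>i\<in>F. y i * rat_of_int (a i $ s)))"
proof -
  have "(\<Sum>i\<in>F. y i * rat_of_int ((M *\<^sub>v a i) $ t))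
      = (\<Sum>i\<in>F. \<Sum>s<N. rat_of_int (M $$ (t, s)) * (y i * rat_of_int (a i $ s)))"
  proof (rule sum.cong[OF refl])
    fix i assume i: "i \<in> F"
    have "(M *\<^sub>v a i) $ t = (\<Sum>s<N. M $$ (t, s) * a i $ s)"
      using M a[OF i] t by (simp add: scalar_prod_def lessThan_atLeast0)
    then show "y i * rat_of_int ((M *\<^sub>v a i) $ t)
        = (\<Sum>s<N. rat_of_int (M $$ (t, s)) * (y i * rat_of_int (a i $ s)))"
      by (simp add: sum_distrib_left algebra_simps)
  qed
  also have "\<dots> = (\<Sum>s<N. rat_of_int (M $$ (t, s)) * (\<Sum>i\<in>F. y i * rat_of_int (a i $ s)))"
    by (subst sum.swap) (simp add: sum_distrib_left)
  finally show ?thesis .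
qed

text \<open>
  The first coordinates of \<open>U a\<close> are the indicators of the blocks, listed in \<open>Js\<close>. The linear form
  \<open>h\<close> only records that \<open>A\<close> is homogeneous.
\<close>

locale cayley_form =
  fixes N :: nat and A :: config and h :: "nat \<Rightarrow> rat" and U :: "int mat" and Js :: "nat set list"
  assumes carr: "set A \<subseteq> carrier_vec N" and A: "A \<noteq> []"
    and h: "\<And>i. i < length A \<Longrightarrow> (\<Sum>t<N. h t * rat_of_int (A ! i $ t)) = 1"
    and U: "U \<in> unimodular N" and kN: "length Js \<le> N"
    and Js: "distinct Js" "partition_on {..<length A} (set Js)"
    and UA: "\<And>j i. j < length Js \<Longrightarrow> i < length A \<Longrightarrow> (U *\<^sub>v A ! i) $ j = (if i \<in> Js ! j then 1 else 0)"
begin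

abbreviation "k \<equiv> length Js"
abbreviation "n \<equiv> length A"
abbreviation "e \<equiv> N - length Js"
abbreviation "K \<equiv> relations N A"

text \<open>
  \<open>order\<close> lists the indices block by block; it is the permutation from \<open>A\<close> to the Cayley
  configuration.
\<close>

definition img :: "nat \<Rightarrow> int vec" where "img i = U *\<^sub>v A ! i"
definition tail :: "nat \<Rightarrow> int vec" where "tail i = vec_last (img i) e"
definition enum :: "nat \<Rightarrow> nat list" where "enum j = sorted_list_of_set (Js ! j)"
definition As :: "config list" where "As = map (\<lambda>j. map tail (enum j)) [0..<k]"
definition order :: "nat list" where "order = concat (map enum [0..<k])"

lemma A_carrier: "i < n \<Longrightarrow> A ! i \<in> carrier_vec N"
  using carr by auto

lemma img_carrier: "i < n \<Longrightarrow> img i \<in> carrier_vec N"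
  unfolding img_def by (rule mult_mat_vec_carrier[OF unimodular_carrier[OF U] A_carrier])

lemma tail_carrier: "tail i \<in> carrier_vec e"
  unfolding tail_def by simp

lemma block_in: "j < k \<Longrightarrow> Js ! j \<in> set Js" by simp

lemma block_sub: "j < k \<Longrightarrow> Js ! j \<subseteq> {..<n}"
  using Js(2) block_in unfolding partition_on_def by blast

lemma block_finite: "j < k \<Longrightarrow> finite (Js ! j)"
  using block_sub finite_subset by blast

lemma block_nonempty: "j < k \<Longrightarrow> Js ! j \<noteq> {}"
  using Js(2) block_in unfolding partition_on_def by metis

lemma block_disjoint: "j < k \<Longrightarrow> l < k \<Longrightarrow> j \<noteq> l \<Longrightarrow> Js ! j \<inter> Js ! l = {}"
  using disjointD[OF partition_onD2[OF Js(2)] block_in block_in] nth_eq_iff_index_eq[OF Js(1)] by auto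

lemma block_Union: "(\<Union>j<k. Js ! j) = {..<n}"
  using partition_onD1[OF Js(2)] by (auto simp: set_conv_nth)

lemma in_block_unique: "j < k \<Longrightarrow> l < k \<Longrightarrow> i \<in> Js ! j \<Longrightarrow> i \<in> Js ! l \<longleftrightarrow> l = j"
  using block_disjoint[of j l] by auto

lemma sum_blocks: "(\<Sum>i<n. f i) = (\<Sum>j<k. \<Sum>i\<in>Js ! j. f i)"
  unfolding block_Union[symmetric] using block_finite block_disjoint
  by (intro sum.UNION_disjoint) auto

lemma set_enum: "j < k \<Longrightarrow> set (enum j) = Js ! j" "distinct (enum j)"
  "length (enum j) = card (Js ! j)"
  using block_finite by (simp_all add: enum_def)

lemma enum_bij: "j < k \<Longrightarrow> bij_betw ((!) (enum j)) {..<card (Js ! j)} (Js ! j)"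
  by (rule bij_betw_nth[OF set_enum(2)]) (simp_all add: set_enum)

lemma img_index:
  assumes j: "j < k" and i: "i \<in> Js ! j" and t: "t < N"
  shows "img i $ t = (if t < k then if t = j then 1 else 0 else tail i $ (t - k))"
proof (cases "t < k")
  case True
  then show ?thesis using UA[of t i] block_sub[OF j] i in_block_unique[OF j _ i] by (auto simp: img_def)
next
  case False
  have "dim_vec (img i) = N" using img_carrier block_sub[OF j] i by auto
  then show ?thesis using False t kN by (simp add: tail_def vec_last_def)
qed

lemma img_append: "j < k \<Longrightarrow> i \<in> Js ! j \<Longrightarrow> img i = unit_vec k j @\<^sub>v tail i"
proof (rule eq_vecI)
  assume j: "j < k" and i: "i \<in> Js ! j"
  have d: "dim_vec (img i) = N" using img_carrier block_sub[OF j] i by auto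
  show "dim_vec (img i) = dim_vec (unit_vec k j @\<^sub>v tail i)" using d kN by (simp add: tail_def)
  fix t assume "t < dim_vec (unit_vec k j @\<^sub>v tail i)"
  then have t: "t < N" using kN by (simp add: tail_def)
  show "img i $ t = (unit_vec k j @\<^sub>v tail i) $ t"
    using img_index[OF j i t] t j kN by (simp add: tail_def)
qed

lemma length_As: "length As = k" by (simp add: As_def)

lemma As_nth: "j < k \<Longrightarrow> As ! j = map tail (enum j)" by (simp add: As_def)

lemma As_carrier: "j < k \<Longrightarrow> set (As ! j) \<subseteq> carrier_vec e"
  using tail_carrier by (auto simp: As_nth)

lemma length_As_nth: "j < k \<Longrightarrow> length (As ! j) = card (Js ! j)"
  by (simp add: As_nth set_enum)

lemma As_nonempty: "j < k \<Longrightarrow> As ! j \<noteq> []"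
  using block_nonempty[of j] set_enum(1)[of j] by (auto simp: As_nth)

lemma cayley_As: "cayley As = map img order"
proof -
  have "map (\<lambda>a. unit_vec (length As) j @\<^sub>v a) (As ! j) = map img (enum j)" if "j < k" for j
    using img_append that set_enum(1)[OF that] by (simp add: As_nth length_As)
  then have "cayley As = concat (map (\<lambda>j. map img (enum j)) [0..<k])"
    unfolding cayley_def length_As by (intro arg_cong[of _ _ concat] map_cong) auto
  then show ?thesis by (simp add: order_def map_concat comp_def)
qed

lemma order_set: "set order = {..<n}" "distinct order" "length order = n"
proof -
  show set: "set order = {..<n}"
    unfolding block_Union[symmetric] using set_enum(1) by (auto simp: order_def)
  have "distinct (map enum [0..<k])"
    unfolding distinct_map
  proof (intro conjI inj_onI)
    fix j l assume jl: "j \<in> set [0..<k]" "l \<in> set [0..<k]" "enum j = enum l"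
    then have "Js ! j = Js ! l" using set_enum(1)[of j] set_enum(1)[of l] by simp
    then show "j = l" using jl nth_eq_iff_index_eq[OF Js(1)] by simp
  qed simp
  moreover have "set xs \<inter> set ys = {}"
    if xy: "xs \<in> set (map enum [0..<k])" "ys \<in> set (map enum [0..<k])" "xs \<noteq> ys" for xs ys
  proof -
    obtain j l where jl: "j < k" "l < k" "xs = enum j" "ys = enum l" using xy by auto
    then have "j \<noteq> l" using xy(3) by auto
    then show ?thesis using block_disjoint[OF jl(1,2)] jl by (simp add: set_enum(1))
  qed
  ultimately show d: "distinct order"
    unfolding order_def using set_enum(2) by (intro distinct_concat) auto
  show "length order = n" using distinct_card[OF d] set by simp
qed

lemma order_bij: "bij_betw ((!) order) {..<n} {..<n}"
  by (rule bij_betw_nth[OF order_set(2)]) (simp_all add: order_set)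

lemma cayley_block_enum:
  assumes j: "j < k"
  shows "cayley_block As j \<subseteq> {..<n}" "(!) order ` cayley_block As j = Js ! j"
proof -
  let ?L = "map enum [0..<k]"
  define a where "a = length (concat (take j ?L))"
  have lenA: "map length As = map length ?L" by (auto simp: As_def)
  have len: "length (concat (take i As)) = length (concat (take i ?L))" for i
    unfolding length_concat using lenA by (metis take_map)
  have split: "order = concat (take j ?L) @ enum j @ concat (drop (Suc j) ?L)"
    using j id_take_nth_drop[of j ?L] unfolding order_def
    by (metis concat.simps(2) concat_append length_map length_upt minus_nat.diff_0 nth_map nth_upt plus_nat.add_0)
  have "length (concat (take (Suc j) ?L)) = a + length (enum j)"
    using j by (simp add: a_def take_Suc_conv_app_nth del: take_map)
  then have block: "cayley_block As j = {a..<a + length (enum j)}"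
    unfolding cayley_block_def len a_def by simp
  show "cayley_block As j \<subseteq> {..<n}"
    unfolding block using split order_set(3) by (auto simp: a_def)
  have nth: "order ! (a + q) = enum j ! q" if "q < length (enum j)" for q
    unfolding split a_def using that by (simp add: nth_append)
  have shift: "{a..<a + length (enum j)} = (+) a ` {0..<length (enum j)}" by (simp add: add.commute)
  have "(!) order ` cayley_block As j = (\<lambda>q. order ! (a + q)) ` {0..<length (enum j)}"
    unfolding block shift image_image ..
  also have "\<dots> = (!) (enum j) ` {0..<length (enum j)}" using nth by (intro image_cong) auto
  also have "\<dots> = set (enum j)" by (auto simp: set_conv_nth)
  finally show "(!) order ` cayley_block As j = Js ! j" using set_enum(1)[OF j] by simp
qed

lemma equivalent_to_cayley_As:
  assumes "N = Suc d" "0 < k" shows "equivalent_to_cayley d A As"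
proof -
  have map: "map (\<lambda>a. U *\<^sub>v a) A = map img [0..<n]" by (rule nth_equalityI) (auto simp: img_def)
  have order: "mset order = mset [0..<n]"
    using set_eq_iff_mset_eq_distinct[OF order_set(2) distinct_upt, of 0 n] order_set(1)
    by (simp add: atLeast0LessThan)
  have "mset (map (\<lambda>a. U *\<^sub>v a) A) = mset (cayley As)"
    unfolding cayley_As map unfolding mset_map order ..
  moreover have "invertible_mat U"
  proof -
    note c = unimodular_carrier[OF U]
    obtain Y where "Y \<in> carrier_mat N N" "U * Y = 1\<^sub>m N" "Y * U = 1\<^sub>m N"
      using U unfolding unimodular_def by auto
    then show ?thesis unfolding invertible_mat_def inverts_mat_def using c by auto
  qed
  ultimately have "affinely_equivalent N A (cayley As)"
    unfolding affinely_equivalent_def using unimodular_carrier[OF U] by auto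
  moreover have "C \<noteq> [] \<and> set C \<subseteq> carrier_vec e" if "C \<in> set As" for C
    using that As_nonempty As_carrier by (auto simp: in_set_conv_nth length_As)
  ultimately show ?thesis
    unfolding equivalent_to_cayley_def length_As using assms kN by auto
qed

lemma sum_restrict_block:
  assumes "j < k" shows "(\<Sum>i<n. (if i \<in> Js ! j then x i else 0) * f i) = (\<Sum>i\<in>Js ! j. x i * f i :: rat)"
proof -
  have "(\<Sum>i<n. (if i \<in> Js ! j then x i else 0) * f i) = (\<Sum>i<n. if i \<in> Js ! j then x i * f i else 0)"
    by (rule sum.cong) auto
  also have "\<dots> = (\<Sum>i\<in>{..<n} \<inter> Js ! j. x i * f i)" by (simp add: sum.inter_restrict)
  also have "{..<n} \<inter> Js ! j = Js ! j" using block_sub[OF assms] by auto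
  finally show ?thesis .
qed

lemma img_sum_zero_iff:
  assumes F: "F \<subseteq> {..<n}"
  shows "(\<forall>t<N. (\<Sum>i\<in>F. y i * rat_of_int (img i $ t)) = 0)
    \<longleftrightarrow> (\<forall>t<N. (\<Sum>i\<in>F. y i * rat_of_int (A ! i $ t)) = 0)" (is "?L \<longleftrightarrow> ?R")
proof
  have AF: "A ! i \<in> carrier_vec N" if "i \<in> F" for i using A_carrier F that by auto
  have IF: "img i \<in> carrier_vec N" if "i \<in> F" for i using img_carrier F that by auto
  show ?L if ?R
    unfolding img_def using mat_mult_vec_sum[OF unimodular_carrier[OF U] AF, of F] that by simp
  obtain Y where Y: "Y \<in> carrier_mat N N" "Y * U = 1\<^sub>m N" using U unfolding unimodular_def by auto
  have "A ! i = Y *\<^sub>v img i" if "i \<in> F" for i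
    unfolding img_def
    using assoc_mult_mat_vec[OF Y(1) unimodular_carrier[OF U] AF[OF that]] Y(2) AF[OF that] by simp
  then show ?R if ?L
    using mat_mult_vec_sum[OF Y(1) IF, of F "\<lambda>i. i" _ y] that by simp
qed

lemma in_K_iff: "x \<in> K \<longleftrightarrow> (\<forall>t<N. (\<Sum>i<n. x i * rat_of_int (img i $ t)) = 0)"
  unfolding in_relations_iff[OF carr] using img_sum_zero_iff[of "{..<n}" x] by simp

lemma cayley_carrier: "set (cayley As) \<subseteq> carrier_vec N" "length (cayley As) = n" "cayley As \<noteq> []"
  unfolding cayley_As using order_set img_carrier A by auto

lemma in_cayley_relations_iff:
  assumes "\<forall>p<n. x' p = x (order ! p)"
  shows "x' \<in> relations N (cayley As) \<longleftrightarrow> x \<in> K"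
proof -
  have "(\<Sum>p<n. x' p * rat_of_int (cayley As ! p $ t)) = (\<Sum>i<n. x i * rat_of_int (img i $ t))" for t
  proof -
    have "(\<Sum>p<n. x' p * rat_of_int (cayley As ! p $ t))
        = (\<Sum>p<n. x (order ! p) * rat_of_int (img (order ! p) $ t))"
      using assms order_set(3) by (intro sum.cong) (auto simp: cayley_As)
    also have "\<dots> = (\<Sum>i<n. x i * rat_of_int (img i $ t))"
      by (rule sum.reindex_bij_betw[OF order_bij])
    finally show ?thesis .
  qed
  then show ?thesis unfolding in_relations_iff[OF cayley_carrier(1)] cayley_carrier(2) in_K_iff by simp
qed

text \<open>The sum of the first \<open>k\<close> coordinates is 1 on the Cayley configuration.\<close>

lemma cayley_linear_form:
  assumes p: "p < length (cayley As)"
  shows "(\<Sum>t<N. (if t < k then 1 else 0) * rat_of_int (cayley As ! p $ t)) = 1"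
proof -
  have "order ! p \<in> {..<n}" using p order_set cayley_carrier(2) nth_mem by metis
  then obtain j where j: "j < k" "order ! p \<in> Js ! j" using block_Union by blast
  have "(\<Sum>t<N. (if t < k then 1 else 0) * rat_of_int (cayley As ! p $ t)) = (\<Sum>t<N. if t = j then 1 else 0)"
    using img_index[OF j] p j(1) cayley_carrier(2) order_set(3) by (intro sum.cong) (auto simp: cayley_As)
  then show ?thesis using j(1) kN by simp
qed

lemma gale_A: "dim_row (gale N A) = n" "presents (gale N A) K"
  using gale_presents[OF carr A h] by simp_all

lemma gale_cayley:
  "dim_row (gale N (cayley As)) = length (cayley As)"
  "presents (gale N (cayley As)) (relations N (cayley As))"
  using gale_presents[OF cayley_carrier(1,3) cayley_linear_form] by simp_all

lemma cayley_sub_dim: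
  assumes J': "J' \<subseteq> {..<n}"
  shows "sub_dim (gale N (cayley As)) J' = sub_dim (gale N A) ((!) order ` J')"
proof (rule sub_dim_reindex)
  have inj: "inj_on ((!) order) {..<n}" using order_bij unfolding bij_betw_def by simp
  show "inj_on ((!) order) J'" using inj J' by (rule inj_on_subset)
  show "\<exists>x\<in>K. \<forall>p\<in>J'. x' p = x (order ! p)" if x': "x' \<in> relations N (cayley As)" for x'
  proof -
    define x where "x = x' \<circ> inv_into {..<n} ((!) order)"
    have eq: "\<forall>p<n. x' p = x (order ! p)" using inj by (simp add: x_def)
    have "x \<in> K" using in_cayley_relations_iff[OF eq] x' by simp
    then show ?thesis using eq J' by (intro bexI[of _ x]) auto
  qed
  show "\<exists>x'\<in>relations N (cayley As). \<forall>p\<in>J'. x' p = x (order ! p)" if "x \<in> K" for x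
    using in_cayley_relations_iff[of "\<lambda>p. x (order ! p)" x] that
    by (intro bexI[of _ "\<lambda>p. x (order ! p)"]) auto
  show "presents (gale N A) K" by (rule gale_A(2))
  show "(!) order ` J' \<subseteq> {..<dim_row (gale N A)}"
    using J' order_bij gale_A(1) unfolding bij_betw_def by auto
  show "presents (gale N (cayley As)) (relations N (cayley As))" by (rule gale_cayley(2))
  show "J' \<subseteq> {..<dim_row (gale N (cayley As))}" using J' gale_cayley(1) cayley_carrier(2) by simp
qed

lemma constituent_codim_As:
  assumes j: "j < k" shows "constituent_codim e As j = sub_dim (gale N A) (Js ! j)"
  using cayley_sub_dim[OF cayley_block_enum(1)[OF j]] cayley_block_enum(2)[OF j] kN
  unfolding constituent_codim_def cayley_gale_def length_As by simp

lemma cayley_excess_As: "cayley_excess e As = decomposition_excess (gale N A) (set Js)"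
proof -
  let ?B = "gale N (cayley As)"
  have inj: "inj_on (cayley_block As) {..<k}"
  proof (rule inj_onI)
    fix j l assume jl: "j \<in> {..<k}" "l \<in> {..<k}" "cayley_block As j = cayley_block As l"
    then have "Js ! j = Js ! l" using cayley_block_enum(2)[of j] cayley_block_enum(2)[of l] by simp
    then show "j = l" using jl nth_eq_iff_index_eq[OF Js(1)] by simp
  qed
  have "(\<Sum>J\<in>cayley_block As ` {..<k}. int (sub_dim ?B J)) = (\<Sum>j<k. int (sub_dim (gale N A) (Js ! j)))"
    using cayley_sub_dim cayley_block_enum by (simp add: sum.reindex[OF inj])
  also have "\<dots> = (\<Sum>J\<in>set Js. int (sub_dim (gale N A) J))"
    using sum.reindex_bij_betw[OF bij_betw_nth[OF Js(1) refl refl], of "\<lambda>J. int (sub_dim (gale N A) J)"]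
    by simp
  finally have "(\<Sum>J\<in>cayley_block As ` {..<k}. int (sub_dim ?B J)) = (\<Sum>J\<in>set Js. int (sub_dim (gale N A) J))" .
  moreover have "sub_dim ?B {..<dim_row ?B} = sub_dim (gale N A) {..<dim_row (gale N A)}"
    using cayley_sub_dim[of "{..<n}"] order_bij gale_A(1) gale_cayley(1) cayley_carrier(2)
    unfolding bij_betw_def by simp
  ultimately show ?thesis
    unfolding cayley_excess_def cayley_gale_def decomposition_excess_def length_As using kN by simp
qed

end

section \<open>Joins\<close>

text \<open>Excess 0 means that relations restrict to blocks; this is the condition \<open>splits\<close>.\<close>

locale split_cayley_form = cayley_form +
  assumes splits: "\<And>j x. j < length Js \<Longrightarrow> x \<in> relations N A \<Longrightarrow> (\<lambda>i. if i \<in> Js ! j then x i else 0) \<in> relations N A"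
begin

lemma block_relation_iff:
  assumes j: "j < k"
  shows "(\<lambda>i. if i \<in> Js ! j then x i else 0) \<in> K \<longleftrightarrow>
    (\<Sum>i\<in>Js ! j. x i) = 0 \<and> (\<forall>s<e. (\<Sum>i\<in>Js ! j. x i * rat_of_int (tail i $ s)) = 0)"
proof -
  have "(\<lambda>i. if i \<in> Js ! j then x i else 0) \<in> K \<longleftrightarrow>
      (\<forall>t<N. (\<Sum>i\<in>Js ! j. x i * rat_of_int (img i $ t)) = 0)"
    unfolding in_K_iff sum_restrict_block[OF j] ..
  moreover have "(\<Sum>i\<in>Js ! j. x i * rat_of_int (img i $ t)) =
      (if t < k then if t = j then (\<Sum>i\<in>Js ! j. x i) else 0
       else (\<Sum>i\<in>Js ! j. x i * rat_of_int (tail i $ (t - k))))" if "t < N" for t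
    using img_index[OF j _ that] by simp
  ultimately have "(\<lambda>i. if i \<in> Js ! j then x i else 0) \<in> K \<longleftrightarrow>
      (\<forall>t<N. (if t < k then if t = j then (\<Sum>i\<in>Js ! j. x i) else 0
       else (\<Sum>i\<in>Js ! j. x i * rat_of_int (tail i $ (t - k)))) = 0)" (is "_ \<longleftrightarrow> (\<forall>t<N. ?f t = 0)")
    by simp
  also have "\<dots> \<longleftrightarrow> (\<Sum>i\<in>Js ! j. x i) = 0 \<and> (\<forall>s<e. (\<Sum>i\<in>Js ! j. x i * rat_of_int (tail i $ s)) = 0)"
  proof (intro iffI conjI allI impI)
    assume f: "\<forall>t<N. ?f t = 0"
    show "(\<Sum>i\<in>Js ! j. x i) = 0" using spec[OF f, of j] j kN by simp
    fix s assume "s < e"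
    then show "(\<Sum>i\<in>Js ! j. x i * rat_of_int (tail i $ s)) = 0" using spec[OF f, of "k + s"] by simp
  next
    fix t assume f: "(\<Sum>i\<in>Js ! j. x i) = 0 \<and> (\<forall>s<e. (\<Sum>i\<in>Js ! j. x i * rat_of_int (tail i $ s)) = 0)" and t: "t < N"
    then have "t - k < e" if "\<not> t < k" using that by simp
    then show "?f t = 0" using f by simp
  qed
  finally show ?thesis .
qed

text \<open>
  A homogeneous configuration with the affine relations of \<open>A\<^sub>j\<close>, which may be \<open>A\<^sub>j\<close> itself or its
  homogenization, has a Gale dual equivalent to \<open>B\<^sub>j\<close>.
\<close>

lemma block_gale:
  assumes j: "j < k"
    and D: "set D \<subseteq> carrier_vec p" "length D = card (Js ! j)"
    and g: "\<And>q. q < length D \<Longrightarrow> (\<Sum>t<p. g t * rat_of_int (D ! q $ t)) = 1"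
    and rel: "\<And>x. x \<in> relations p D \<longleftrightarrow> (\<Sum>q<length D. x q) = 0 \<and> x \<in> relations e (As ! j)"
  shows "codim p D = int (sub_dim (gale N A) (Js ! j))"
    and "\<lbrakk>\<And>i l. i < n \<Longrightarrow> l < n \<Longrightarrow> i \<noteq> l \<Longrightarrow> indep_on K {i, l}; 2 \<le> card (Js ! j);
      sub_dim (gale N A) (Js ! j) \<le> 3\<rbrakk> \<Longrightarrow> defect p D = 0"
proof -
  let ?m = "card (Js ! j)" and ?\<sigma> = "(!) (enum j)"
  have ne: "D \<noteq> []" using D(2) block_nonempty[OF j] block_finite[OF j] by auto
  note bij = enum_bij[OF j]
  have inj: "inj_on ?\<sigma> {..<?m}" and im: "?\<sigma> ` {..<?m} = Js ! j" using bij unfolding bij_betw_def by auto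
  have iff: "x' \<in> relations p D \<longleftrightarrow> (\<lambda>i. if i \<in> Js ! j then x i else 0) \<in> K"
    if x: "\<And>q. q < ?m \<Longrightarrow> x' q = x (enum j ! q)" for x x'
  proof -
    have tr: "(\<Sum>q<?m. x' q * f q) = (\<Sum>i\<in>Js ! j. x i * f' i)"
      if "\<And>q. q < ?m \<Longrightarrow> f q = f' (enum j ! q)" for f f'
    proof -
      have "(\<Sum>q<?m. x' q * f q) = (\<Sum>q<?m. x (enum j ! q) * f' (enum j ! q))"
        using x that by (intro sum.cong) auto
      also have "\<dots> = (\<Sum>i\<in>Js ! j. x i * f' i)" by (rule sum.reindex_bij_betw[OF bij])
      finally show ?thesis .
    qed
    have one: "(\<Sum>q<?m. x' q) = (\<Sum>i\<in>Js ! j. x i)" using tr[of "\<lambda>_. 1" "\<lambda>_. 1"] by simp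
    have coord: "(\<Sum>q<?m. x' q * rat_of_int (As ! j ! q $ s)) = (\<Sum>i\<in>Js ! j. x i * rat_of_int (tail i $ s))" for s
      by (rule tr) (use set_enum(3)[of j] in \<open>simp add: As_nth[OF j]\<close>)
    show ?thesis
      unfolding rel D(2) block_relation_iff[OF j] in_relations_iff[OF As_carrier[OF j]]
        length_As_nth[OF j] one coord ..
  qed
  have KK': "\<exists>x\<in>K. \<forall>q\<in>{..<?m}. x' q = x (enum j ! q)" if x': "x' \<in> relations p D" for x'
  proof -
    define x where "x i = (if i \<in> Js ! j then x' (inv_into {..<?m} ?\<sigma> i) else 0)" for i
    have eq: "x' q = x (enum j ! q)" if "q < ?m" for q
      using that inj im by (auto simp: x_def)
    have "(\<lambda>i. if i \<in> Js ! j then x i else 0) \<in> K" using iff[of x' x] eq x' by simp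
    then show ?thesis using eq im by (intro bexI[of _ "\<lambda>i. if i \<in> Js ! j then x i else 0"]) auto
  qed
  have K'K: "\<exists>x'\<in>relations p D. \<forall>q\<in>{..<?m}. x' q = x (enum j ! q)" if x: "x \<in> K" for x
    using iff[of "\<lambda>q. x (enum j ! q)" x] splits[OF j x] by (intro bexI[of _ "\<lambda>q. x (enum j ! q)"]) auto
  note gD = gale_presents[OF D(1) ne g]
  have "sub_dim (gale p D) {..<?m} = sub_dim (gale N A) (?\<sigma> ` {..<?m})"
  proof (rule sub_dim_reindex[OF inj KK' K'K])
    show "presents (gale N A) K" by (rule gale_A(2))
    show "?\<sigma> ` {..<?m} \<subseteq> {..<dim_row (gale N A)}" using im block_sub[OF j] gale_A(1) by simp
    show "presents (gale p D) (relations p D)" by (rule gD(2))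
    show "{..<?m} \<subseteq> {..<dim_row (gale p D)}" using gD(1) D(2) by simp
  qed
  then have sd: "sub_dim (gale p D) {..<length D} = sub_dim (gale N A) (Js ! j)" using im D(2) by simp
  show "codim p D = int (sub_dim (gale N A) (Js ! j))" using sub_dim_gale_all[OF D(1) ne g] sd by simp
  assume pairs: "\<And>i l. i < n \<Longrightarrow> l < n \<Longrightarrow> i \<noteq> l \<Longrightarrow> indep_on K {i, l}"
    and card: "2 \<le> card (Js ! j)" and rank: "sub_dim (gale N A) (Js ! j) \<le> 3"
  have pairsD: "indep_on (relations p D) {q, r}"
    if "q < dim_row (gale p D)" "r < dim_row (gale p D)" "q \<noteq> r" for q r
  proof -
    have qr: "q < ?m" "r < ?m" using that gD(1) D(2) by auto
    have "?\<sigma> ` {q, r} \<subseteq> {..<n}" using qr im block_sub[OF j] by blast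
    moreover have "enum j ! q \<noteq> enum j ! r" using inj_onD[OF inj, of q r] qr that(3) by auto
    ultimately have "indep_on K (?\<sigma> ` {q, r})" using pairs by simp
    then show ?thesis using qr by (intro basis_on_reindex(1)[OF inj KK' K'K]) auto
  qed
  have hom: "relation_on (relations p D) {..<dim_row (gale p D)} (\<lambda>i. 1)"
    using relations_sum_zero[OF D(1) ne g] gD(1) unfolding relation_on_def by simp
  have dim2: "2 \<le> dim_row (gale p D)" using card gD(1) D(2) by simp
  show "defect p D = 0"
    unfolding defect_def
    by (rule gale_defect_eq_0[OF gD(2) dim2 pairsD hom]) (use sd rank gD(1) in auto)
qed

lemma codim_As:
  assumes j: "j < k" shows "codim e (As ! j) = int (sub_dim (gale N A) (Js ! j))"
proof -
  have "codim (Suc e) (homogenization (As ! j)) = int (sub_dim (gale N A) (Js ! j))"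
    using homogenization_relations_iff[OF As_carrier[OF j]] length_As_nth[OF j]
    by (intro block_gale(1)[OF j homogenization_carrier[OF As_carrier[OF j]] _ homogenization_linear_form])
      (simp_all add: homogenization_nth(2))
  then show ?thesis using codim_homogenization[OF As_carrier[OF j] As_nonempty[OF j]] by simp
qed

text \<open>The bound \<open>2\<theta> \<le> m - 2\<close> leaves no room for a positive defect when \<open>m \<le> 3\<close>.\<close>

lemma non_defective_As:
  assumes j: "j < k" and pairs: "\<And>i l. i < n \<Longrightarrow> l < n \<Longrightarrow> i \<noteq> l \<Longrightarrow> indep_on K {i, l}"
    and card: "2 \<le> card (Js ! j)" and rank: "sub_dim (gale N A) (Js ! j) \<le> 3"
  shows "non_defective e (As ! j)"
proof (cases "homogeneous e (As ! j)")
  case True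
  obtain g where g: "\<And>q. q < length (As ! j) \<Longrightarrow> (\<Sum>t<e. g t * rat_of_int (As ! j ! q $ t)) = 1"
    by (rule homogeneous_imp_linear_form[OF As_carrier[OF j] True], rule that)
  have rel: "x \<in> relations e (As ! j) \<longleftrightarrow> (\<Sum>q<length (As ! j). x q) = 0 \<and> x \<in> relations e (As ! j)" for x
    using relations_sum_zero[OF As_carrier[OF j] As_nonempty[OF j] g] by blast
  have "defect e (As ! j) = 0"
    by (rule block_gale(2)[OF j As_carrier[OF j] length_As_nth[OF j] _ _ _ card rank],
        rule g, assumption, rule rel, rule pairs)
  then show ?thesis unfolding non_defective_def using True by simp
next
  case False
  have len: "length (homogenization (As ! j)) = card (Js ! j)"
    using length_As_nth[OF j] by (simp add: homogenization_nth(2))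
  have rel: "x \<in> relations (Suc e) (homogenization (As ! j)) \<longleftrightarrow>
      (\<Sum>q<length (homogenization (As ! j)). x q) = 0 \<and> x \<in> relations e (As ! j)" for x
    using homogenization_relations_iff[OF As_carrier[OF j]] by (simp add: homogenization_nth(2))
  have "defect (Suc e) (homogenization (As ! j)) = 0"
    by (rule block_gale(2)[OF j homogenization_carrier[OF As_carrier[OF j]] len _ _ _ card rank],
        rule homogenization_linear_form, assumption, rule rel, rule pairs)
  then show ?thesis unfolding non_defective_def using False by simp
qed

lemma difference_group_As:
  assumes j: "j < k"
  shows "x \<in> carrier (difference_group e (As ! j)) \<longleftrightarrow>
    x \<in> carrier_vec e \<and>
    (\<exists>c. (\<Sum>i\<in>Js ! j. c i) = 0 \<and> (\<forall>s<e. x $ s = (\<Sum>i\<in>Js ! j. c i * tail i $ s)))"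
proof -
  let ?m = "card (Js ! j)" and ?\<sigma> = "(!) (enum j)"
  note bij = enum_bij[OF j]
  have inj: "inj_on ?\<sigma> {..<?m}" using bij unfolding bij_betw_def by auto
  have len: "length (As ! j) = ?m" by (rule length_As_nth[OF j])
  have nth: "As ! j ! q = tail (enum j ! q)" if "q < ?m" for q
    using that set_enum(3)[of j] by (simp add: As_nth[OF j])
  have tr: "(\<Sum>q<?m. c (enum j ! q) * f (enum j ! q)) = (\<Sum>i\<in>Js ! j. c i * f i)" for c f :: "nat \<Rightarrow> int"
    by (rule sum.reindex_bij_betw[OF bij, of "\<lambda>i. c i * f i"])
  have sums: "(\<Sum>q<?m. b q) = (\<Sum>i\<in>Js ! j. c i)"
    "(\<Sum>q<?m. b q * As ! j ! q $ s) = (\<Sum>i\<in>Js ! j. c i * tail i $ s)"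
    if b: "\<And>q. q < ?m \<Longrightarrow> b q = c (enum j ! q)" for b c :: "nat \<Rightarrow> int" and s
    using tr[of c "\<lambda>_. 1"] tr[of c "\<lambda>i. tail i $ s"] b nth by simp_all
  show ?thesis
    unfolding difference_group_iff[OF As_carrier[OF j]] len
  proof (intro conj_cong refl iffI)
    assume "\<exists>c. (\<Sum>i<?m. c i) = 0 \<and> (\<forall>t<e. x $ t = (\<Sum>i<?m. c i * As ! j ! i $ t))"
    then obtain b where b: "(\<Sum>q<?m. b q) = 0" "\<forall>t<e. x $ t = (\<Sum>q<?m. b q * As ! j ! q $ t)" by auto
    define c where "c = b \<circ> inv_into {..<?m} ?\<sigma>"
    have "b q = c (enum j ! q)" if "q < ?m" for q using inj that by (simp add: c_def)
    from sums[of b c, OF this] b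
    show "\<exists>c. (\<Sum>i\<in>Js ! j. c i) = 0 \<and> (\<forall>s<e. x $ s = (\<Sum>i\<in>Js ! j. c i * tail i $ s))"
      by (intro exI[of _ c]) simp
  next
    assume "\<exists>c. (\<Sum>i\<in>Js ! j. c i) = 0 \<and> (\<forall>s<e. x $ s = (\<Sum>i\<in>Js ! j. c i * tail i $ s))"
    then obtain c where c: "(\<Sum>i\<in>Js ! j. c i) = 0" "\<forall>s<e. x $ s = (\<Sum>i\<in>Js ! j. c i * tail i $ s)" by auto
    then show "\<exists>c. (\<Sum>i<?m. c i) = 0 \<and> (\<forall>t<e. x $ t = (\<Sum>i<?m. c i * As ! j ! i $ t))"
      using sums[of "\<lambda>q. c (enum j ! q)" c] by (intro exI[of _ "\<lambda>q. c (enum j ! q)"]) simp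
  qed
qed

text \<open>
  If \<open>\<Sum>\<^sub>j g\<^sub>j = \<Sum>\<^sub>j g'\<^sub>j\<close>, the difference of the coefficients is a relation of \<open>A\<close>; its restrictions
  to the blocks are relations, too, and give \<open>g\<^sub>j = g'\<^sub>j\<close>. Surjectivity
  comes from \<open>A\<close> generating the lattice: if \<open>(0, x)\<close> is a combination of the \<open>(e\<^sub>j, a)\<close>, the
  coefficients add up to 0 on every block.
\<close>

lemma is_join_As:
  assumes gen: "\<And>z. z \<in> carrier_vec N \<Longrightarrow> \<exists>c. \<forall>t<N. z $ t = (\<Sum>i<n. c i * A ! i $ t)"
  shows "is_join e As"
proof -
  let ?M = "monoid_vec TYPE(int) e"
  let ?D = "\<lambda>j. difference_group e (As ! j)"
  let ?S = "sum_group {..<k} ?D"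
  let ?\<Phi> = "\<lambda>g. finsum_vec TYPE(int) e g {..<k}"
  interpret G: comm_group ?M by (rule comm_group_vec)
  have grp: "group (?D j)" for j unfolding difference_group_def by simp
  have Dc: "x \<in> carrier_vec e" if "x \<in> carrier (?D j)" "j < k" for x j
    using that difference_group_As by blast
  have S: "g \<in> carrier ?S \<longleftrightarrow> g \<in> (\<Pi>\<^sub>E j\<in>{..<k}. carrier (?D j))" for g
    using carrier_sum_group[of "{..<k}" ?D] grp by auto
  have gc: "g \<in> {..<k} \<rightarrow> carrier_vec e" if "g \<in> carrier ?S" for g
    using that Dc unfolding S by (auto simp: PiE_iff)
  have idx: "?\<Phi> g $ s = (\<Sum>j<k. g j $ s)" if "g \<in> {..<k} \<rightarrow> carrier_vec e" "s < e" for g s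
    by (rule index_finsum_vec[OF _ that(2,1)]) simp
  have \<Phi>c: "?\<Phi> g \<in> carrier_vec e" if "g \<in> {..<k} \<rightarrow> carrier_vec e" for g
    using finsum_vec_closed[OF that] .
  have hom: "?\<Phi> \<in> hom ?S ?M"
  proof (rule homI)
    fix g assume "g \<in> carrier ?S"
    then show "?\<Phi> g \<in> carrier ?M" using \<Phi>c gc by (simp add: monoid_vec_simps)
    fix g' assume "g' \<in> carrier ?S"
    note g = gc[OF \<open>g \<in> carrier ?S\<close>] gc[OF this]
    have mult: "(g \<otimes>\<^bsub>?S\<^esub> g') j = g j + g' j" if "j < k" for j
      using that by (simp add: difference_group_def subgroup_generated_def monoid_vec_simps)
    have gg: "g \<otimes>\<^bsub>?S\<^esub> g' \<in> {..<k} \<rightarrow> carrier_vec e"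
    proof
      fix j assume "j \<in> {..<k}"
      then show "(g \<otimes>\<^bsub>?S\<^esub> g') j \<in> carrier_vec e"
        using mult[of j] add_carrier_vec[OF funcset_mem[OF g(1)] funcset_mem[OF g(2)], of j j] by simp
    qed
    have "?\<Phi> (g \<otimes>\<^bsub>?S\<^esub> g') = ?\<Phi> g + ?\<Phi> g'"
    proof (rule eq_vecI)
      fix s assume "s < dim_vec (?\<Phi> g + ?\<Phi> g')"
      then have s: "s < e" using \<Phi>c[OF g(2)] by simp
      have "?\<Phi> (g \<otimes>\<^bsub>?S\<^esub> g') $ s = (\<Sum>j<k. (g j + g' j) $ s)"
        unfolding idx[OF gg s] using mult by (intro sum.cong) auto
      also have "\<dots> = (\<Sum>j<k. g j $ s + g' j $ s)"
      proof (rule sum.cong[OF refl])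
        fix j assume "j \<in> {..<k}"
        then have "s < dim_vec (g' j)" using funcset_mem[OF g(2)] s by fastforce
        then show "(g j + g' j) $ s = g j $ s + g' j $ s" by simp
      qed
      also have "\<dots> = (?\<Phi> g + ?\<Phi> g') $ s"
        using idx[OF g(1) s] idx[OF g(2) s] s \<Phi>c[OF g(2)] by (simp add: sum.distrib)
      finally show "?\<Phi> (g \<otimes>\<^bsub>?S\<^esub> g') $ s = (?\<Phi> g + ?\<Phi> g') $ s" .
    qed (use \<Phi>c[OF gg] \<Phi>c[OF g(2)] in simp)
    then show "?\<Phi> (g \<otimes>\<^bsub>?S\<^esub> g') = ?\<Phi> g \<otimes>\<^bsub>?M\<^esub> ?\<Phi> g'" by (simp add: monoid_vec_simps)
  qed
  define b where "b i = (THE j. j < k \<and> i \<in> Js ! j)" for i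
  have b: "b i = j" if "j < k" "i \<in> Js ! j" for i j
    unfolding b_def using that in_block_unique[OF that(1) _ that(2)] by (intro the_equality) auto
  have inj: "inj_on ?\<Phi> (carrier ?S)"
  proof (rule inj_onI)
    fix g g' assume g: "g \<in> carrier ?S" and g': "g' \<in> carrier ?S" and eq: "?\<Phi> g = ?\<Phi> g'"
    have coeffs: "\<exists>c. \<forall>j<k. (\<Sum>i\<in>Js ! j. c j i) = 0 \<and> (\<forall>s<e. f j $ s = (\<Sum>i\<in>Js ! j. c j i * tail i $ s))"
      if f: "f \<in> carrier ?S" for f
    proof -
      have "\<forall>j\<in>{..<k}. \<exists>c. (\<Sum>i\<in>Js ! j. c i) = 0 \<and> (\<forall>s<e. f j $ s = (\<Sum>i\<in>Js ! j. c i * tail i $ s))"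
        using f difference_group_As unfolding S by (auto simp: PiE_iff)
      from bchoice[OF this] show ?thesis by auto
    qed
    obtain c where c: "\<And>j. j < k \<Longrightarrow> (\<Sum>i\<in>Js ! j. c j i) = 0"
      "\<And>j s. j < k \<Longrightarrow> s < e \<Longrightarrow> g j $ s = (\<Sum>i\<in>Js ! j. c j i * tail i $ s)"
      using coeffs[OF g] by auto
    obtain c' where c': "\<And>j. j < k \<Longrightarrow> (\<Sum>i\<in>Js ! j. c' j i) = 0"
      "\<And>j s. j < k \<Longrightarrow> s < e \<Longrightarrow> g' j $ s = (\<Sum>i\<in>Js ! j. c' j i * tail i $ s)"
      using coeffs[OF g'] by auto
    define a where "a i = c (b i) i - c' (b i) i" for i
    have a: "a i = c j i - c' j i" if "j < k" "i \<in> Js ! j" for i j using b[OF that] by (simp add: a_def)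
    have a0: "(\<Sum>i\<in>Js ! j. a i) = 0" if "j < k" for j
      using a[OF that] c(1)[OF that] c'(1)[OF that] by (simp add: sum_subtractf)
    have as: "(\<Sum>i\<in>Js ! j. a i * tail i $ s) = g j $ s - g' j $ s" if "j < k" "s < e" for j s
      using a[OF that(1)] c(2)[OF that] c'(2)[OF that] by (simp add: left_diff_distrib sum_subtractf)
    have "(\<Sum>i<n. a i * img i $ t) = 0" if t: "t < N" for t
    proof (cases "t < k")
      case True
      have "(\<Sum>i\<in>Js ! j. a i * img i $ t) = 0" if j: "j < k" for j
        using img_index[OF j _ t] True a0[OF j] by simp
      then show ?thesis unfolding sum_blocks by simp
    next
      case False
      then have s: "t - k < e" using t by simp
      have "(\<Sum>i<n. a i * img i $ t) = (\<Sum>j<k. g j $ (t - k) - g' j $ (t - k))"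
        unfolding sum_blocks using img_index[OF _ _ t] False as[OF _ s] by simp
      also have "\<dots> = ?\<Phi> g $ (t - k) - ?\<Phi> g' $ (t - k)"
        using idx[OF gc[OF g] s] idx[OF gc[OF g'] s] by (simp add: sum_subtractf)
      finally show ?thesis using eq by simp
    qed
    then have "(\<lambda>i. rat_of_int (a i)) \<in> K"
      unfolding in_K_iff by (simp flip: of_int_mult of_int_sum)
    then have "(\<Sum>i\<in>Js ! j. rat_of_int (a i) * rat_of_int (tail i $ s)) = 0" if "j < k" "s < e" for j s
      using splits[OF that(1)] block_relation_iff[OF that(1), THEN iffD1] that(2) by simp
    then have zero: "(\<Sum>i\<in>Js ! j. a i * tail i $ s) = 0" if "j < k" "s < e" for j s
      using that by (simp flip: of_int_mult of_int_sum)
    show "g = g'"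
    proof (rule PiE_ext)
      show "g \<in> (\<Pi>\<^sub>E j\<in>{..<k}. carrier (?D j))" "g' \<in> (\<Pi>\<^sub>E j\<in>{..<k}. carrier (?D j))"
        using g g' unfolding S by simp_all
      fix j assume "j \<in> {..<k}"
      then have j: "j < k" by simp
      have "g j \<in> carrier_vec e" "g' j \<in> carrier_vec e" using gc[OF g] gc[OF g'] j by auto
      then show "g j = g' j" using zero[OF j] as[OF j] by (intro eq_vecI) auto
    qed
  qed
  have surj: "carrier ?M \<subseteq> ?\<Phi> ` carrier ?S"
  proof
    fix x assume "x \<in> carrier ?M"
    then have x: "x \<in> carrier_vec e" by (simp add: monoid_vec_simps)
    obtain Y where Y: "Y \<in> carrier_mat N N" "U * Y = 1\<^sub>m N" using U unfolding unimodular_def by auto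
    define y where "y = 0\<^sub>v k @\<^sub>v x"
    define z where "z = Y *\<^sub>v y"
    have "y \<in> carrier_vec (k + e)" unfolding y_def by (rule append_carrier_vec[OF zero_carrier_vec x])
    then have y: "y \<in> carrier_vec N" using kN by simp
    then have z: "z \<in> carrier_vec N" using Y(1) by (simp add: z_def)
    have Uz: "U *\<^sub>v z = y"
      using assoc_mult_mat_vec[OF unimodular_carrier[OF U] Y(1) y] Y(2) y by (simp add: z_def)
    obtain c where c: "\<And>t. t < N \<Longrightarrow> z $ t = (\<Sum>i<n. c i * A ! i $ t)" using gen[OF z] by auto
    have yc: "y $ t = (\<Sum>i<n. c i * img i $ t)" if t: "t < N" for t
    proof -
      have "rat_of_int (y $ t) = (\<Sum>s<N. rat_of_int (U $$ (t, s)) * rat_of_int (z $ s))"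
        using mat_mult_vec_sum[OF unimodular_carrier[OF U], of "{()}" "\<lambda>_. z" t "\<lambda>_. 1"] z t Uz by simp
      also have "\<dots> = (\<Sum>s<N. rat_of_int (U $$ (t, s)) * (\<Sum>i<n. rat_of_int (c i) * rat_of_int (A ! i $ s)))"
        using c by simp
      also have "\<dots> = (\<Sum>i<n. rat_of_int (c i) * rat_of_int (img i $ t))"
        unfolding img_def
        using mat_mult_vec_sum[OF unimodular_carrier[OF U], of "{..<n}" "\<lambda>i. A ! i" t "\<lambda>i. rat_of_int (c i)"]
          A_carrier t by simp
      finally show ?thesis by (simp flip: of_int_mult of_int_sum)
    qed
    have block0: "(\<Sum>i\<in>Js ! j. c i) = 0" if j: "j < k" for j
    proof -
      have jN: "j < N" using j kN by simp
      have inner: "(\<Sum>i\<in>Js ! l. c i * img i $ j) = (if l = j then \<Sum>i\<in>Js ! l. c i else 0)" if "l < k" for l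
        using img_index[OF that _ jN] j by simp
      have "0 = y $ j" using j by (simp add: y_def)
      also have "\<dots> = (\<Sum>l<k. if l = j then \<Sum>i\<in>Js ! l. c i else 0)"
        unfolding yc[OF jN] sum_blocks using inner by (intro sum.cong) auto
      also have "\<dots> = (\<Sum>i\<in>Js ! j. c i)" using j by simp
      finally show ?thesis by simp
    qed
    define g where "g = restrict (\<lambda>j. vec e (\<lambda>s. \<Sum>i\<in>Js ! j. c i * tail i $ s)) {..<k}"
    have gS: "g \<in> carrier ?S"
    proof -
      have "vec e (\<lambda>s. \<Sum>i\<in>Js ! j. c i * tail i $ s) \<in> carrier (?D j)" if j: "j < k" for j
        unfolding difference_group_As[OF j] using block0[OF j] by (intro conjI exI[of _ c]) auto
      then show ?thesis unfolding S by (auto simp: g_def)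
    qed
    have "?\<Phi> g = x"
    proof (rule eq_vecI)
      fix s assume "s < dim_vec x"
      then have s: "s < e" using x by simp
      then have sN: "k + s < N" by simp
      have "?\<Phi> g $ s = (\<Sum>j<k. \<Sum>i\<in>Js ! j. c i * tail i $ s)"
        unfolding idx[OF gc[OF gS] s] using s by (intro sum.cong) (auto simp: g_def)
      also have "\<dots> = (\<Sum>j<k. \<Sum>i\<in>Js ! j. c i * img i $ (k + s))"
        using img_index[OF _ _ sN] by simp
      also have "\<dots> = y $ (k + s)" unfolding yc[OF sN] sum_blocks ..
      also have "\<dots> = x $ s" using s x by (simp add: y_def)
      finally show "?\<Phi> g $ s = x $ s" .
    qed (use x \<Phi>c[OF gc[OF gS]] in simp)
    then show "x \<in> ?\<Phi> ` carrier ?S" using gS by blast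
  qed
  have "?\<Phi> ` carrier ?S \<subseteq> carrier ?M" using hom unfolding hom_def by auto
  then have "bij_betw ?\<Phi> (carrier ?S) (carrier ?M)" using inj surj unfolding bij_betw_def by auto
  then show ?thesis using hom unfolding is_join_def iso_def length_As by simp
qed

end

section \<open>Configurations generating the lattice\<close>

locale lattice_configuration =
  fixes d :: nat and A' :: config
  assumes carr': "set A' \<subseteq> carrier_vec d" and n: "2 \<le> length A'"
    and gen: "carrier (difference_group d A') = carrier_vec d"
    and pairs: "\<And>i j. i < length A' \<Longrightarrow> j < length A' \<Longrightarrow> i \<noteq> j
      \<Longrightarrow> indep_on (relations (Suc d) (homogenization A')) {i, j}"
begin

abbreviation "A \<equiv> homogenization A'"
abbreviation "B \<equiv> gale (Suc d) (homogenization A')"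
abbreviation "K \<equiv> relations (Suc d) (homogenization A')"
abbreviation "h \<equiv> \<lambda>t. if t = 0 then 1 else 0 :: rat"

lemmas carr = homogenization_carrier[OF carr']

lemma nonempty: "A' \<noteq> []" "A \<noteq> []"
  using n by (auto simp: homogenization_def)

lemmas length_A = homogenization_nth(2)[of A']

lemma form: "i < length A \<Longrightarrow> (\<Sum>t<Suc d. h t * rat_of_int (A ! i $ t)) = 1"
  by (rule homogenization_linear_form)

lemma gale_B: "dim_row B = length A" "presents B K"
  using gale_presents[OF carr nonempty(2) form] by simp_all

lemma dim_B: "dim_row B = length A'"
  using gale_B(1) by (simp add: length_A)

lemma pairs_B: "i < dim_row B \<Longrightarrow> j < dim_row B \<Longrightarrow> i \<noteq> j \<Longrightarrow> indep_on K {i, j}"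
  using pairs dim_B by simp

lemma two_le_dim_B: "2 \<le> dim_row B"
  using n dim_B by simp

lemma hom_B: "relation_on K {..<dim_row B} (\<lambda>i. 1)"
  using relations_sum_zero[OF carr nonempty(2) form] unfolding relation_on_def dim_B by (simp add: length_A)

lemma rank_B: "int (sub_dim B {..<dim_row B}) = codim (Suc d) A"
  using sub_dim_gale_all[OF carr nonempty(2) form] dim_B by (simp add: length_A)

text \<open>
  The indicator forms of the blocks are integral, and the values at one point of each block show
  that they extend to a unimodular matrix.
\<close>

lemma cayley_form_exists:
  assumes dec: "cayley_decomposition B (set Js)" and dist: "distinct Js"
  obtains U where "cayley_form (Suc d) A h U Js"
proof -
  let ?k = "length Js"
  have part: "partition_on {..<length A'} (set Js)"
    using dec dim_B unfolding cayley_decomposition_def by simp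
  have sub: "Js ! j \<subseteq> {..<length A'}" and ne: "Js ! j \<noteq> {}" if "j < ?k" for j
    using part nth_mem[OF that] unfolding partition_on_def by auto
  have "\<exists>g. g \<in> carrier_vec (Suc d) \<and> (\<forall>i<length A'. g \<bullet> (A ! i) = (if i \<in> Js ! j then 1 else 0))"
    if j: "j < ?k" for j
  proof -
    have "relation_on K (Js ! j) (\<lambda>i. 1)"
      using block_homogeneous[OF gale_B(2) dec two_le_dim_B pairs_B] nth_mem[OF j] by blast
    from integral_indicator_form[OF carr' nonempty(1) gen sub[OF j] this] show ?thesis by metis
  qed
  then obtain g where g: "\<And>j. j < ?k \<Longrightarrow> g j \<in> carrier_vec (Suc d)"
    "\<And>j i. j < ?k \<Longrightarrow> i < length A' \<Longrightarrow> g j \<bullet> (A ! i) = (if i \<in> Js ! j then 1 else 0)"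
    by metis
  have "\<exists>i. i \<in> Js ! j" if "j < ?k" for j using ne[OF that] by auto
  then obtain r where r: "\<And>j. j < ?k \<Longrightarrow> r j \<in> Js ! j" by metis
  have rn: "r j < length A'" if "j < ?k" for j using r[OF that] sub[OF that] by auto
  have Ai: "A ! i \<in> carrier_vec (Suc d)" if "i < length A'" for i using carr that length_A by auto
  have "r l \<in> Js ! j \<longleftrightarrow> j = l" if "j < ?k" "l < ?k" for j l
  proof -
    have "Js ! j \<inter> Js ! l = {}" if "j \<noteq> l"
      using disjointD[OF partition_onD2[OF part] nth_mem[OF \<open>j < ?k\<close>] nth_mem[OF \<open>l < ?k\<close>]]
        nth_eq_iff_index_eq[OF dist \<open>j < ?k\<close> \<open>l < ?k\<close>] that by simp
    then show ?thesis using r[OF \<open>l < ?k\<close>] by auto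
  qed
  then have dual: "g j \<bullet> (A ! r l) = (if j = l then 1 else 0)" if "j < ?k" "l < ?k" for j l
    using g(2)[OF that(1) rn[OF that(2)]] that by simp
  obtain U where U: "?k \<le> Suc d" "U \<in> unimodular (Suc d)"
    "\<And>j v. j < ?k \<Longrightarrow> v \<in> carrier_vec (Suc d) \<Longrightarrow> (U *\<^sub>v v) $ j = g j \<bullet> v"
    by (rule complete_to_unimodular[of ?k g "Suc d" "\<lambda>l. A ! r l"])
      (use g(1) Ai[OF rn] dual that in auto)
  have "cayley_form (Suc d) A h U Js"
  proof
    show "(U *\<^sub>v A ! i) $ j = (if i \<in> Js ! j then 1 else 0)" if "j < ?k" "i < length A" for j i
      using U(3)[OF that(1) Ai] g(2)[OF that(1)] that(2) length_A by simp
  qed (use carr nonempty(2) form U(1,2) dist part length_A in simp_all)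
  then show ?thesis by (rule that)
qed

lemma cayley_of_decomposition:
  assumes dec: "cayley_decomposition B (set Js)" and dist: "distinct Js"
  shows "\<exists>As. length As = length Js \<and> equivalent_to_cayley d A As
    \<and> (\<forall>j<length Js. constituent_codim (Suc d - length Js) As j = sub_dim B (Js ! j))
    \<and> cayley_excess (Suc d - length Js) As = decomposition_excess B (set Js)"
proof -
  obtain U where "cayley_form (Suc d) A h U Js" using cayley_form_exists[OF dec dist] .
  then interpret C: cayley_form "Suc d" A h U Js .
  have "0 < length Js" using dec unfolding cayley_decomposition_def by auto
  then show ?thesis
    using C.length_As C.equivalent_to_cayley_As[OF refl] C.constituent_codim_As C.cayley_excess_As
    by (intro exI[of _ C.As]) simp
qed

text \<open>
  The rows of the matrix of \<open>A\<close> are relations of \<open>B\<close>. If the excess is 0, they restrict to the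
  blocks, which says that the relations of \<open>A\<close> do.
\<close>

lemma join_of_decomposition:
  assumes dec: "cayley_decomposition B (set Js)" and dist: "distinct Js"
    and excess: "decomposition_excess B (set Js) = 0"
    and ranks: "\<And>J. J \<in> set Js \<Longrightarrow> sub_dim B J \<le> 3"
  shows "\<exists>As. length As = length Js \<and> equivalent_to_cayley d A As \<and> is_join (Suc d - length Js) As
    \<and> (\<forall>j<length Js. non_defective (Suc d - length Js) (As ! j)
        \<and> codim (Suc d - length Js) (As ! j) = int (sub_dim B (Js ! j)))"
proof -
  obtain U where "cayley_form (Suc d) A h U Js" using cayley_form_exists[OF dec dist] .
  then interpret C: cayley_form "Suc d" A h U Js .
  interpret C: split_cayley_form "Suc d" A h U Js
  proof
    fix j x assume j: "j < length Js" and x: "x \<in> K"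
    have "(\<Sum>i\<in>Js ! j. rat_of_int (A ! i $ t) * x i) = 0" if t: "t < Suc d" for t
    proof -
      have rel: "relation_on K {..<dim_row B} (\<lambda>i. rat_of_int (A ! i $ t))"
        unfolding relation_on_def dim_B
        using in_relations_iff[OF carr] t by (simp add: length_A mult.commute)
      have "relation_on K (Js ! j) (\<lambda>i. rat_of_int (A ! i $ t))"
        using excess_zero_relation_restricts[OF gale_B(2) dec two_le_dim_B pairs_B excess rel] nth_mem[OF j]
        by blast
      then show ?thesis using x unfolding relation_on_def by simp
    qed
    moreover have "(\<Sum>i<length A. (if i \<in> Js ! j then x i else 0) * rat_of_int (A ! i $ t))
        = (\<Sum>i\<in>Js ! j. rat_of_int (A ! i $ t) * x i)" for t
      using C.sum_restrict_block[OF j] by (simp add: mult.commute)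
    ultimately show "(\<lambda>i. if i \<in> Js ! j then x i else 0) \<in> K"
      unfolding in_relations_iff[OF carr] by simp
  qed
  have pos: "0 < length Js" using dec unfolding cayley_decomposition_def by auto
  have join: "is_join (Suc d - length Js) C.As"
  proof (rule C.is_join_As)
    fix z :: "int vec" assume "z \<in> carrier_vec (Suc d)"
    from homogenization_generates[OF carr' nonempty(1) gen this]
    show "\<exists>c. \<forall>t<Suc d. z $ t = (\<Sum>i<length A. c i * A ! i $ t)" unfolding length_A .
  qed
  have nd: "non_defective (Suc d - length Js) (C.As ! j)" if j: "j < length Js" for j
  proof (rule C.non_defective_As[OF j])
    show "indep_on K {i, l}" if "i < length A" "l < length A" "i \<noteq> l" for i l
      using pairs that by (simp add: length_A)
    have fin: "finite (Js ! j)" by (rule C.block_finite[OF j])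
    obtain I where I: "basis_on K (Js ! j) I" using basis_on_exists[OF fin] .
    have "Js ! j \<subseteq> {..<dim_row B}" using C.block_sub[OF j] dim_B length_A by simp
    from sub_dim_eq_card_basis[OF gale_B(2) this I] have "sub_dim B (Js ! j) \<le> card (Js ! j)"
      using card_mono[OF fin basis_onD(1)[OF I]] by simp
    moreover have "2 \<le> sub_dim B (Js ! j)"
      using block_rank_ge_2[OF gale_B(2) dec two_le_dim_B pairs_B] nth_mem[OF j] by blast
    ultimately show "2 \<le> card (Js ! j)" by simp
    show "sub_dim B (Js ! j) \<le> 3" by (rule ranks[OF nth_mem[OF j]])
  qed
  show ?thesis
    using C.length_As C.equivalent_to_cayley_As[OF refl pos] join nd C.codim_As
    by (intro exI[of _ C.As]) simp
qed

lemma defect_le: "2 * defect (Suc d) A \<le> codim (Suc d) A - 2"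
  using twice_gale_defect_le[OF gale_B(2) two_le_dim_B pairs_B hom_B] rank_B unfolding defect_def by simp

lemma join_of_extremal_even:
  assumes m: "codim (Suc d) A = 2 * int k" and \<theta>: "defect (Suc d) A = int k - 1"
  shows "\<exists>As. length As = k \<and> equivalent_to_cayley d A As \<and> is_join (Suc d - k) As
    \<and> (\<forall>j<k. non_defective (Suc d - k) (As ! j) \<and> codim (Suc d - k) (As ! j) = 2)"
proof -
  have "sub_dim B {..<dim_row B} = 2 * k" "gale_defect B = int k - 1"
    using rank_B m \<theta> unfolding defect_def by linarith+
  then obtain P where P: "cayley_decomposition B P" "card P = k" "decomposition_excess B P = 0"
    "\<And>J. J \<in> P \<Longrightarrow> sub_dim B J = 2"
    using extremal_decomposition_even[OF gale_B(2) two_le_dim_B pairs_B hom_B] by blast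
  have "finite P"
    using finite_decomposition[OF gale_B(2) P(1) two_le_dim_B pairs_B] by blast
  then obtain Js where Js: "set Js = P" "distinct Js" using finite_distinct_list by auto
  have k: "length Js = k" using distinct_card[OF Js(2)] Js(1) P(2) by simp
  have "sub_dim B (Js ! j) = 2" if "j < length Js" for j using P(4) Js(1) nth_mem[OF that] by simp
  then show ?thesis
    using join_of_decomposition[of Js] P Js k by auto
qed

lemma join_or_cayley_of_extremal_odd:
  assumes m: "codim (Suc d) A = 2 * int k + 1" and \<theta>: "defect (Suc d) A = int k - 1"
  shows "(\<exists>As. length As = k \<and> equivalent_to_cayley d A As \<and> is_join (Suc d - k) As
      \<and> (\<forall>j<k. non_defective (Suc d - k) (As ! j)
        \<and> codim (Suc d - k) (As ! j) = (if j = 0 then 3 else 2)))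
    \<or> (\<exists>As. length As = Suc k \<and> equivalent_to_cayley d A As
      \<and> (\<forall>j<Suc k. constituent_codim (d - k) As j = 2) \<and> cayley_excess (d - k) As = 1)"
    (is "?join \<or> ?cayley")
proof -
  have e: "sub_dim B {..<dim_row B} = 2 * k + 1" "gale_defect B = int k - 1"
    using rank_B m \<theta> unfolding defect_def by linarith+
  consider (join) P J0 where "cayley_decomposition B P" "card P = k" "decomposition_excess B P = 0"
      "J0 \<in> P" "sub_dim B J0 = 3" "\<And>J. J \<in> P \<Longrightarrow> J \<noteq> J0 \<Longrightarrow> sub_dim B J = 2"
    | (cayley) P where "cayley_decomposition B P" "card P = Suc k" "decomposition_excess B P = 1"
      "\<And>J. J \<in> P \<Longrightarrow> sub_dim B J = 2"
    by (rule extremal_decomposition_odd[OF gale_B(2) two_le_dim_B _ hom_B e], rule pairs_B,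
        assumption+, rule that(1), assumption+, rule that(2), assumption+)
  then show ?thesis
  proof cases
    case join
    have fin: "finite P"
      using finite_decomposition[OF gale_B(2) join(1) two_le_dim_B pairs_B] by blast
    then obtain Ls where Ls: "set Ls = P - {J0}" "distinct Ls" using finite_distinct_list[of "P - {J0}"] by auto
    define Js where "Js = J0 # Ls"
    have Js: "set Js = P" "distinct Js" using Ls join(4) by (auto simp: Js_def)
    have k: "length Js = k" using distinct_card[OF Js(2)] Js(1) join(2) by simp
    have "sub_dim B (Js ! j) = (if j = 0 then 3 else 2)" if "j < k" for j
    proof (cases j)
      case 0
      then show ?thesis using join(5) by (simp add: Js_def)
    next
      case (Suc l)
      then have "Js ! j \<in> P - {J0}" using that k Ls(1) nth_mem[of l Ls] by (simp add: Js_def)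
      then show ?thesis using join(6) Suc by simp
    qed
    moreover have "sub_dim B J \<le> 3" if "J \<in> set Js" for J
      using join(5) join(6)[of J] that Js(1) by (cases "J = J0") auto
    ultimately have ?join using join_of_decomposition[of Js] join(1,3) Js k by auto
    then show ?thesis ..
  next
    case cayley
    have fin: "finite P"
      using finite_decomposition[OF gale_B(2) cayley(1) two_le_dim_B pairs_B] by blast
    then obtain Js where Js: "set Js = P" "distinct Js" using finite_distinct_list by auto
    have k: "length Js = Suc k" using distinct_card[OF Js(2)] Js(1) cayley(2) by simp
    have "sub_dim B (Js ! j) = 2" if "j < Suc k" for j using cayley(4) Js(1) nth_mem[of j Js] k that by simp
    then have ?cayley using cayley_of_decomposition[of Js] cayley(1,3) Js k by auto
    then show ?thesis ..
  qed
qed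

end

text \<open>A single point is a pyramid, which leaves at least two points.\<close>

lemma non_pyramid_length_ge_2:
  assumes "A' \<noteq> []" and "\<not> pyramid (Suc d) (homogenization A')" and carr: "set A' \<subseteq> carrier_vec d"
  shows "2 \<le> length A'"
proof (rule ccontr)
  assume "\<not> 2 \<le> length A'"
  moreover have "0 < length A'" using assms(1) by simp
  ultimately have n: "length A' = 1" by linarith
  have "A' ! 0 \<in> carrier_vec d" using carr n by auto
  then have "unit_vec (Suc d) 0 \<bullet> map_vec rat_of_int (homogenization A' ! 0) = 1"
    using n by (subst scalar_prod_left_unit[of _ "Suc d"]) (auto simp: homogenization_nth)
  then have "pyramid (Suc d) (homogenization A')"
    unfolding pyramid_def homogenization_nth(2) n
    by (intro bexI[of _ "unit_vec (Suc d) 0"] exI[of _ 0]) auto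
  then show False using assms(2) by simp
qed

theorem proposition4p17:
  fixes d :: nat and A A' :: config
  assumes A'_carrier: "set A' \<subseteq> carrier_vec d"
    and A'_generates: "carrier (difference_group d A') = carrier_vec d"
    and A_eq: "A = homogenization A'"
    and dim_A: "affine_dim (Suc d) A = int d"
    and homogeneous_A: "homogeneous (Suc d) A"
    and non_pyramidal_A: "\<not> pyramid (Suc d) A"
    and irreducible_A: "irreducible_config (Suc d) A"
  shows "rat_of_int (defect (Suc d) A) \<le> (rat_of_int (codim (Suc d) A) - 2) / 2
    \<and> (\<forall>k::nat. codim (Suc d) A = 2 * int k \<and> defect (Suc d) A = int k - 1 \<longrightarrow>
         (\<exists>As. length As = k \<and> equivalent_to_cayley d A As \<and> is_join (Suc d - k) As
            \<and> (\<forall>j<k. non_defective (Suc d - k) (As ! j) \<and> codim (Suc d - k) (As ! j) = 2)))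
    \<and> (\<forall>k::nat. codim (Suc d) A = 2 * int k + 1 \<and> defect (Suc d) A = int k - 1 \<longrightarrow>
         (\<exists>As. length As = k \<and> equivalent_to_cayley d A As \<and> is_join (Suc d - k) As
            \<and> (\<forall>j<k. non_defective (Suc d - k) (As ! j)
                 \<and> codim (Suc d - k) (As ! j) = (if j = 0 then 3 else 2)))
         \<or> (\<exists>As. length As = Suc k \<and> equivalent_to_cayley d A As
            \<and> (\<forall>j<Suc k. constituent_codim (d - k) As j = 2)
            \<and> cayley_excess (d - k) As = 1))"
proof -
  have ne: "A' \<noteq> []" using dim_A unfolding A_eq affine_dim_def homogenization_def by auto
  have "indep_on (relations (Suc d) A) {i, j}" if "i < length A'" "j < length A'" "i \<noteq> j" for i j
    using irreducible_imp_pairs_independent[OF homogenization_carrier[OF A'_carrier], of i j]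
      irreducible_A that unfolding A_eq by (simp add: homogenization_nth(2))
  then interpret lattice_configuration d A'
    using A'_carrier A'_generates ne non_pyramidal_A non_pyramid_length_ge_2[of A' d]
    unfolding A_eq by unfold_locales auto
  have "2 * defect (Suc d) A \<le> codim (Suc d) A - 2"
    using defect_le unfolding A_eq .
  then have "2 * rat_of_int (defect (Suc d) A) \<le> rat_of_int (codim (Suc d) A) - 2"
    by (simp flip: of_int_le_iff[where 'a = rat])
  then show ?thesis using join_of_extremal_even join_or_cayley_of_extremal_odd unfolding A_eq by auto
qed

end
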